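(* Let $\mathsf L_0=K(X,Y)\in\mathrm{Sym}^+(\mathcal T)$. Then all isotropic polycrystals made of the single crystallite $\mathsf L_0$ have the same effective tensor $\mathsf L^*$, regardless of texture; that is, $\mathsf L^*$ is uniquely determined by $\mathsf L_0$. Moreover $\mathsf L^*=K(L^*,0)$, where $L^*$ is a positive definite complex Hermitian $2\times2$ matrix satisfying \[ X-L^*=Y(\overline X+L^* )^{-1}\overline Y . \] It is given by \[ L^*=(\mathsf I+\theta\mathfrak B_Y)^{-1}(X+\overline X)-\overline X>0, \] where $\mathfrak B_Y$ is the real-linear operator on Hermitian $2\times2$ matrices $\mathfrak B_YZ=Y\,\mathrm{cof}(Z)^TY^H$, $\mathsf I$ is the identity operator on Hermitian matrices, and $\theta$ is a positive root of \[ \theta\det\big[(\mathsf I+\theta\mathfrak B_Y)^{-1}(X+\overline X)\big]=1 \] for which the matrix $(\mathsf I+\theta\mathfrak B_Y)^{-1}(X+\overline X)-\overline X$ is positive definite.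
   Context: Let $\mathcal T=\mathbb R^2\oplus\mathbb R^2$, identified with $\mathbb C^2$ via $(\mathbf u,\mathbf v)\mapsto(u_1+iu_2,v_1+iv_2)$. Each real-linear operator on $\mathcal T$ is uniquely of the form $K(X,Y)u=Xu+Y\overline u$, $u\in\mathbb C^2$, with complex $2\times2$ matrices $X,Y$; it is symmetric iff $X^H=X$ and $Y^T=Y$ (where $X^H=\overline X^T$). $\mathrm{Sym}^+(\mathcal T)$ is the set of symmetric positive definite operators. $\mathrm{cof}(Z)$ is the cofactor matrix, so $\mathrm{cof}(Z)^T=(\det Z)Z^{-1}$ for invertible $Z$. A rotation $R_\theta\in SO(2)$ by angle $\theta$ acts by $R_\theta\cdot K(X,Y)=K(X,e^{2i\theta}Y)$; an operator is isotropic if it is invariant under all rotations, i.e. of the form $K(X,0)$. A composite is a $[0,1]^2$-periodic measurable map $\mathsf L:\mathbb R^2\to\mathrm{Sym}^+(\mathcal T)$ with values in a compact subset of $\mathrm{Sym}^+(\mathcal T)$. Its effective tensor $\mathsf L^*\in\mathrm{Sym}^+(\mathcal T)$ is defined by $\mathsf L^*E_0=\int_{[0,1]^2}\mathsf L(x)E(x)\,dx$ for $E_0\in\mathcal T$, where $E=E_0+(\nabla\varphi_1,\nabla\varphi_2)$ with $\varphi_1,\varphi_2\in H^1_{\rm per}$ is the unique such field for which both $\mathbb R^2$-components of $\mathsf L E$ are divergence-free. An isotropic polycrystal made of $\mathsf L_0$ is a composite of the form $\mathsf L(x)=R(x)\cdot\mathsf L_0$ with $R(x)\in SO(2)$ measurable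 (the texture), whose effective tensor is isotropic. *)

theory Defs
  imports "HOL-Analysis.Analysis"
begin

section \<open>Complex matrices\<close>

definition cnj_vec :: "complex^2 \<Rightarrow> complex^2" where
  "cnj_vec u = (\<chi> i. cnj (u $ i))"

abbreviation cnj_mat :: "complex^2^2 \<Rightarrow> complex^2^2" where
  "cnj_mat A \<equiv> map_matrix cnj A"

definition ctranspose :: "complex^2^2 \<Rightarrow> complex^2^2" where
  "ctranspose A = transpose (cnj_mat A)"

definition hermitian_mats :: "(complex^2^2) set" where
  "hermitian_mats = {A. ctranspose A = A}"

text \<open>The quadratic form \<open>u\<^sup>H A u\<close> is real for Hermitian \<open>A\<close>, so taking \<open>Re\<close> loses nothing.\<close>

definition pos_def_hermitian :: "complex^2^2 \<Rightarrow> bool" where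
  "pos_def_hermitian A \<longleftrightarrow> A \<in> hermitian_mats \<and>
     (\<forall>u. u \<noteq> 0 \<longrightarrow> 0 < Re (\<Sum>i\<in>UNIV. cnj (u $ i) * (A *v u) $ i))"

definition cof :: "complex^2^2 \<Rightarrow> complex^2^2" where
  "cof Z = vector [vector [Z $ 2 $ 2, - Z $ 2 $ 1], vector [- Z $ 1 $ 2, Z $ 1 $ 1]]"

lemma cof_mult: "transpose (cof Z) ** Z = mat (det Z)" "Z ** transpose (cof Z) = mat (det Z)"
  by (auto simp: vec_eq_iff forall_2 cof_def transpose_def matrix_matrix_mult_def sum_2 mat_def
        det_2 algebra_simps)

definition BY :: "complex^2^2 \<Rightarrow> complex^2^2 \<Rightarrow> complex^2^2" where
  "BY Y Z = Y ** transpose (cof Z) ** ctranspose Y"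

definition I_plus_BY :: "real \<Rightarrow> complex^2^2 \<Rightarrow> complex^2^2 \<Rightarrow> complex^2^2" where
  "I_plus_BY \<theta> Y Z = Z + \<theta> *\<^sub>R BY Y Z"

text \<open>\<open>(I + \<theta> B\<^sub>Y)\<inverse> (X + cnj X)\<close>, the inverse being that of an operator on the space of
  Hermitian matrices; it is only meaningful when that operator is bijective.\<close>

definition theta_matrix :: "complex^2^2 \<Rightarrow> complex^2^2 \<Rightarrow> real \<Rightarrow> complex^2^2" where
  "theta_matrix X Y \<theta> = inv_into hermitian_mats (I_plus_BY \<theta> Y) (X + cnj_mat X)"

definition admissible_theta :: "complex^2^2 \<Rightarrow> complex^2^2 \<Rightarrow> real \<Rightarrow> bool" where
  "admissible_theta X Y \<theta> \<longleftrightarrow>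
     0 < \<theta> \<and>
     bij_betw (I_plus_BY \<theta> Y) hermitian_mats hermitian_mats \<and>
     of_real \<theta> * det (theta_matrix X Y \<theta>) = 1 \<and>
     pos_def_hermitian (theta_matrix X Y \<theta> - cnj_mat X)"

section \<open>Operators on \<open>\<real>\<^sup>2 \<oplus> \<real>\<^sup>2\<close>, identified with \<open>\<complex>\<^sup>2\<close>\<close>

text \<open>The real inner product of the type \<^typ>\<open>complex^2\<close> is the Euclidean inner product of
  \<open>\<real>\<^sup>2 \<oplus> \<real>\<^sup>2\<close> under \<open>(u, v) \<mapsto> (u\<^sub>1 + \<i> u\<^sub>2, v\<^sub>1 + \<i> v\<^sub>2)\<close>.\<close>

definition cplx :: "real^2 \<Rightarrow> complex" where
  "cplx w = Complex (w $ 1) (w $ 2)"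

definition uncplx :: "complex \<Rightarrow> real^2" where
  "uncplx z = vector [Re z, Im z]"

type_synonym operator = "(complex^2) \<Rightarrow>\<^sub>L (complex^2)"

definition K :: "complex^2^2 \<Rightarrow> complex^2^2 \<Rightarrow> operator" where
  "K X Y = Blinfun (\<lambda>u. X *v u + Y *v cnj_vec u)"

definition Sym_pos :: "operator set" where
  "Sym_pos = {L. (\<forall>u v. blinfun_apply L u \<bullet> v = u \<bullet> blinfun_apply L v) \<and>
                 (\<forall>u. u \<noteq> 0 \<longrightarrow> 0 < blinfun_apply L u \<bullet> u)}"

text \<open>A planar matrix acts on both \<open>\<real>\<^sup>2\<close>-components of an element of \<open>\<real>\<^sup>2 \<oplus> \<real>\<^sup>2\<close>, and a
  rotation acts on operators by conjugation.\<close>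

definition planar_act :: "real^2^2 \<Rightarrow> complex^2 \<Rightarrow> complex^2" where
  "planar_act R u = (\<chi> k. cplx (R *v uncplx (u $ k)))"

definition rot_act :: "real^2^2 \<Rightarrow> operator \<Rightarrow> operator" where
  "rot_act R L = Blinfun (\<lambda>u. planar_act R (blinfun_apply L (planar_act (transpose R) u)))"

definition isotropic :: "operator \<Rightarrow> bool" where
  "isotropic L \<longleftrightarrow> (\<forall>R. rotation_matrix R \<longrightarrow> rot_act R L = L)"

definition rot :: "real \<Rightarrow> real^2^2" where
  "rot \<theta> = vector [vector [cos \<theta>, - sin \<theta>], vector [sin \<theta>, cos \<theta>]]"

lemma K_apply: "blinfun_apply (K X Y) u = X *v u + Y *v cnj_vec u"
proof -
  have "linear (\<lambda>u. X *v u + Y *v cnj_vec u)"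
    by (rule linearI)
      (auto simp: vec_eq_iff cnj_vec_def matrix_vector_mult_def sum_2 complex_eq_iff algebra_simps)
  then show ?thesis
    by (simp add: K_def bounded_linear_Blinfun_apply linear_conv_bounded_linear)
qed

lemma rot_act_apply:
  "blinfun_apply (rot_act R L) u = planar_act R (blinfun_apply L (planar_act (transpose R) u))"
proof -
  have "linear (planar_act R)" for R
    by (rule linearI)
      (auto simp: vec_eq_iff planar_act_def cplx_def uncplx_def matrix_vector_mult_def sum_2
        complex_eq_iff algebra_simps)
  then have "bounded_linear (planar_act R)" for R
    by (simp add: linear_conv_bounded_linear)
  then have "bounded_linear (\<lambda>u. planar_act R (blinfun_apply L (planar_act (transpose R) u)))"
    using bounded_linear_compose[OF _ bounded_linear_compose[OF blinfun.bounded_linear_right]]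
    by blast
  then show ?thesis
    by (simp add: rot_act_def bounded_linear_Blinfun_apply)
qed

lemma planar_act_rot: "planar_act (rot \<theta>) u = cis \<theta> *s u"
  and planar_act_rot_transpose: "planar_act (transpose (rot \<theta>)) u = cis (-\<theta>) *s u"
  by (auto simp: vec_eq_iff forall_2 planar_act_def cplx_def uncplx_def rot_def transpose_def
      matrix_vector_mult_def sum_2 complex_eq_iff algebra_simps)

lemma rot_act_K: "rot_act (rot \<theta>) (K X Y) = K X (map_matrix (\<lambda>z. cis (2 * \<theta>) * z) Y)"
proof (rule blinfun_eqI)
  fix u
  have cnj: "cnj_vec (cis (-\<theta>) *s u) = cis \<theta> *s cnj_vec u"
    by (simp add: vec_eq_iff cnj_vec_def cis_cnj)
  have double: "cis \<theta> * cis \<theta> = cis (2 * \<theta>)"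
    by (simp add: cis_mult)
  have cancel: "cis \<theta> * cis (-\<theta>) = 1"
    by (simp add: cis_mult)
  have scale: "map_matrix (\<lambda>z. c * z) Y *v w = c *s (Y *v w)" for c w
    by (simp add: vec_eq_iff matrix_vector_mult_def sum_distrib_left mult.assoc)
  show "blinfun_apply (rot_act (rot \<theta>) (K X Y)) u
      = blinfun_apply (K X (map_matrix (\<lambda>z. cis (2 * \<theta>) * z) Y)) u"
    unfolding rot_act_apply K_apply planar_act_rot planar_act_rot_transpose cnj
      vector_scalar_commute scale vector_add_ldistrib vector_smult_assoc double cancel
    by simp
qed

section \<open>Periodic functions and the Sobolev space \<open>H\<^sup>1\<^sub>p\<^sub>e\<^sub>r\<close>\<close>

definition unit_square :: "(real^2) set" where
  "unit_square = {x. \<forall>i. 0 \<le> x $ i \<and> x $ i \<le> 1}"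

definition periodic :: "(real^2 \<Rightarrow> 'b) \<Rightarrow> bool" where
  "periodic f \<longleftrightarrow> (\<forall>x i. f (x + axis i 1) = f x)"

text \<open>\<open>F i j\<close> is the partial derivative of order \<open>i\<close> in \<open>x\<^sub>1\<close> and \<open>j\<close> in \<open>x\<^sub>2\<close>.\<close>

definition C_infinity :: "(real^2 \<Rightarrow> real) \<Rightarrow> bool" where
  "C_infinity \<psi> \<longleftrightarrow> (\<exists>F :: nat \<Rightarrow> nat \<Rightarrow> real^2 \<Rightarrow> real. F 0 0 = \<psi> \<and>
     (\<forall>i j x. (F i j has_derivative (\<lambda>h. h $ 1 * F (Suc i) j x + h $ 2 * F i (Suc j) x)) (at x)))"

definition test_function :: "(real^2 \<Rightarrow> real) \<Rightarrow> bool" where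
  "test_function \<psi> \<longleftrightarrow> C_infinity \<psi> \<and> periodic \<psi>"

definition grad :: "(real^2 \<Rightarrow> real) \<Rightarrow> real^2 \<Rightarrow> real^2" where
  "grad \<psi> x = (\<chi> i. frechet_derivative \<psi> (at x) (axis i 1))"

definition L2_per :: "(real^2 \<Rightarrow> 'b::euclidean_space) \<Rightarrow> bool" where
  "L2_per f \<longleftrightarrow> periodic f \<and> f \<in> borel_measurable lebesgue \<and>
     set_integrable lebesgue unit_square (\<lambda>x. (norm (f x))\<^sup>2)"

text \<open>\<open>\<phi>\<close> belongs to \<open>H\<^sup>1\<^sub>p\<^sub>e\<^sub>r\<close> and has the weak gradient \<open>G\<close>. Testing against periodic
  functions over one period is the distributional derivative on the torus.\<close>

definition H1_per_with_grad :: "(real^2 \<Rightarrow> real) \<Rightarrow> (real^2 \<Rightarrow> real^2) \<Rightarrow> bool" where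
  "H1_per_with_grad \<phi> G \<longleftrightarrow> L2_per \<phi> \<and> L2_per G \<and>
     (\<forall>\<psi>. test_function \<psi> \<longrightarrow>
        (LINT x:unit_square|lebesgue. \<phi> x *\<^sub>R grad \<psi> x) =
        - (LINT x:unit_square|lebesgue. \<psi> x *\<^sub>R G x))"

definition weakly_div_free :: "(real^2 \<Rightarrow> real^2) \<Rightarrow> bool" where
  "weakly_div_free w \<longleftrightarrow>
     (\<forall>\<psi>. test_function \<psi> \<longrightarrow> (LINT x:unit_square|lebesgue. w x \<bullet> grad \<psi> x) = 0)"

section \<open>Composites, effective tensors, polycrystals\<close>

definition composite :: "(real^2 \<Rightarrow> operator) \<Rightarrow> bool" where
  "composite L \<longleftrightarrow> periodic L \<and> L \<in> borel_measurable lebesgue \<and>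
     (\<exists>C. compact C \<and> C \<subseteq> Sym_pos \<and> (\<forall>x. L x \<in> C))"

definition cell_field :: "(real^2 \<Rightarrow> operator) \<Rightarrow> complex^2 \<Rightarrow> (real^2 \<Rightarrow> complex^2) \<Rightarrow> bool" where
  "cell_field L E0 E \<longleftrightarrow>
     (\<exists>\<phi>1 \<phi>2 G1 G2. H1_per_with_grad \<phi>1 G1 \<and> H1_per_with_grad \<phi>2 G2 \<and>
        E = (\<lambda>x. E0 + vector [cplx (G1 x), cplx (G2 x)])) \<and>
     (\<forall>k. weakly_div_free (\<lambda>x. uncplx (blinfun_apply (L x) (E x) $ k)))"

text \<open>\<open>Ls\<close> is the effective tensor of the composite \<open>L\<close>. The cell field exists and is unique up
  to null sets for every composite, so this relation is functional on composites.\<close>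

definition effective_tensor :: "(real^2 \<Rightarrow> operator) \<Rightarrow> operator \<Rightarrow> bool" where
  "effective_tensor L Ls \<longleftrightarrow>
     (\<forall>E0. \<exists>E. cell_field L E0 E \<and>
        blinfun_apply Ls E0 = (LINT x:unit_square|lebesgue. blinfun_apply (L x) (E x)))"

definition polycrystal :: "operator \<Rightarrow> (real^2 \<Rightarrow> operator) \<Rightarrow> bool" where
  "polycrystal L0 L \<longleftrightarrow> composite L \<and>
     (\<exists>R. R \<in> borel_measurable lebesgue \<and> (\<forall>x. rotation_matrix (R x)) \<and>
        L = (\<lambda>x. rot_act (R x) L0))"

definition isotropic_polycrystal :: "operator \<Rightarrow> (real^2 \<Rightarrow> operator) \<Rightarrow> operator \<Rightarrow> bool" where
  "isotropic_polycrystal L0 L Ls \<longleftrightarrow> polycrystal L0 L \<and> effective_tensor L Ls \<and> isotropic Ls"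

end

theory Submission
  imports Defs
begin

text \<open>Write the solution of the fixed point equation as \<open>L\<^sup>* = A + \<i> P\<close> with \<open>A\<close>, \<open>P\<close> real, put
  \<open>S = cnj X + L\<^sup>*\<close>, and for a cell field \<open>E\<close> with flux \<open>J\<close> let \<open>J\<^sub>t = J - \<i> P E\<close>, which is again
  divergence-free. The fixed point equation turns the constitutive law into the Beltrami system
  \<open>J\<^sub>t - A E = q Y S\<^bsup>-1\<^esup> cnj (J\<^sub>t + A E)\<close> with \<open>|q| = 1\<close>. Hence \<open>J\<^sub>t \<bullet> E\<close> is nonnegative, and for two
  cell fields the null Lagrangians \<open>\<i> A\<^bsup>-1\<^esup> J\<^sub>t \<bullet> J\<^sub>t'\<close> and \<open>\<i> A E \<bullet> E'\<close> agree. Averaging by the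
  div-curl lemma, the complex-linear symmetric operator \<open>T = L\<^sub>s - \<i> P\<close> satisfies \<open>T \<ge> 0\<close> and
  \<open>T A\<^bsup>-1\<^esup> T = A\<close>, which forces \<open>T = A\<close>.

  The solution exists by Brouwer's theorem on \<open>0 \<le> M \<le> X\<close>, because the right-hand side
  \<open>X - Y (cnj X + M)\<^bsup>-1\<^esup> cnj Y\<close> is a Schur complement of the positive block matrix of \<open>K X Y\<close>; the same
  variational characterisation gives uniqueness among positive definite matrices. The roots \<open>\<theta>\<close>
  are exactly the reciprocals of \<open>det S\<close>.\<close>

section \<open>Fourier modes on the periodicity cell\<close>

text \<open>The texture enters pointwise only through the unimodular factor \<open>q\<close>, so the
  averages used must not see \<open>q\<close>. The splitting into \<open>A\<close> and
  \<open>P\<close> arranges this: the fixed point equation makes A^-1 Y S^-1 complex symmetric, and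
  for every \<open>q\<close> this symmetry cancels against the skewness of \<i> A^-1. Isotropy acts
  through the quarter turn alone: T commutes with \<i>, which turns the averaged identity T \<i>
  A^-1 T = \<i> A into T A^-1 T = A.

  Divergence and gradient are given weakly, by pairing with smooth periodic functions, so the
  div-curl lemma is read off Fourier coefficients: a divergence-free one is orthogonal to its
  frequency, a gradient one parallel to it, and only the means survive. The price is completeness of
  the Fourier modes.

  Existence of a root meets a separate obstacle: I + \<theta> B_Y must be invertible on Hermitian
  matrices. It is when \<theta> |det Y| < 1, and at \<theta> = 1 / det S this bound follows by
  comparing the determinants of X - M and cnj S.\<close>

abbreviation cell :: "(real^2) measure" where
  "cell \<equiv> lebesgue_on unit_square"

lemma unit_square_eq_cbox: "unit_square = cbox 0 (vec 1)"
  by (auto simp: unit_square_def mem_box_cart)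

lemma unit_square_lmeasurable: "unit_square \<in> lmeasurable"
  by (simp add: unit_square_eq_cbox)

lemma unit_square_sets [measurable, simp]: "unit_square \<in> sets lebesgue"
  using unit_square_lmeasurable by (rule fmeasurableD)

lemma finite_measure_cell: "finite_measure cell"
  by (rule finite_measure_lebesgue_on[OF unit_square_lmeasurable])

lemma space_cell [simp]: "space cell = unit_square"
  by simp

lemma set_integral_cell:
  fixes f :: "real^2 \<Rightarrow> 'b::{banach, second_countable_topology}"
  shows "(LINT x:unit_square|lebesgue. f x) = (\<integral>x. f x \<partial>cell)"
  by (simp add: set_lebesgue_integral_def integral_restrict_space)

definition fmode :: "int \<times> int \<Rightarrow> real^2 \<Rightarrow> complex" where
  "fmode k x = cis (2 * pi * (real_of_int (fst k) * x $ 1 + real_of_int (snd k) * x $ 2))"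

lemma norm_fmode [simp]: "norm (fmode k x) = 1"
  by (simp add: fmode_def)

lemma fmode_0 [simp]: "fmode 0 x = 1"
  by (simp add: fmode_def)

lemma fmode_add: "fmode (k + l) x = fmode k x * fmode l x"
  by (simp add: fmode_def cis_mult algebra_simps)

lemma cnj_fmode: "cnj (fmode k x) = fmode (- k) x"
  by (simp add: fmode_def cis_cnj algebra_simps)

lemma fmode_mult_cnj: "fmode k x * cnj (fmode l x) = fmode (k - l) x"
  using fmode_add[of k "-l" x] by (simp add: cnj_fmode)

lemma continuous_on_fmode: "continuous_on S (fmode k)"
  unfolding fmode_def by (intro continuous_intros)

lemma fmode_measurable [measurable]: "fmode k \<in> borel_measurable borel"
  by (intro borel_measurable_continuous_onI continuous_on_fmode)

lemma measurable_cellI: "f \<in> borel_measurable borel \<Longrightarrow> f \<in> borel_measurable cell"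
  by (rule measurable_restrict_space1) (rule measurable_completion, simp)

lemma fmode_measurable_cell [measurable]: "fmode k \<in> borel_measurable cell"
  by (rule measurable_cellI) simp

lemma integral_cis_unit_interval:
  "(\<integral>t. indicator {0..1} t *\<^sub>R cis (2 * pi * real_of_int m * t) \<partial>lborel) = (if m = 0 then 1 else 0)"
proof (cases "m = 0")
  case False
  let ?c = "2 * pi * real_of_int m"
  have c: "?c \<noteq> 0"
    using False by simp
  have "(\<integral>t. indicator {0..1} t *\<^sub>R cis (?c * t) \<partial>lborel)
      = cis (?c * 1) / (\<i> * ?c) - cis (?c * 0) / (\<i> * ?c)"
  proof (rule integral_FTC_Icc)
    show "((\<lambda>t. cis (?c * t) / (\<i> * ?c)) has_vector_derivative cis (?c * x)) (at x within {0..1})" for x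
    proof -
      have "((\<lambda>t. exp (\<i> * (?c * complex_of_real t)) / (\<i> * ?c)) has_vector_derivative
          exp (\<i> * (?c * of_real x)) ) (at x within {0..1})"
        using c
        by (auto intro!: derivative_eq_intros has_vector_derivative_real_field simp: field_simps)
      then show ?thesis
        by (simp add: cis_conv_exp)
    qed
    show "continuous_on {0..1} (\<lambda>t. cis (?c * t))"
      by (intro continuous_intros)
  qed simp
  also have "cis (?c * 1) = 1"
    using cis_multiple_2pi[of "real_of_int m"] by (simp add: mult.commute)
  finally show ?thesis
    using False by simp
qed simp

text \<open>Fubini: \<open>lborel\<close> is the image of a product measure indexed by
  \<open>Basis\<close>, and with the indicator of the square absorbed the integrand splits into one
  factor per basis vector. Hence \<open>F\<close> is indexed by vectors.\<close>

lemma integral_fmode: "(\<integral>x. fmode k x \<partial>cell) = (if k = 0 then 1 else 0)"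
proof -
  define F :: "real^2 \<Rightarrow> real \<Rightarrow> complex" where
    "F b t = indicator {0..1} t *\<^sub>R
       cis (2 * pi * real_of_int (if b = axis 1 1 then fst k else snd k) * t)" for b t
  have ax: "axis 1 1 \<noteq> (axis 2 1 :: real^2)"
    by (simp add: axis_eq_axis)
  have B: "Basis = {axis 1 1, axis 2 1 :: real^2}"
    by (auto simp: Basis_vec_def UNIV_2)
  interpret product_sigma_finite "\<lambda>b :: real^2. lborel :: real measure"
    by standard
  have intF: "integrable lborel (F b)" for b
    unfolding F_def
    by (rule borel_integrable_compact[unfolded set_integrable_def]) (auto intro!: continuous_intros)
  have [measurable]: "F b \<in> borel_measurable borel" for b
    using borel_measurable_integrable[OF intF] by simp
  have "(\<integral>x. fmode k x \<partial>cell) = (\<integral>x. indicator unit_square x *\<^sub>R fmode k x \<partial>lebesgue)"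
    by (simp add: integral_restrict_space)
  also have "\<dots> = (\<integral>x. indicator unit_square x *\<^sub>R fmode k x \<partial>lborel)"
    by (rule integral_completion) (simp add: unit_square_eq_cbox)
  also have "\<dots> = (\<integral>x. (\<Prod>b\<in>Basis. F b (x \<bullet> b)) \<partial>lborel)"
  proof (rule Bochner_Integration.integral_cong[OF refl])
    fix x :: "real^2"
    show "indicator unit_square x *\<^sub>R fmode k x = (\<Prod>b\<in>Basis. F b (x \<bullet> b))"
      using ax unfolding B
      by (auto simp: F_def fmode_def inner_axis unit_square_def forall_2 indicator_def cis_mult
          algebra_simps)
  qed
  also have "\<dots> = (\<integral>f. (\<Prod>b\<in>Basis. F b ((\<Sum>c\<in>Basis. f c *\<^sub>R c) \<bullet> b)) \<partial>(\<Pi>\<^sub>M b\<in>Basis. lborel))"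
    by (subst lborel_eq, subst integral_distr) auto
  also have "\<dots> = (\<integral>f. (\<Prod>b\<in>Basis. F b (f b)) \<partial>(\<Pi>\<^sub>M b\<in>Basis. lborel))"
    by (intro Bochner_Integration.integral_cong prod.cong refl) simp
  also have "\<dots> = (\<Prod>b\<in>Basis. integral\<^sup>L lborel (F b))"
    by (rule product_integral_prod) (auto simp: intF)
  also have "\<dots> = (if k = 0 then 1 else 0)"
    using ax unfolding B F_def by (auto simp: integral_cis_unit_interval prod_eq_iff)
  finally show ?thesis .
qed

section \<open>Square-integrable real functions\<close>

definition sq_integrable :: "'a measure \<Rightarrow> ('a \<Rightarrow> real) \<Rightarrow> bool" where
  "sq_integrable M f \<longleftrightarrow> f \<in> borel_measurable M \<and> integrable M (\<lambda>x. (f x)\<^sup>2)"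

lemma sq_integrable_measurable: "sq_integrable M f \<Longrightarrow> f \<in> borel_measurable M"
  by (simp add: sq_integrable_def)

lemma sq_integrable_bound:
  assumes "sq_integrable M f" "g \<in> borel_measurable M" "\<And>x. x \<in> space M \<Longrightarrow> \<bar>g x\<bar> \<le> \<bar>f x\<bar>"
  shows "sq_integrable M g"
  unfolding sq_integrable_def
proof (intro conjI)
  show "integrable M (\<lambda>x. (g x)\<^sup>2)"
    by (rule Bochner_Integration.integrable_bound[of _ "\<lambda>x. (f x)\<^sup>2"])
      (use assms in \<open>auto simp: sq_integrable_def abs_le_square_iff\<close>)
qed (rule assms)

lemma integrable_mult_sq_integrable:
  assumes "sq_integrable M f" "sq_integrable M g"
  shows "integrable M (\<lambda>x. f x * g x)"
proof (rule Bochner_Integration.integrable_bound[of _ "\<lambda>x. (f x)\<^sup>2 + (g x)\<^sup>2"])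
  have "\<bar>f x * g x\<bar> \<le> (f x)\<^sup>2 + (g x)\<^sup>2" for x
  proof -
    have "2 * (\<bar>f x\<bar> * \<bar>g x\<bar>) \<le> (f x)\<^sup>2 + (g x)\<^sup>2"
      using sum_squares_bound[of "\<bar>f x\<bar>" "\<bar>g x\<bar>"] by (simp add: mult.assoc)
    moreover have "0 \<le> \<bar>f x\<bar> * \<bar>g x\<bar>" by simp
    ultimately show ?thesis unfolding abs_mult by linarith
  qed
  then show "AE x in M. norm (f x * g x) \<le> norm ((f x)\<^sup>2 + (g x)\<^sup>2)"
    by auto
qed (use assms in \<open>auto simp: sq_integrable_def\<close>)

lemma sq_integrable_cmult: "sq_integrable M f \<Longrightarrow> sq_integrable M (\<lambda>x. c * f x)"
  by (auto simp: sq_integrable_def power_mult_distrib)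

lemma sq_integrable_add:
  assumes "sq_integrable M f" "sq_integrable M g"
  shows "sq_integrable M (\<lambda>x. f x + g x)"
  using assms integrable_mult_sq_integrable[OF assms]
  by (auto simp: sq_integrable_def power2_sum mult.assoc)

lemma sq_integrable_diff:
  assumes "sq_integrable M f" "sq_integrable M g"
  shows "sq_integrable M (\<lambda>x. f x - g x)"
  using sq_integrable_add[OF assms(1) sq_integrable_cmult[OF assms(2), of "-1"]] by simp

lemma (in finite_measure) sq_integrable_bounded:
  assumes "f \<in> borel_measurable M" "\<And>x. x \<in> space M \<Longrightarrow> \<bar>f x\<bar> \<le> B"
  shows "sq_integrable M f"
  by (rule sq_integrable_bound[of _ "\<lambda>_. B"])
    (use assms in \<open>auto simp: sq_integrable_def intro: order_trans[OF _ abs_ge_self]\<close>)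

lemma (in finite_measure) integrable_sq_integrable:
  assumes "sq_integrable M f"
  shows "integrable M f"
  using integrable_mult_sq_integrable[OF assms sq_integrable_bounded[of "\<lambda>_. 1" 1]] by simp

lemma sq_integrable_sum:
  assumes "\<And>i. i \<in> I \<Longrightarrow> sq_integrable M (f i)"
  shows "sq_integrable M (\<lambda>x. \<Sum>i\<in>I. f i x)"
proof (cases "finite I")
  case True
  then show ?thesis
    using assms by induction (auto intro: sq_integrable_add simp: sq_integrable_def[of M "\<lambda>_. 0"])
qed (simp add: sq_integrable_def)

section \<open>Fourier coefficients and Bessel's identity\<close>

definition fcoef :: "(real^2 \<Rightarrow> real) \<Rightarrow> int \<times> int \<Rightarrow> complex" where
  "fcoef a k = (\<integral>x. complex_of_real (a x) * cnj (fmode k x) \<partial>cell)"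

lemma integrable_fmode: "integrable cell (fmode k)"
proof -
  interpret finite_measure cell by (rule finite_measure_cell)
  show ?thesis by (rule integrable_const_bound[of _ 1]) auto
qed

lemma integrable_mult_fmode:
  fixes f :: "real^2 \<Rightarrow> complex"
  assumes "integrable cell f"
  shows "integrable cell (\<lambda>x. f x * fmode k x)" "integrable cell (\<lambda>x. f x * cnj (fmode k x))"
proof -
  have [measurable]: "f \<in> borel_measurable cell" "(\<lambda>x. cnj (fmode k x)) \<in> borel_measurable cell"
    using assms by (simp_all add: cnj_fmode)
  show "integrable cell (\<lambda>x. f x * fmode k x)" "integrable cell (\<lambda>x. f x * cnj (fmode k x))"
    by (rule Bochner_Integration.integrable_bound[OF assms]; simp add: norm_mult)+
qed

lemma sq_integrable_cellD: "sq_integrable cell a \<Longrightarrow> integrable cell a"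
  using finite_measure.integrable_sq_integrable[OF finite_measure_cell] .

lemma sq_integrable_cell_bounded:
  assumes "f \<in> borel_measurable cell" "\<And>x. x \<in> unit_square \<Longrightarrow> \<bar>f x\<bar> \<le> B"
  shows "sq_integrable cell f"
  using finite_measure.sq_integrable_bounded[OF finite_measure_cell assms(1), of B] assms(2) by simp

lemma integral_diff_cnj_add:
  fixes u w z :: "'a \<Rightarrow> complex"
  assumes "integrable M u" "integrable M w" "integrable M z"
  shows "(\<integral>x. u x - w x - cnj (w x) + z x \<partial>M)
    = integral\<^sup>L M u - integral\<^sup>L M w - cnj (integral\<^sup>L M w) + integral\<^sup>L M z"
  using assms by simp

text \<open>Expansion of the square by orthonormality of the modes. The coefficients
  \<open>c\<close> stay arbitrary so that one identity serves twice: \<open>c = fcoef a\<close>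
  gives Bessel's inequality, and dropping the last, nonnegative sum shows that no \<open>c\<close>
  beats the Fourier coefficients.\<close>

lemma bessel_identity:
  assumes a: "sq_integrable cell a" and F: "finite F"
  shows "(\<integral>x. (norm (complex_of_real (a x) - (\<Sum>k\<in>F. c k * fmode k x)))\<^sup>2 \<partial>cell)
    = (\<integral>x. (a x)\<^sup>2 \<partial>cell) - (\<Sum>k\<in>F. (norm (fcoef a k))\<^sup>2) + (\<Sum>k\<in>F. (norm (fcoef a k - c k))\<^sup>2)"
proof -
  let ?p = "\<lambda>x. \<Sum>k\<in>F. c k * fmode k x"
  have ia: "integrable cell (\<lambda>x. complex_of_real (a x))"
    using sq_integrable_cellD[OF a] by simp
  have ia2: "integrable cell (\<lambda>x. (a x)\<^sup>2)"
    using a by (simp add: sq_integrable_def)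
  have i1: "integrable cell (\<lambda>x. complex_of_real (a x) * cnj (?p x))"
    by (auto simp: sum_distrib_left mult.left_commute intro!: Bochner_Integration.integrable_sum
        integrable_mult_right integrable_mult_fmode ia)
  have I1: "(\<integral>x. complex_of_real (a x) * cnj (?p x) \<partial>cell) = (\<Sum>k\<in>F. cnj (c k) * fcoef a k)"
    by (simp add: sum_distrib_left mult.left_commute fcoef_def Bochner_Integration.integral_sum
        integrable_mult_right integrable_mult_fmode ia)
  have i0: "integrable cell (\<lambda>x. complex_of_real ((a x)\<^sup>2))"
    using ia2 by (simp only: complex_of_real_integrable_eq)
  have pp: "?p x * cnj (?p x) = (\<Sum>k\<in>F. \<Sum>l\<in>F. c k * cnj (c l) * fmode (k - l) x)" for x
    by (simp add: sum_product fmode_mult_cnj[symmetric] mult_ac)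
  have i2: "integrable cell (\<lambda>x. ?p x * cnj (?p x))"
    unfolding pp by (intro Bochner_Integration.integrable_sum integrable_mult_right integrable_fmode)
  have I2: "(\<integral>x. ?p x * cnj (?p x) \<partial>cell) = (\<Sum>k\<in>F. c k * cnj (c k))"
    unfolding pp
    by (simp add: Bochner_Integration.integral_sum integrable_mult_right integrable_fmode
        integral_fmode if_distrib[of "\<lambda>z. _ * z"] sum.delta F cong: if_cong)
  have expand: "complex_of_real ((norm (complex_of_real t - p))\<^sup>2) = complex_of_real (t\<^sup>2)
      - complex_of_real t * cnj p - cnj (complex_of_real t * cnj p) + p * cnj p" for t p
    by (subst complex_norm_square) (simp add: algebra_simps power2_eq_square)
  have "complex_of_real (\<integral>x. (norm (complex_of_real (a x) - ?p x))\<^sup>2 \<partial>cell)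
      = (\<integral>x. complex_of_real ((a x)\<^sup>2) - complex_of_real (a x) * cnj (?p x)
           - cnj (complex_of_real (a x) * cnj (?p x)) + ?p x * cnj (?p x) \<partial>cell)"
    unfolding integral_complex_of_real[symmetric]
    by (intro Bochner_Integration.integral_cong refl expand)
  also have "\<dots> = complex_of_real (\<integral>x. (a x)\<^sup>2 \<partial>cell) - (\<Sum>k\<in>F. cnj (c k) * fcoef a k)
       - cnj (\<Sum>k\<in>F. cnj (c k) * fcoef a k) + (\<Sum>k\<in>F. c k * cnj (c k))"
    unfolding I1[symmetric] I2[symmetric]
    unfolding integral_diff_cnj_add[OF i0 i1 i2] integral_complex_of_real ..
  also have "\<dots> = complex_of_real ((\<integral>x. (a x)\<^sup>2 \<partial>cell) - (\<Sum>k\<in>F. (norm (fcoef a k))\<^sup>2)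
      + (\<Sum>k\<in>F. (norm (fcoef a k - c k))\<^sup>2))"
    by (simp only: of_real_add of_real_diff of_real_sum complex_norm_square complex_cnj_diff cnj_sum
        complex_cnj_mult complex_cnj_cnj sum.distrib sum_subtractf algebra_simps)
  finally show ?thesis
    unfolding of_real_eq_iff .
qed

section \<open>Completeness of the Fourier modes\<close>

text \<open>Generated inductively so that products are handled by induction; the finite sum over
  frequencies is recovered in \<open>trig_poly_normal_form\<close>.\<close>

inductive trig_poly :: "(real^2 \<Rightarrow> complex) \<Rightarrow> bool" where
  mode: "trig_poly (\<lambda>x. c * fmode k x)"
| add: "trig_poly p \<Longrightarrow> trig_poly q \<Longrightarrow> trig_poly (\<lambda>x. p x + q x)"

lemma trig_poly_const: "trig_poly (\<lambda>x. c)"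
  using trig_poly.mode[of c 0] by simp

lemma trig_poly_normal_form:
  "trig_poly p \<Longrightarrow> \<exists>F c. finite F \<and> p = (\<lambda>x. \<Sum>k\<in>F. c k * fmode k x)"
proof (induction rule: trig_poly.induct)
  case (mode c k)
  show ?case by (intro exI[of _ "{k}"] exI[of _ "\<lambda>_. c"]) simp
next
  case (add p q)
  then obtain F c G d where F: "finite F" "p = (\<lambda>x. \<Sum>k\<in>F. c k * fmode k x)"
    and G: "finite G" "q = (\<lambda>x. \<Sum>k\<in>G. d k * fmode k x)" by blast
  have "p x = (\<Sum>k\<in>F \<union> G. (if k \<in> F then c k else 0) * fmode k x)"
    "q x = (\<Sum>k\<in>F \<union> G. (if k \<in> G then d k else 0) * fmode k x)" for x
    unfolding F G by (rule sum.mono_neutral_cong_left; use F G in auto)+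
  then show ?case
    by (intro exI[of _ "F \<union> G"]
        exI[of _ "\<lambda>k. (if k \<in> F then c k else 0) + (if k \<in> G then d k else 0)"])
      (simp add: F(1) G(1) sum.distrib distrib_right)
qed

lemma trig_poly_mult:
  assumes "trig_poly p" "trig_poly q"
  shows "trig_poly (\<lambda>x. p x * q x)"
  using assms(1)
proof (induction rule: trig_poly.induct)
  case (mode c k)
  show ?case
    using assms(2)
  proof (induction rule: trig_poly.induct)
    case (mode d l)
    have "(\<lambda>x. c * fmode k x * (d * fmode l x)) = (\<lambda>x. c * d * fmode (k + l) x)"
      by (simp add: fmode_add mult_ac)
    then show ?case by (simp only: trig_poly.mode)
  qed (simp add: distrib_left trig_poly.add)
qed (simp add: distrib_right trig_poly.add)

lemma trig_poly_measurable: "trig_poly p \<Longrightarrow> p \<in> borel_measurable cell"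
  by (induction rule: trig_poly.induct) (simp_all add: fmode_measurable_cell)

lemma trig_poly_bounded: "trig_poly p \<Longrightarrow> \<exists>B. \<forall>x. norm (p x) \<le> B"
proof (induction rule: trig_poly.induct)
  case (mode c k)
  show ?case by (rule exI[of _ "norm c"]) (simp add: norm_mult)
next
  case (add p q)
  then show ?case by (meson add_mono norm_triangle_le)
qed

text \<open>Embedding of the torus in \<complex>^2. Its coordinates are themselves Fourier modes, so
  polynomials on the image are trigonometric polynomials and Stone-Weierstrass applies.\<close>

definition torus :: "real^2 \<Rightarrow> complex^2" where
  "torus x = (\<chi> i. cis (2 * pi * x $ i))"

lemma torus_nth: "torus x $ i = fmode (if i = 1 then (1, 0) else (0, 1)) x"
  using exhaust_2[of i] by (auto simp: torus_def fmode_def)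

lemma continuous_on_torus: "continuous_on S torus"
  unfolding torus_def by (intro continuous_intros)

text \<open>In the linear case a functional r Re z + s Im z of one coordinate is a combination of z
  and cnj z with the amplitudes (r - \<i> s) / 2 and (r + \<i> s) / 2, and conjugating a mode
  reverses its frequency.\<close>

lemma trig_poly_real_polynomial:
  assumes "real_polynomial_function g"
  shows "trig_poly (\<lambda>x. complex_of_real (g (torus x)))"
  using assms
proof (induction rule: real_polynomial_function.induct)
  case (linear f)
  interpret bounded_linear f by fact
  define c where "c i z = f (axis i z)" for i :: 2 and z :: complex
  have split: "axis i z = Re z *\<^sub>R axis i 1 + Im z *\<^sub>R axis i \<i>" for i :: 2 and z :: complex
    by (simp add: vec_eq_iff axis_def complex_eq_iff)
  have lin: "c i z = Re z * c i 1 + Im z * c i \<i>" for i z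
    unfolding c_def by (subst split) (simp add: add scaleR)
  have ax: "v = axis 1 (v $ 1) + axis 2 (v $ 2)" for v :: "complex^2"
    by (simp add: vec_eq_iff axis_def forall_2)
  have "f v = c 1 (v $ 1) + c 2 (v $ 2)" for v
    unfolding c_def by (subst ax) (rule add)
  moreover have "trig_poly (\<lambda>x. complex_of_real (c i (torus x $ i)))" for i
  proof -
    obtain k where k: "torus x $ i = fmode k x" for x
      using torus_nth by blast
    have "complex_of_real (c i (torus x $ i))
        = Complex (c i 1 / 2) (- c i \<i> / 2) * fmode k x
          + Complex (c i 1 / 2) (c i \<i> / 2) * fmode (- k) x" for x
    proof -
      have "complex_of_real (Re z * r + Im z * s)
          = Complex (r / 2) (- s / 2) * z + Complex (r / 2) (s / 2) * cnj z" for r s z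
        by (simp add: complex_eq_iff)
      then show ?thesis
        unfolding cnj_fmode[symmetric] k[symmetric] by (subst lin) (simp only:)
    qed
    then show ?thesis
      using trig_poly.add[OF trig_poly.mode trig_poly.mode] by presburger
  qed
  ultimately show ?case
    by (simp add: trig_poly.add)
next
  case (const c)
  show ?case by (rule trig_poly_const)
qed (simp_all add: trig_poly.add trig_poly_mult)

section \<open>Mean-square density of trigonometric polynomials\<close>

definition trig_approx :: "(real^2 \<Rightarrow> real) \<Rightarrow> bool" where
  "trig_approx f \<longleftrightarrow> sq_integrable cell f \<and>
     (\<forall>\<epsilon>>0. \<exists>p. trig_poly p \<and> (\<integral>x. (norm (complex_of_real (f x) - p x))\<^sup>2 \<partial>cell) < \<epsilon>)"

lemma trig_approxD: "trig_approx f \<Longrightarrow> sq_integrable cell f"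
  by (simp add: trig_approx_def)

lemma integrable_sq_diff_trig_poly:
  assumes "sq_integrable cell f" "trig_poly p"
  shows "integrable cell (\<lambda>x. (norm (complex_of_real (f x) - p x))\<^sup>2)"
proof -
  obtain B where B: "\<And>x. norm (p x) \<le> B" using trig_poly_bounded[OF assms(2)] by blast
  have m [measurable]: "p \<in> borel_measurable cell" "f \<in> borel_measurable cell"
    using assms trig_poly_measurable by (auto simp: sq_integrable_def)
  have "sq_integrable cell (\<lambda>x. Re (p x))" "sq_integrable cell (\<lambda>x. Im (p x))"
    using order_trans[OF abs_Re_le_cmod B] order_trans[OF abs_Im_le_cmod B]
    by (auto intro!: sq_integrable_cell_bounded[of _ B])
  then have "sq_integrable cell (\<lambda>x. f x - Re (p x))" "sq_integrable cell (\<lambda>x. Im (p x))"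
    using assms(1) by (auto intro: sq_integrable_diff)
  moreover have "(norm (complex_of_real (f x) - p x))\<^sup>2 = (f x - Re (p x))\<^sup>2 + (Im (p x))\<^sup>2" for x
    by (simp add: cmod_power2)
  ultimately show ?thesis
    by (simp add: sq_integrable_def)
qed

text \<open>Squared distances obey the triangle inequality up to a factor 2, which is harmless for
  density and explains the quarters of \<epsilon> below.\<close>

lemma norm_add_sq_le: "(norm (a + b))\<^sup>2 \<le> 2 * (norm a)\<^sup>2 + 2 * (norm b)\<^sup>2"
proof -
  have "(norm (a + b))\<^sup>2 \<le> (norm a + norm b)\<^sup>2"
    by (rule power_mono[OF norm_triangle_ineq]) simp
  also have "\<dots> \<le> 2 * (norm a)\<^sup>2 + 2 * (norm b)\<^sup>2"
    using sum_squares_bound[of "norm a" "norm b"] by (simp add: power2_sum)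
  finally show ?thesis .
qed

lemma trig_approx_add:
  assumes "trig_approx f" "trig_approx g"
  shows "trig_approx (\<lambda>x. f x + g x)"
  unfolding trig_approx_def
proof (intro conjI allI impI)
  show "sq_integrable cell (\<lambda>x. f x + g x)"
    using assms by (intro sq_integrable_add trig_approxD)
  fix \<epsilon> :: real assume \<epsilon>: "\<epsilon> > 0"
  then obtain p q where p: "trig_poly p" "(\<integral>x. (norm (complex_of_real (f x) - p x))\<^sup>2 \<partial>cell) < \<epsilon> / 4"
    and q: "trig_poly q" "(\<integral>x. (norm (complex_of_real (g x) - q x))\<^sup>2 \<partial>cell) < \<epsilon> / 4"
    using assms unfolding trig_approx_def by (meson divide_pos_pos zero_less_numeral)
  note i = integrable_sq_diff_trig_poly[OF trig_approxD[OF assms(1)] p(1)]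
    integrable_sq_diff_trig_poly[OF trig_approxD[OF assms(2)] q(1)]
  have "(\<integral>x. (norm (complex_of_real (f x + g x) - (p x + q x)))\<^sup>2 \<partial>cell)
      \<le> (\<integral>x. 2 * (norm (complex_of_real (f x) - p x))\<^sup>2
             + 2 * (norm (complex_of_real (g x) - q x))\<^sup>2 \<partial>cell)"
  proof (rule integral_mono)
    show "integrable cell (\<lambda>x. (norm (complex_of_real (f x + g x) - (p x + q x)))\<^sup>2)"
      by (intro integrable_sq_diff_trig_poly trig_poly.add p q sq_integrable_add trig_approxD assms)
    show "(norm (complex_of_real (f x + g x) - (p x + q x)))\<^sup>2
      \<le> 2 * (norm (complex_of_real (f x) - p x))\<^sup>2 + 2 * (norm (complex_of_real (g x) - q x))\<^sup>2" for x
      using norm_add_sq_le[of "complex_of_real (f x) - p x" "complex_of_real (g x) - q x"]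
      by (simp add: algebra_simps)
  qed (use i in auto)
  also have "\<dots> < \<epsilon>"
    using i p q by simp
  finally show "\<exists>p. trig_poly p \<and> (\<integral>x. (norm (complex_of_real (f x + g x) - p x))\<^sup>2 \<partial>cell) < \<epsilon>"
    using trig_poly.add[OF p(1) q(1)] by blast
qed

lemma trig_approx_limit:
  assumes f: "sq_integrable cell f"
    and lim: "\<And>\<epsilon>. \<epsilon> > 0 \<Longrightarrow> \<exists>g. trig_approx g \<and> (\<integral>x. (f x - g x)\<^sup>2 \<partial>cell) < \<epsilon>"
  shows "trig_approx f"
  unfolding trig_approx_def
proof (intro conjI allI impI f)
  fix \<epsilon> :: real assume \<epsilon>: "\<epsilon> > 0"
  then obtain g where g: "trig_approx g" "(\<integral>x. (f x - g x)\<^sup>2 \<partial>cell) < \<epsilon> / 4"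
    using lim[of "\<epsilon> / 4"] by auto
  with \<epsilon> obtain p where p: "trig_poly p" "(\<integral>x. (norm (complex_of_real (g x) - p x))\<^sup>2 \<partial>cell) < \<epsilon> / 4"
    unfolding trig_approx_def by (meson divide_pos_pos zero_less_numeral)
  have i: "integrable cell (\<lambda>x. (f x - g x)\<^sup>2)"
    using sq_integrable_diff[OF f trig_approxD[OF g(1)]] by (simp add: sq_integrable_def)
  note j = integrable_sq_diff_trig_poly[OF trig_approxD[OF g(1)] p(1)]
  have "(\<integral>x. (norm (complex_of_real (f x) - p x))\<^sup>2 \<partial>cell)
      \<le> (\<integral>x. 2 * (f x - g x)\<^sup>2 + 2 * (norm (complex_of_real (g x) - p x))\<^sup>2 \<partial>cell)"
  proof (rule integral_mono)
    show "integrable cell (\<lambda>x. (norm (complex_of_real (f x) - p x))\<^sup>2)"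
      by (intro integrable_sq_diff_trig_poly p f)
    show "(norm (complex_of_real (f x) - p x))\<^sup>2
      \<le> 2 * (f x - g x)\<^sup>2 + 2 * (norm (complex_of_real (g x) - p x))\<^sup>2" for x
      using norm_add_sq_le[of "complex_of_real (f x - g x)" "complex_of_real (g x) - p x"]
      unfolding norm_of_real by simp
  qed (use i j in auto)
  also have "\<dots> < \<epsilon>"
    using i j g p by simp
  finally show "\<exists>p. trig_poly p \<and> (\<integral>x. (norm (complex_of_real (f x) - p x))\<^sup>2 \<partial>cell) < \<epsilon>"
    using p by blast
qed

lemma trig_approx_0: "trig_approx (\<lambda>x. 0)"
  unfolding trig_approx_def
  by (auto intro!: exI[of _ "\<lambda>x. 0"] trig_poly_const simp: sq_integrable_def)

lemma trig_approx_cmult: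
  assumes "trig_approx f"
  shows "trig_approx (\<lambda>x. c * f x)"
proof (cases "c = 0")
  case False
  show ?thesis
    unfolding trig_approx_def
  proof (intro conjI allI impI)
    show "sq_integrable cell (\<lambda>x. c * f x)"
      using assms by (intro sq_integrable_cmult trig_approxD)
    fix \<epsilon> :: real assume \<epsilon>: "\<epsilon> > 0"
    then have "\<epsilon> / c\<^sup>2 > 0" using False by simp
    then obtain p where p: "trig_poly p" "(\<integral>x. (norm (complex_of_real (f x) - p x))\<^sup>2 \<partial>cell) < \<epsilon> / c\<^sup>2"
      using assms unfolding trig_approx_def by meson
    have "(norm (complex_of_real (c * f x) - complex_of_real c * p x))\<^sup>2
        = c\<^sup>2 * (norm (complex_of_real (f x) - p x))\<^sup>2" for x
      by (simp add: right_diff_distrib[symmetric] norm_mult power_mult_distrib)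
    then have "(\<integral>x. (norm (complex_of_real (c * f x) - complex_of_real c * p x))\<^sup>2 \<partial>cell) < \<epsilon>"
      using p(2) False by (simp add: field_simps)
    then show "\<exists>p. trig_poly p \<and> (\<integral>x. (norm (complex_of_real (c * f x) - p x))\<^sup>2 \<partial>cell) < \<epsilon>"
      using trig_poly_mult[OF trig_poly_const[of "complex_of_real c"] p(1)] by blast
  qed
qed (simp add: trig_approx_0)

lemma trig_approx_sum:
  assumes "\<And>i. i \<in> I \<Longrightarrow> trig_approx (f i)"
  shows "trig_approx (\<lambda>x. \<Sum>i\<in>I. f i x)"
proof (cases "finite I")
  case True
  then show ?thesis
    using assms by induction (auto intro: trig_approx_add trig_approx_0)
qed (simp add: trig_approx_0)

lemma trig_approx_cong:
  assumes "trig_approx f" "\<And>x. x \<in> unit_square \<Longrightarrow> f x = g x"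
  shows "trig_approx g"
proof -
  have "f \<in> borel_measurable cell \<longleftrightarrow> g \<in> borel_measurable cell"
    by (rule measurable_cong) (simp add: assms)
  moreover have "integrable cell (\<lambda>x. (f x)\<^sup>2) \<longleftrightarrow> integrable cell (\<lambda>x. (g x)\<^sup>2)"
    by (rule Bochner_Integration.integrable_cong) (simp_all add: assms)
  moreover have "(\<integral>x. (norm (complex_of_real (f x) - p x))\<^sup>2 \<partial>cell)
     = (\<integral>x. (norm (complex_of_real (g x) - p x))\<^sup>2 \<partial>cell)" for p
    by (rule Bochner_Integration.integral_cong) (simp_all add: assms)
  ultimately show ?thesis
    using assms(1) by (simp add: trig_approx_def sq_integrable_def)
qed

lemma measure_cell: "measure cell unit_square = 1"
  using integral_fmode[of 0] by (simp add: scaleR_conv_of_real)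

text \<open>Stone-Weierstrass on the compact image of the cell. As the cell has measure 1, a uniform
  error \<delta> is a mean-square error of at most \<delta>^2, and \<delta> = sqrt (\<epsilon> / 2)
  brings this below \<epsilon>.\<close>

lemma trig_approx_continuous:
  fixes h :: "complex^2 \<Rightarrow> real"
  assumes h: "continuous_on UNIV h"
  shows "trig_approx (\<lambda>x. h (torus x))"
proof -
  let ?f = "\<lambda>x. h (torus x)"
  have co: "continuous_on S ?f" for S
    using continuous_on_compose2[OF h continuous_on_torus] by blast
  have comp: "compact (torus ` unit_square)"
    by (rule compact_continuous_image[OF continuous_on_torus]) (simp add: unit_square_eq_cbox)
  obtain B where B: "\<And>x. x \<in> unit_square \<Longrightarrow> \<bar>?f x\<bar> \<le> B"
    using compact_imp_bounded[OF compact_continuous_image[OF continuous_on_subset[OF h] comp]]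
    by (auto simp: bounded_iff)
  have sq: "sq_integrable cell ?f"
    using B by (intro sq_integrable_cell_bounded[of _ B] measurable_cellI
        borel_measurable_continuous_onI co)
  show ?thesis
    unfolding trig_approx_def
  proof (intro conjI allI impI sq)
    fix \<epsilon> :: real assume \<epsilon>: "\<epsilon> > 0"
    define \<delta> where "\<delta> = sqrt (\<epsilon> / 2)"
    have \<delta>: "\<delta> > 0" "\<delta>\<^sup>2 < \<epsilon>" using \<epsilon> by (auto simp: \<delta>_def)
    obtain g where g: "real_polynomial_function g"
      "\<And>v. v \<in> torus ` unit_square \<Longrightarrow> \<bar>h v - g v\<bar> < \<delta>"
      using Stone_Weierstrass_real_polynomial_function[OF comp continuous_on_subset[OF h] \<delta>(1)]
      by blast
    let ?p = "\<lambda>x. complex_of_real (g (torus x))"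
    note p = trig_poly_real_polynomial[OF g(1)]
    have "(\<integral>x. (norm (complex_of_real (?f x) - ?p x))\<^sup>2 \<partial>cell) \<le> (\<integral>x. \<delta>\<^sup>2 \<partial>cell)"
    proof (rule integral_mono)
      show "(norm (complex_of_real (?f x) - ?p x))\<^sup>2 \<le> \<delta>\<^sup>2" if "x \<in> space cell" for x
      proof -
        have "\<bar>h (torus x) - g (torus x)\<bar> \<le> \<delta>" using g(2)[of "torus x"] that by force
        then have "norm (complex_of_real (?f x) - ?p x) \<le> \<delta>"
          unfolding of_real_diff[symmetric] norm_of_real .
        then show ?thesis by (rule power_mono) simp
      qed
    qed (use integrable_sq_diff_trig_poly[OF sq p] finite_measure.integrable_const[OF finite_measure_cell] in auto)
    also have "\<dots> = \<delta>\<^sup>2"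
      using measure_cell by simp
    finally show "\<exists>p. trig_poly p \<and> (\<integral>x. (norm (complex_of_real (?f x) - p x))\<^sup>2 \<partial>cell) < \<epsilon>"
      using p \<delta> by (intro exI[of _ ?p]) auto
  qed
qed

text \<open>\<open>torus\<close> identifies opposite edges, so one of the points has to be interior:
  coordinate differences then lie strictly between -1 and 1, where 0 is the only integer.\<close>

lemma torus_inj_interior:
  assumes "x \<in> unit_square" "y \<in> box 0 (vec 1)" "torus x = torus y"
  shows "x = y"
proof -
  have "x $ i = y $ i" for i
  proof -
    have "cis (2 * pi * x $ i) = cis (2 * pi * y $ i)"
      using assms(3) by (simp add: torus_def vec_eq_iff)
    then have "cis (2 * pi * (x $ i - y $ i)) = 1"
      by (simp add: right_diff_distrib cis_divide[symmetric])
    then obtain n :: int where "2 * pi * (x $ i - y $ i) = of_int (2 * n) * pi"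
      by (auto simp: cis_conv_exp exp_eq_1)
    then have "x $ i - y $ i = of_int n" by simp
    moreover have "0 \<le> x $ i" "x $ i \<le> 1" "0 < y $ i" "y $ i < 1"
      using assms(1,2) by (auto simp: unit_square_def mem_box_cart)
    ultimately show ?thesis by (cases "n = 0") auto
  qed
  then show ?thesis by (simp add: vec_eq_iff)
qed

text \<open>Dominated convergence with the bound 4 h^2, since |f - g n| \<le> 2 h. A
  square-integrable \<open>h\<close> in place of a constant admits unbounded limits.\<close>

lemma trig_approx_bounded_limit:
  assumes meas: "f \<in> borel_measurable cell"
    and g: "\<And>n. trig_approx (g n)"
    and lim: "\<And>x. x \<in> unit_square \<Longrightarrow> (\<lambda>n. g n x) \<longlonglongrightarrow> f x"
    and h: "sq_integrable cell h" "\<And>n x. x \<in> unit_square \<Longrightarrow> \<bar>g n x\<bar> \<le> h x"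
  shows "trig_approx f"
proof (rule trig_approx_limit)
  have fh: "\<bar>f x\<bar> \<le> h x" if "x \<in> unit_square" for x
    using h(2)[OF that] by (intro LIMSEQ_le_const2[OF tendsto_rabs[OF lim[OF that]]]) blast
  show sqf: "sq_integrable cell f"
    by (rule sq_integrable_bound[OF h(1) meas]) (use fh in force)
  have [measurable]: "g n \<in> borel_measurable cell" for n
    using trig_approxD[OF g] by (rule sq_integrable_measurable)
  have "(\<lambda>n. \<integral>x. (f x - g n x)\<^sup>2 \<partial>cell) \<longlonglongrightarrow> (\<integral>x. 0 \<partial>cell)"
  proof (rule integral_dominated_convergence[where w = "\<lambda>x. 4 * (h x)\<^sup>2"])
    show "integrable cell (\<lambda>x. 4 * (h x)\<^sup>2)"
      using h(1) by (simp add: sq_integrable_def)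
    show "AE x in cell. (\<lambda>n. (f x - g n x)\<^sup>2) \<longlonglongrightarrow> 0"
    proof (rule AE_I2)
      fix x assume "x \<in> space cell"
      then have "(\<lambda>n. (f x - g n x)\<^sup>2) \<longlonglongrightarrow> (f x - f x)\<^sup>2"
        by (intro tendsto_intros lim) simp
      then show "(\<lambda>n. (f x - g n x)\<^sup>2) \<longlonglongrightarrow> 0" by simp
    qed
    show "AE x in cell. norm ((f x - g n x)\<^sup>2) \<le> 4 * (h x)\<^sup>2" for n
    proof (rule AE_I2)
      fix x assume x: "x \<in> space cell"
      have "\<bar>f x - g n x\<bar> \<le> 2 * h x"
        using fh[of x] h(2)[of x n] x by simp
      then have "(f x - g n x)\<^sup>2 \<le> (2 * h x)\<^sup>2"
        by (metis abs_ge_zero power2_abs power_mono)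
      then show "norm ((f x - g n x)\<^sup>2) \<le> 4 * (h x)\<^sup>2"
        by (simp add: power_mult_distrib)
    qed
  qed (use meas in measurable)
  then have L: "(\<lambda>n. \<integral>x. (f x - g n x)\<^sup>2 \<partial>cell) \<longlonglongrightarrow> 0" by simp
  show "\<exists>g. trig_approx g \<and> (\<integral>x. (f x - g x)\<^sup>2 \<partial>cell) < \<epsilon>" if "\<epsilon> > 0" for \<epsilon>
    using order_tendstoD(2)[OF L that] g unfolding eventually_sequentially by blast
qed

text \<open>The cut-offs \<open>h n\<close> are continuous functions of the torus point and decrease
  to the indicator. \<open>C\<close> has to avoid the boundary, where a point outside
  \<open>C\<close> could share its image with a point of \<open>C\<close>.\<close>

lemma trig_approx_indicator_compact:
  assumes C: "compact C" "C \<subseteq> box 0 (vec 1)"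
  shows "trig_approx (indicator C)"
\<comment> \<open>For the empty set \<open>infdist\<close> is 0 by convention, and the cut-offs
  would be constantly 1.\<close>
proof (cases "C = {}")
  case False
  define h where "h n v = max 0 (1 - real n * infdist v (torus ` C))" for n v
  have comp: "compact (torus ` C)"
    by (rule compact_continuous_image[OF continuous_on_torus C(1)])
  show ?thesis
  proof (rule trig_approx_bounded_limit)
    have "C \<in> sets lebesgue"
      using lmeasurable_compact[OF C(1)] by (rule fmeasurableD)
    then show "indicator C \<in> borel_measurable cell"
      by (intro measurable_restrict_space1 borel_measurable_indicator)
    show "trig_approx (\<lambda>x. h n (torus x))" for n
      unfolding h_def by (intro trig_approx_continuous continuous_intros)
    show "sq_integrable cell (\<lambda>x. 1)"
      by (rule sq_integrable_cell_bounded[of _ 1]) auto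
    show "\<bar>h n (torus x)\<bar> \<le> 1" for n x
      by (simp add: h_def infdist_nonneg)
    show "(\<lambda>n. h n (torus x)) \<longlonglongrightarrow> indicator C x" if x: "x \<in> unit_square" for x
    proof (cases "x \<in> C")
      case True
      then show ?thesis by (simp add: h_def)
    next
      case out: False
      then have "torus x \<notin> torus ` C"
        using torus_inj_interior[OF x] C(2) by blast
      then have pos: "infdist (torus x) (torus ` C) > 0"
        using infdist_pos_not_in_closed[OF compact_imp_closed[OF comp]] False by blast
      obtain N where N: "1 / infdist (torus x) (torus ` C) < real N"
        using reals_Archimedean2 by blast
      have "h n (torus x) = indicator C x" if "n \<ge> N" for n
      proof -
        have "1 \<le> real n * infdist (torus x) (torus ` C)"
        proof -
          have "1 \<le> real N * infdist (torus x) (torus ` C)"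
            using N pos by (simp add: divide_less_eq)
          also have "\<dots> \<le> real n * infdist (torus x) (torus ` C)"
            using that pos by (intro mult_right_mono) auto
          finally show ?thesis .
        qed
        then show ?thesis using out by (simp add: h_def)
      qed
      then show ?thesis
        by (intro tendsto_eventually) (auto simp: eventually_sequentially)
    qed
  qed
next
  case True
  then have "indicator C = (\<lambda>x. 0 :: real)"
    by (simp add: fun_eq_iff)
  then show ?thesis
    by (simp only: trig_approx_0)
qed

text \<open>Inner regularity: a closed set fills \<open>A\<close> up to measure \<epsilon>. It is
  taken inside the open square, as the compact case demands; the boundary that is lost is a null
  set.\<close>

lemma trig_approx_indicator:
  assumes A: "A \<in> sets cell"
  shows "trig_approx (indicator A)"
proof (rule trig_approx_limit)
  have AQ: "A \<subseteq> unit_square" and AL: "A \<in> sets lebesgue"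
    using A sets.sets_into_space[OF A] by (auto simp: sets_restrict_space)
  show sqA: "sq_integrable cell (indicator A)"
    using A by (intro sq_integrable_cell_bounded[of _ 1]) auto
  fix \<epsilon> :: real assume \<epsilon>: "\<epsilon> > 0"
  let ?A = "A \<inter> box 0 (vec 1)"
  have "?A \<in> sets lebesgue" using AL by auto
  then obtain T where T: "closed T" "T \<subseteq> ?A" "?A - T \<in> lmeasurable" "emeasure lebesgue (?A - T) < ennreal \<epsilon>"
    using \<epsilon> by (rule sets_lebesgue_inner_closed)
  have "bounded T"
    using T(2) bounded_subset[OF bounded_box] by blast
  then have T': "trig_approx (indicator T)"
    using T by (intro trig_approx_indicator_compact) (auto simp: compact_eq_bounded_closed)
  have null: "negligible (cbox 0 (vec 1) - box 0 (vec 1 :: real^2))"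
    by (rule negligible_frontier_interval)
  have "(\<integral>x. (indicat_real A x - indicator T x)\<^sup>2 \<partial>cell) = (\<integral>x. indicat_real (A - T) x \<partial>cell)"
    using T(2) by (intro Bochner_Integration.integral_cong) (auto simp: indicator_def)
  also have "\<dots> = measure cell (A - T)"
  proof -
    have "(A - T) \<inter> unit_square = A - T" using AQ by blast
    then show ?thesis by simp
  qed
  also have "\<dots> = measure lebesgue (A - T)"
    using AQ by (intro measure_restrict_space) auto
  also have "\<dots> = measure lebesgue (?A - T)"
    by (rule measure_negligible_symdiff[OF T(3)])
      (rule negligible_subset[OF null], use AQ unit_square_eq_cbox in auto)
  also have "\<dots> < \<epsilon>"
    using T(4) emeasure_eq_measure2[OF T(3)] by (simp add: ennreal_less_iff)
  finally show "\<exists>g. trig_approx g \<and> (\<integral>x. (indicator A x - g x)\<^sup>2 \<partial>cell) < \<epsilon>"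
    using T' by blast
qed

lemma sq_integrable_trig_approx:
  assumes f: "sq_integrable cell f"
  shows "trig_approx f"
proof -
  have fm: "f \<in> borel_measurable cell"
    using f by (rule sq_integrable_measurable)
  \<comment> \<open>Approximation centred at 0 yields simple functions dominated by 2 |f|, the
    square-integrable bound required for passing to the limit.\<close>
  obtain s where s: "\<And>n. simple_function cell (s n)"
    "\<And>x. x \<in> unit_square \<Longrightarrow> (\<lambda>n. s n x) \<longlonglongrightarrow> f x"
    "\<And>n x. x \<in> unit_square \<Longrightarrow> \<bar>s n x\<bar> \<le> 2 * \<bar>f x\<bar>"
    using borel_measurable_implies_sequence_metric[OF fm, of 0]
    by (simp add: dist_real_def Ball_def) blast
  show ?thesis
  proof (rule trig_approx_bounded_limit[OF fm _ s(2)])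
    show "trig_approx (s n)" for n
    proof (rule trig_approx_cong)
      have "s n -` {y} \<inter> space cell \<in> sets cell" for y
        using s(1) by (rule simple_functionD)
      then show "trig_approx (\<lambda>x. \<Sum>y\<in>s n ` space cell. y * indicator (s n -` {y} \<inter> space cell) x)"
        by (intro trig_approx_sum trig_approx_cmult trig_approx_indicator)
      show "(\<Sum>y\<in>s n ` space cell. y * indicator (s n -` {y} \<inter> space cell) x) = s n x"
        if "x \<in> unit_square" for x
      proof -
        have "(\<Sum>y\<in>s n ` space cell. y * indicator (s n -` {y} \<inter> space cell) x)
            = (\<Sum>y\<in>s n ` space cell. if y = s n x then y else 0)"
          using that by (intro sum.cong) (auto simp: indicator_def)
        also have "\<dots> = s n x"
          using that simple_functionD(1)[OF s(1)] by simp
        finally show ?thesis .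
      qed
    qed
    have "sq_integrable cell (\<lambda>x. \<bar>f x\<bar>)"
      using f by (auto simp: sq_integrable_def)
    then show "sq_integrable cell (\<lambda>x. 2 * \<bar>f x\<bar>)"
      by (rule sq_integrable_cmult)
  qed (use s(3) in auto)
qed

section \<open>Parseval's identity\<close>

lemma parseval_norm:
  assumes a: "sq_integrable cell a"
  shows "((\<lambda>k. (norm (fcoef a k))\<^sup>2) has_sum (\<integral>x. (a x)\<^sup>2 \<partial>cell)) UNIV"
  unfolding has_sum_def tendsto_iff eventually_finite_subsets_at_top
proof (intro allI impI)
  let ?I = "\<integral>x. (a x)\<^sup>2 \<partial>cell"
  fix \<epsilon> :: real assume "\<epsilon> > 0"
  then obtain p where p: "trig_poly p" "(\<integral>x. (norm (complex_of_real (a x) - p x))\<^sup>2 \<partial>cell) < \<epsilon>"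
    using sq_integrable_trig_approx[OF a] unfolding trig_approx_def by blast
  obtain F c where F: "finite F" "p = (\<lambda>x. \<Sum>k\<in>F. c k * fmode k x)"
    using trig_poly_normal_form[OF p(1)] by blast
  \<comment> \<open>Bessel bounds every finite partial sum from above. A good approximation with
    frequencies in \<open>F\<close> bounds the sum over \<open>F\<close> from below, and enlarging
    \<open>F\<close> only increases the sum.\<close>
  have bessel: "(\<Sum>k\<in>G. (norm (fcoef a k))\<^sup>2) \<le> ?I" if "finite G" for G
  proof -
    have "0 \<le> (\<integral>x. (norm (complex_of_real (a x) - (\<Sum>k\<in>G. fcoef a k * fmode k x)))\<^sup>2 \<partial>cell)"
      by (rule Bochner_Integration.integral_nonneg) simp
    then show ?thesis
      unfolding bessel_identity[OF a that] by simp
  qed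
  have close: "?I - (\<Sum>k\<in>F. (norm (fcoef a k))\<^sup>2) < \<epsilon>"
  proof -
    have "0 \<le> (\<Sum>k\<in>F. (norm (fcoef a k - c k))\<^sup>2)"
      by (rule sum_nonneg) simp
    then show ?thesis
      using p(2) unfolding F(2) bessel_identity[OF a F(1)] by linarith
  qed
  show "\<exists>X. finite X \<and> X \<subseteq> UNIV \<and> (\<forall>Y. finite Y \<and> X \<subseteq> Y \<and> Y \<subseteq> UNIV \<longrightarrow>
      dist (\<Sum>k\<in>Y. (norm (fcoef a k))\<^sup>2) ?I < \<epsilon>)"
  proof (intro exI[of _ F] conjI allI impI)
    fix G assume "finite G \<and> F \<subseteq> G \<and> G \<subseteq> UNIV"
    then have "finite G" "(\<Sum>k\<in>F. (norm (fcoef a k))\<^sup>2) \<le> (\<Sum>k\<in>G. (norm (fcoef a k))\<^sup>2)"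
      by (auto intro: sum_mono2)
    then show "dist (\<Sum>k\<in>G. (norm (fcoef a k))\<^sup>2) ?I < \<epsilon>"
      using bessel[of G] close by (simp add: dist_real_def)
  qed (use F(1) in auto)
qed

lemma fcoef_add:
  assumes "integrable cell a" "integrable cell b"
  shows "fcoef (\<lambda>x. a x + b x) k = fcoef a k + fcoef b k"
  using integrable_mult_fmode(2)[of "\<lambda>x. complex_of_real (a x)" k]
    integrable_mult_fmode(2)[of "\<lambda>x. complex_of_real (b x)" k] assms
  by (simp add: fcoef_def distrib_right)

lemma fcoef_cmult: "fcoef (\<lambda>x. c * a x) k = of_real c * fcoef a k"
  by (simp add: fcoef_def mult.assoc)

text \<open>Polarisation of \<open>parseval_norm\<close>: the squares for a + b and a - b differ by
  four times the product.\<close>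

lemma parseval:
  assumes a: "sq_integrable cell a" and b: "sq_integrable cell b"
  shows "((\<lambda>k. fcoef a k \<bullet> fcoef b k) has_sum (\<integral>x. a x * b x \<partial>cell)) UNIV"
proof -
  note i = sq_integrable_cellD[OF a] sq_integrable_cellD[OF b]
  have m: "sq_integrable cell (\<lambda>x. (-1) * b x)"
    by (rule sq_integrable_cmult[OF b])
  note im = sq_integrable_cellD[OF m]
  have "((\<lambda>k. ((norm (fcoef (\<lambda>x. a x + b x) k))\<^sup>2 + (-1) * (norm (fcoef (\<lambda>x. a x + (-1) * b x) k))\<^sup>2) * (1/4))
      has_sum ((\<integral>x. (a x + b x)\<^sup>2 \<partial>cell) + (-1) * (\<integral>x. (a x + (-1) * b x)\<^sup>2 \<partial>cell)) * (1/4)) UNIV"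
    by (intro has_sum_cmult_left has_sum_cmult_right has_sum_add parseval_norm sq_integrable_add a b m)
  moreover have "((norm (fcoef (\<lambda>x. a x + b x) k))\<^sup>2
      + (-1) * (norm (fcoef (\<lambda>x. a x + (-1) * b x) k))\<^sup>2) * (1/4) = fcoef a k \<bullet> fcoef b k" for k
    unfolding fcoef_add[OF i] fcoef_add[OF i(1) im] fcoef_cmult power2_norm_eq_inner
    by (simp add: inner_add_left inner_add_right inner_commute algebra_simps)
  moreover have "((\<integral>x. (a x + b x)\<^sup>2 \<partial>cell) + (-1) * (\<integral>x. (a x + (-1) * b x)\<^sup>2 \<partial>cell)) * (1/4)
     = (\<integral>x. a x * b x \<partial>cell)"
  proof -
    have "integrable cell (\<lambda>x. (a x + b x)\<^sup>2)" "integrable cell (\<lambda>x. (a x + (-1) * b x)\<^sup>2)"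
      using sq_integrable_add[OF a b] sq_integrable_add[OF a m] by (auto simp: sq_integrable_def)
    then have "(\<integral>x. (a x + b x)\<^sup>2 \<partial>cell) - (\<integral>x. (a x + (-1) * b x)\<^sup>2 \<partial>cell)
       = (\<integral>x. (a x + b x)\<^sup>2 - (a x + (-1) * b x)\<^sup>2 \<partial>cell)"
      by (rule Bochner_Integration.integral_diff[symmetric])
    also have "\<dots> = (\<integral>x. 4 * (a x * b x) \<partial>cell)"
      by (intro Bochner_Integration.integral_cong refl) (simp add: power2_eq_square algebra_simps)
    finally show ?thesis by simp
  qed
  ultimately show ?thesis by simp
qed

section \<open>Divergence-free and curl-free fields\<close>

text \<open>The symbol of differentiation: the i-th partial derivative multiplies mode
  \<open>k\<close> by \<open>freq k i\<close>.\<close>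

definition freq :: "int \<times> int \<Rightarrow> 2 \<Rightarrow> complex" where
  "freq k i = 2 * pi * \<i> * of_int (if i = 1 then fst k else snd k)"

lemma fmode_has_derivative:
  "(fmode k has_derivative (\<lambda>h. (h $ 1 * freq k 1 + h $ 2 * freq k 2) * fmode k x)) (at x)"
proof -
  let ?g = "\<lambda>h :: real^2. h $ 1 * freq k 1 + h $ 2 * freq k 2"
  have "linear ?g"
    by (rule linearI) (auto simp: algebra_simps scaleR_conv_of_real[where 'a=complex])
  then have "(?g has_derivative ?g) (at x)"
    by (simp add: linear_conv_bounded_linear bounded_linear_imp_has_derivative)
  then have "((\<lambda>x. exp (?g x)) has_derivative (\<lambda>h. exp (?g x) * ?g h)) (at x)"
    by (rule has_derivative_compose) (rule has_field_derivative_imp_has_derivative[OF DERIV_exp])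
  moreover have "exp (?g y) = fmode k y" for y
    by (simp add: fmode_def cis_conv_exp freq_def algebra_simps)
  ultimately show ?thesis
    by (simp add: mult.commute)
qed

lemma test_mode_has_derivative:
  "((\<lambda>x. Re (c * fmode k x)) has_derivative
     (\<lambda>h. h $ 1 * Re (c * freq k 1 * fmode k x) + h $ 2 * Re (c * freq k 2 * fmode k x))) (at x)"
  by (rule has_derivative_eq_rhs[OF bounded_linear.has_derivative[OF bounded_linear_Re
        has_derivative_mult_right[OF fmode_has_derivative]]])
    (simp add: fun_eq_iff algebra_simps)

text \<open>With a complex amplitude \<open>c\<close> the family contains the cosine and the sine of
  each frequency, and differentiation merely multiplies \<open>c\<close> by \<open>freq k i\<close>,
  so all derivatives are explicit.\<close>

lemma test_function_mode: "test_function (\<lambda>x. Re (c * fmode k x))"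
  unfolding test_function_def
proof
  show "C_infinity (\<lambda>x. Re (c * fmode k x))"
    unfolding C_infinity_def
  proof -
    let ?F = "\<lambda>i j x. Re ((c * freq k 1 ^ i * freq k 2 ^ j) * fmode k x)"
    have "(?F i j has_derivative (\<lambda>h. h $ 1 * ?F (Suc i) j x + h $ 2 * ?F i (Suc j) x)) (at x)" for i j x
      using test_mode_has_derivative[of "c * freq k 1 ^ i * freq k 2 ^ j" k x]
      by (simp add: mult_ac)
    then show "\<exists>F. F 0 0 = (\<lambda>x. Re (c * fmode k x)) \<and> (\<forall>i j x. (F i j has_derivative
        (\<lambda>h. h $ 1 * F (Suc i) j x + h $ 2 * F i (Suc j) x)) (at x))"
      by (intro exI[of _ ?F]) simp
  qed
  have per: "fmode k (x + axis i 1) = fmode k x" for x i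
  proof -
    have "fmode k (x + axis i 1)
        = fmode k x * cis (2 * pi * of_int (if i = 1 then fst k else snd k))"
      using exhaust_2[of i]
      by (auto simp: fmode_def cis_mult axis_def algebra_simps)
    also have "cis (2 * pi * of_int (if i = 1 then fst k else snd k)) = 1"
      by (rule cis_multiple_2pi) simp
    finally show ?thesis by simp
  qed
  show "periodic (\<lambda>x. Re (c * fmode k x))"
    by (simp add: periodic_def per)
qed

lemma grad_mode: "grad (\<lambda>x. Re (c * fmode k x)) x = (\<chi> i. Re (c * freq k i * fmode k x))"
  unfolding grad_def frechet_derivative_at[OF test_mode_has_derivative, symmetric]
  by (auto simp: vec_eq_iff forall_2 axis_def)

lemma integral_mult_Re_mode:
  assumes "integrable cell a"
  shows "(\<integral>x. a x * Re (c * fmode k x) \<partial>cell) = Re (c * cnj (fcoef a k))"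
    and "integrable cell (\<lambda>x. a x * Re (c * fmode k x))"
proof -
  have i: "integrable cell (\<lambda>x. c * (complex_of_real (a x) * fmode k x))"
    using assms by (intro integrable_mult_right integrable_mult_fmode) simp
  have eq: "a x * Re (c * fmode k x) = Re (c * (complex_of_real (a x) * fmode k x))" for x
    by (simp add: algebra_simps)
  show "integrable cell (\<lambda>x. a x * Re (c * fmode k x))"
    unfolding eq using i by (rule integrable_Re)
  have "(\<integral>x. a x * Re (c * fmode k x) \<partial>cell) = Re (\<integral>x. c * (complex_of_real (a x) * fmode k x) \<partial>cell)"
    unfolding eq by (rule integral_Re[OF i])
  also have "(\<integral>x. c * (complex_of_real (a x) * fmode k x) \<partial>cell) = c * cnj (fcoef a k)"
  proof -
    have "cnj (fcoef a k) = (\<integral>x. complex_of_real (a x) * fmode k x \<partial>cell)"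
      by (simp only: fcoef_def Bochner_Integration.integral_cnj[symmetric] complex_cnj_mult complex_cnj_cnj
          complex_cnj_complex_of_real)
    then show ?thesis by simp
  qed
  finally show "(\<integral>x. a x * Re (c * fmode k x) \<partial>cell) = Re (c * cnj (fcoef a k))" .
qed

lemma Re_mult_all_eq:
  assumes "\<And>c. Re (c * z) = Re (c * w)"
  shows "z = w"
  using assms[of 1] assms[of "\<i>"] by (simp add: complex_eq_iff)

definition sq_field :: "(real^2 \<Rightarrow> complex) \<Rightarrow> bool" where
  "sq_field u \<longleftrightarrow> sq_integrable cell (\<lambda>x. Re (u x)) \<and> sq_integrable cell (\<lambda>x. Im (u x))"

text \<open>Fourier characterisations of divergence-free and curl-free fields on the torus; a plane
  vector is encoded as a complex number, so multiplication by \<open>\<i>\<close> is rotation by a right angle.\<close>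

definition solenoidal :: "(real^2 \<Rightarrow> complex) \<Rightarrow> bool" where
  "solenoidal u \<longleftrightarrow> sq_field u \<and>
     (\<forall>k. of_int (fst k) * fcoef (\<lambda>x. Re (u x)) k + of_int (snd k) * fcoef (\<lambda>x. Im (u x)) k = 0)"

definition irrotational :: "(real^2 \<Rightarrow> complex) \<Rightarrow> bool" where
  "irrotational u \<longleftrightarrow> solenoidal (\<lambda>x. \<i> * u x)"

lemma solenoidalD:
  "solenoidal u \<Longrightarrow>
    of_int (fst k) * fcoef (\<lambda>x. Re (u x)) k + of_int (snd k) * fcoef (\<lambda>x. Im (u x)) k = 0"
  unfolding solenoidal_def by blast

lemma sq_field_add: "sq_field u \<Longrightarrow> sq_field v \<Longrightarrow> sq_field (\<lambda>x. u x + v x)"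
  by (simp add: sq_field_def sq_integrable_add)

lemma sq_field_cmult: "sq_field u \<Longrightarrow> sq_field (\<lambda>x. c * u x)"
  by (simp add: sq_field_def sq_integrable_add sq_integrable_diff sq_integrable_cmult)

lemma sq_field_integrable: "sq_field u \<Longrightarrow> integrable cell u"
proof -
  assume "sq_field u"
  then have "integrable cell (\<lambda>x. complex_of_real (Re (u x)) + \<i> * complex_of_real (Im (u x)))"
    using sq_integrable_cellD by (auto simp: sq_field_def)
  then show ?thesis
    by (simp only: complex_eq[symmetric])
qed

lemma solenoidal_add:
  assumes "solenoidal u" "solenoidal v"
  shows "solenoidal (\<lambda>x. u x + v x)"
  unfolding solenoidal_def
proof (intro conjI allI)
  fix k
  have eq: "of_int (fst k) * fcoef (\<lambda>x. Re (u x + v x)) k + of_int (snd k) * fcoef (\<lambda>x. Im (u x + v x)) k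
      = (of_int (fst k) * fcoef (\<lambda>x. Re (u x)) k + of_int (snd k) * fcoef (\<lambda>x. Im (u x)) k)
      + (of_int (fst k) * fcoef (\<lambda>x. Re (v x)) k + of_int (snd k) * fcoef (\<lambda>x. Im (v x)) k)"
    using assms
    by (simp add: solenoidal_def sq_field_def fcoef_add sq_integrable_cellD distrib_left)
  show "of_int (fst k) * fcoef (\<lambda>x. Re (u x + v x)) k + of_int (snd k) * fcoef (\<lambda>x. Im (u x + v x)) k = 0"
    unfolding eq using assms by (simp add: solenoidalD)
qed (use assms in \<open>simp add: solenoidal_def sq_field_add\<close>)

lemma solenoidal_cmult:
  assumes "solenoidal u"
  shows "solenoidal (\<lambda>x. complex_of_real r * u x)"
  unfolding solenoidal_def
proof (intro conjI allI)
  fix k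
  have eq: "of_int (fst k) * fcoef (\<lambda>x. Re (of_real r * u x)) k + of_int (snd k) * fcoef (\<lambda>x. Im (of_real r * u x)) k
      = of_real r * (of_int (fst k) * fcoef (\<lambda>x. Re (u x)) k + of_int (snd k) * fcoef (\<lambda>x. Im (u x)) k)"
    by (simp add: fcoef_cmult algebra_simps)
  show "of_int (fst k) * fcoef (\<lambda>x. Re (of_real r * u x)) k + of_int (snd k) * fcoef (\<lambda>x. Im (of_real r * u x)) k = 0"
    unfolding eq using assms by (simp add: solenoidalD)
qed (use assms in \<open>simp add: solenoidal_def sq_field_cmult\<close>)

lemma irrotational_rotate:
  assumes "solenoidal u"
  shows "irrotational (\<lambda>x. \<i> * u x)"
  using solenoidal_cmult[OF assms, of "-1"] by (simp add: irrotational_def mult.assoc[symmetric])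

text \<open>The div-curl lemma for one mode of frequency (p, q): (a1, a2) is orthogonal to the
  frequency, (b1, b2) parallel to it. Multiplying the claim by p and by q separately avoids deciding
  which one to divide by.\<close>

lemma inner_eq_0_of_orthogonal:
  fixes a1 a2 b1 b2 :: "'a::real_inner"
  assumes "p *\<^sub>R a1 + q *\<^sub>R a2 = 0" "q *\<^sub>R b1 = p *\<^sub>R b2" "p \<noteq> 0 \<or> q \<noteq> 0"
  shows "a1 \<bullet> b1 + a2 \<bullet> b2 = 0"
proof -
  have "p * (a1 \<bullet> b1 + a2 \<bullet> b2) = (p *\<^sub>R a1) \<bullet> b1 + a2 \<bullet> (p *\<^sub>R b2)"
    by (simp add: distrib_left)
  also have "\<dots> = (p *\<^sub>R a1 + q *\<^sub>R a2) \<bullet> b1"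
    unfolding assms(2)[symmetric] by (simp add: inner_add_left)
  finally have p: "p * (a1 \<bullet> b1 + a2 \<bullet> b2) = 0" using assms(1) by simp
  have "q * (a1 \<bullet> b1 + a2 \<bullet> b2) = a1 \<bullet> (q *\<^sub>R b1) + (q *\<^sub>R a2) \<bullet> b2"
    by (simp add: distrib_left)
  also have "\<dots> = (p *\<^sub>R a1 + q *\<^sub>R a2) \<bullet> b2"
    unfolding assms(2) by (simp add: inner_add_left)
  finally have "q * (a1 \<bullet> b1 + a2 \<bullet> b2) = 0" using assms(1) by simp
  with p assms(3) show ?thesis by auto
qed

lemma fcoef_0: "fcoef a 0 = of_real (\<integral>x. a x \<partial>cell)"
  by (simp add: fcoef_def)

lemma sq_field_inner_integrable:
  assumes "sq_field u" "sq_field v"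
  shows "integrable cell (\<lambda>x. u x \<bullet> v x)"
  using assms by (simp add: inner_complex_def sq_field_def integrable_mult_sq_integrable)

text \<open>Parseval turns the integral into a sum over frequencies; all nonzero frequencies drop
  out, and the zero mode is the product of the averages.\<close>

lemma div_curl:
  assumes u: "solenoidal u" and v: "irrotational v"
  shows "(\<integral>x. u x \<bullet> v x \<partial>cell) = (\<integral>x. u x \<partial>cell) \<bullet> (\<integral>x. v x \<partial>cell)"
proof -
  have sv: "sq_field v"
    using sq_field_cmult[of "\<lambda>x. \<i> * v x" "- \<i>"] v
    by (simp add: irrotational_def solenoidal_def mult.assoc[symmetric])
  have su: "sq_field u" using u by (simp add: solenoidal_def)
  note c = su[unfolded sq_field_def] sv[unfolded sq_field_def]
  let ?t = "\<lambda>k. fcoef (\<lambda>x. Re (u x)) k \<bullet> fcoef (\<lambda>x. Re (v x)) k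
    + fcoef (\<lambda>x. Im (u x)) k \<bullet> fcoef (\<lambda>x. Im (v x)) k"
  have split: "(\<integral>x. u x \<bullet> v x \<partial>cell) = (\<integral>x. Re (u x) * Re (v x) \<partial>cell) + (\<integral>x. Im (u x) * Im (v x) \<partial>cell)"
    using c by (simp add: inner_complex_def integrable_mult_sq_integrable)
  have sum: "(?t has_sum ((\<integral>x. Re (u x) * Re (v x) \<partial>cell) + (\<integral>x. Im (u x) * Im (v x) \<partial>cell))) UNIV"
    using c by (intro has_sum_add parseval) auto
  have sum0: "(?t has_sum ?t 0) UNIV"
  proof (rule has_sum_finite_neutralI[of "{0}"])
    fix k :: "int \<times> int" assume "k \<in> UNIV - {0}"
    then have k: "real_of_int (fst k) \<noteq> 0 \<or> real_of_int (snd k) \<noteq> 0"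
      by (simp add: prod_eq_iff)
    have neg: "fcoef (\<lambda>x. - Im (v x)) k = - fcoef (\<lambda>x. Im (v x)) k"
      using fcoef_cmult[of "-1"] by simp
    have "real_of_int (fst k) *\<^sub>R fcoef (\<lambda>x. Re (u x)) k + real_of_int (snd k) *\<^sub>R fcoef (\<lambda>x. Im (u x)) k = 0"
      using solenoidalD[OF u] by (simp add: scaleR_conv_of_real)
    moreover have "real_of_int (snd k) *\<^sub>R fcoef (\<lambda>x. Re (v x)) k = real_of_int (fst k) *\<^sub>R fcoef (\<lambda>x. Im (v x)) k"
      using solenoidalD[OF v[unfolded irrotational_def], of k] neg
      by (simp add: scaleR_conv_of_real algebra_simps)
    ultimately show "?t k = 0"
      using k by (rule inner_eq_0_of_orthogonal)
  qed auto
  have t0: "?t 0 = (\<integral>x. u x \<partial>cell) \<bullet> (\<integral>x. v x \<partial>cell)"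
    using sq_field_integrable[OF su] sq_field_integrable[OF sv]
    by (simp add: fcoef_0 inner_complex_def)
  show ?thesis
    unfolding split has_sum_unique[OF sum sum0] t0 ..
qed

text \<open>Fourier modes suffice as test functions: letting the amplitude run through \<complex>
  recovers a complex equation from real pairings. Pairing with \<open>fmode k\<close> produces the
  conjugate coefficient.\<close>

lemma weakly_div_free_solenoidal:
  assumes "sq_field u" "weakly_div_free (\<lambda>x. uncplx (u x))"
  shows "solenoidal u"
  unfolding solenoidal_def
proof (intro conjI allI assms(1))
  fix k
  let ?a = "\<lambda>x. Re (u x)" and ?b = "\<lambda>x. Im (u x)"
  have i: "integrable cell ?a" "integrable cell ?b"
    using assms(1) sq_integrable_cellD by (auto simp: sq_field_def)
  have "Re (c * (freq k 1 * cnj (fcoef ?a k) + freq k 2 * cnj (fcoef ?b k))) = Re (c * 0)" for c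
  proof -
    have "0 = (\<integral>x. uncplx (u x) \<bullet> grad (\<lambda>x. Re (c * fmode k x)) x \<partial>cell)"
      using assms(2) test_function_mode[of c k] by (simp add: weakly_div_free_def set_integral_cell)
    also have "\<dots> = (\<integral>x. ?a x * Re (c * freq k 1 * fmode k x) + ?b x * Re (c * freq k 2 * fmode k x) \<partial>cell)"
      unfolding grad_mode by (simp add: inner_vec_def sum_2 uncplx_def)
    also have "\<dots> = Re (c * freq k 1 * cnj (fcoef ?a k)) + Re (c * freq k 2 * cnj (fcoef ?b k))"
      by (subst Bochner_Integration.integral_add)
        (simp_all only: integral_mult_Re_mode i)
    finally show ?thesis by (simp add: algebra_simps)
  qed
  from Re_mult_all_eq[OF this]
  have "2 * pi * \<i> * cnj (of_int (fst k) * fcoef ?a k + of_int (snd k) * fcoef ?b k) = 0"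
    by (simp add: freq_def algebra_simps)
  then show "of_int (fst k) * fcoef ?a k + of_int (snd k) * fcoef ?b k = 0"
    by (simp only: mult_eq_0_iff complex_cnj_zero_iff) simp
qed

lemma L2_per_sq_integrable:
  assumes "L2_per f"
  shows "sq_integrable cell (\<lambda>x. norm (f x))"
  using assms
  by (auto simp: L2_per_def sq_integrable_def set_integrable_def integrable_restrict_space
      intro!: measurable_restrict_space1)

lemma L2_per_component_sq_integrable:
  fixes G :: "real^2 \<Rightarrow> real^2"
  assumes "L2_per G"
  shows "sq_integrable cell (\<lambda>x. G x $ i)"
proof (rule sq_integrable_bound[OF L2_per_sq_integrable[OF assms]])
  have "G \<in> borel_measurable lebesgue" using assms by (simp add: L2_per_def)
  then have "(\<lambda>x. G x $ i) \<in> borel_measurable lebesgue"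
    by (rule measurable_compose[OF _ borel_measurable_continuous_onI[of "\<lambda>v. v $ i"]])
      (intro continuous_intros)
  then show "(\<lambda>x. G x $ i) \<in> borel_measurable cell"
    by (rule measurable_restrict_space1)
  show "\<bar>G x $ i\<bar> \<le> \<bar>norm (G x)\<bar>" for x
    using component_le_norm_cart by simp
qed

lemma fcoef_weak_gradient:
  assumes H: "H1_per_with_grad \<phi> G"
  shows "cnj (fcoef (\<lambda>x. G x $ i) k) = - freq k i * cnj (fcoef \<phi> k)"
proof (rule Re_mult_all_eq)
  fix c
  have per: "L2_per \<phi>" "L2_per G" using H by (auto simp: H1_per_with_grad_def)
  have \<phi>m: "\<phi> \<in> borel_measurable cell"
    using per(1) by (auto simp: L2_per_def intro: measurable_restrict_space1)
  have "sq_integrable cell \<phi>"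
    by (rule sq_integrable_bound[OF L2_per_sq_integrable[OF per(1)] \<phi>m]) simp
  then have i\<phi>: "integrable cell \<phi>" by (rule sq_integrable_cellD)
  have iG: "integrable cell (\<lambda>x. G x $ j)" for j
    using L2_per_component_sq_integrable[OF per(2)] by (rule sq_integrable_cellD)
  \<comment> \<open>Moving a component inside a vector-valued integral requires integrability of the
    vector function, which is reduced here to its components.\<close>
  have vec: "integrable cell f" if "\<And>j. integrable cell (\<lambda>x. f x $ j)" for f :: "real^2 \<Rightarrow> real^2"
  proof -
    have "integrable cell (\<lambda>x. \<Sum>j\<in>UNIV. (f x $ j) *\<^sub>R (axis j 1 :: real^2))"
      using that by (intro Bochner_Integration.integrable_sum integrable_scaleR_left) auto
    moreover have "(\<Sum>j\<in>UNIV. (f x $ j) *\<^sub>R axis j 1) = f x" for x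
      by (simp add: vec_eq_iff axis_def if_distrib cong: if_cong)
    ultimately have "integrable cell (\<lambda>x. f x)" by (simp only:)
    then show ?thesis by simp
  qed
  let ?\<psi> = "\<lambda>x. Re (c * fmode k x)"
  have "(\<integral>x. \<phi> x *\<^sub>R grad ?\<psi> x \<partial>cell) $ i = - (\<integral>x. ?\<psi> x *\<^sub>R G x \<partial>cell) $ i"
    using H test_function_mode[of c k] by (simp add: H1_per_with_grad_def set_integral_cell)
  moreover have "(\<integral>x. \<phi> x *\<^sub>R grad ?\<psi> x \<partial>cell) $ i = (\<integral>x. \<phi> x * Re (c * freq k i * fmode k x) \<partial>cell)"
  proof (subst integral_bounded_linear[OF bounded_linear_vec_nth, symmetric])
    show "integrable cell (\<lambda>x. \<phi> x *\<^sub>R grad ?\<psi> x)"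
      unfolding grad_mode using integral_mult_Re_mode(2)[OF i\<phi>]
      by (intro vec) (simp only: vector_scaleR_component real_scaleR_def vec_lambda_beta)
    show "(\<integral>x. (\<phi> x *\<^sub>R grad ?\<psi> x) $ i \<partial>cell) = (\<integral>x. \<phi> x * Re (c * freq k i * fmode k x) \<partial>cell)"
      unfolding grad_mode by (simp only: vector_scaleR_component real_scaleR_def vec_lambda_beta)
  qed
  moreover have "(\<integral>x. ?\<psi> x *\<^sub>R G x \<partial>cell) $ i = (\<integral>x. G x $ i * Re (c * fmode k x) \<partial>cell)"
  proof (subst integral_bounded_linear[OF bounded_linear_vec_nth, symmetric])
    show "integrable cell (\<lambda>x. ?\<psi> x *\<^sub>R G x)"
      using integral_mult_Re_mode(2)[OF iG] by (intro vec) (simp only: vector_scaleR_component real_scaleR_def mult.commute)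
  qed (simp add: mult.commute)
  ultimately show "Re (c * cnj (fcoef (\<lambda>x. G x $ i) k)) = Re (c * (- freq k i * cnj (fcoef \<phi> k)))"
    unfolding integral_mult_Re_mode(1)[OF i\<phi>] integral_mult_Re_mode(1)[OF iG]
    by (simp add: mult.assoc)
qed

text \<open>The coefficients of a gradient are multiples of the frequency vector: turned by a right
  angle they are orthogonal to it, and at frequency zero they vanish.\<close>

lemma weak_gradient_irrotational:
  assumes H: "H1_per_with_grad \<phi> G"
  shows "sq_field (\<lambda>x. cplx (G x))" "irrotational (\<lambda>x. cplx (G x))" "(\<integral>x. cplx (G x) \<partial>cell) = 0"
proof -
  have "L2_per G" using H by (simp add: H1_per_with_grad_def)
  then have c: "sq_integrable cell (\<lambda>x. G x $ i)" for i
    by (rule L2_per_component_sq_integrable)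
  then show sq: "sq_field (\<lambda>x. cplx (G x))"
    by (simp add: sq_field_def cplx_def)
  have co: "fcoef (\<lambda>x. G x $ i) k = - cnj (freq k i) * fcoef \<phi> k" for i k
    using arg_cong[OF fcoef_weak_gradient[OF H, of i k], of cnj] by simp
  have neg: "fcoef (\<lambda>x. - G x $ i) k = - fcoef (\<lambda>x. G x $ i) k" for i k
    using fcoef_cmult[of "-1"] by simp
  show "irrotational (\<lambda>x. cplx (G x))"
    unfolding irrotational_def solenoidal_def
    using sq_field_cmult[OF sq, of "\<i>"] by (simp add: cplx_def neg co freq_def)
  have "(\<integral>x. G x $ i \<partial>cell) = 0" for i
    using co[of i 0] by (cases "i = 1") (simp_all add: fcoef_0 freq_def)
  then show "(\<integral>x. cplx (G x) \<partial>cell) = 0"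
    using integral_Re[OF sq_field_integrable[OF sq]] integral_Im[OF sq_field_integrable[OF sq]]
    by (simp add: complex_eq_iff cplx_def)
qed

lemma solenoidal_sq_field: "solenoidal u \<Longrightarrow> sq_field u"
  by (simp add: solenoidal_def)

lemma irrotational_sq_field: "irrotational v \<Longrightarrow> sq_field v"
  using sq_field_cmult[of "\<lambda>x. \<i> * v x" "- \<i>"]
  by (simp add: irrotational_def solenoidal_def mult.assoc[symmetric])

lemma solenoidal_const: "solenoidal (\<lambda>x. c)"
proof -
  have "fcoef (\<lambda>x. r) k = (if k = 0 then of_real r else 0)" for r k
    by (simp add: fcoef_def cnj_fmode integral_fmode)
  moreover have "sq_integrable cell (\<lambda>x. r)" for r
    by (rule sq_integrable_cell_bounded[of _ "\<bar>r\<bar>"]) auto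
  ultimately show ?thesis
    by (auto simp: solenoidal_def sq_field_def zero_prod_def)
qed

section \<open>Pairs of plane fields and their averages\<close>

definition mean :: "(real^2 \<Rightarrow> complex^2) \<Rightarrow> complex^2" where
  "mean U = (\<chi> i. \<integral>x. U x $ i \<partial>cell)"

definition solenoidal2 :: "(real^2 \<Rightarrow> complex^2) \<Rightarrow> bool" where
  "solenoidal2 U \<longleftrightarrow> (\<forall>i. solenoidal (\<lambda>x. U x $ i))"

definition irrotational2 :: "(real^2 \<Rightarrow> complex^2) \<Rightarrow> bool" where
  "irrotational2 U \<longleftrightarrow> solenoidal2 (\<lambda>x. \<i> *s U x)"

lemma irrotational2_nth: "irrotational2 U \<Longrightarrow> irrotational (\<lambda>x. U x $ i)"
  by (simp add: irrotational2_def solenoidal2_def irrotational_def)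

lemma irrotational2_sq_field: "irrotational2 U \<Longrightarrow> sq_field (\<lambda>x. U x $ i)"
  by (intro irrotational_sq_field irrotational2_nth)

lemma solenoidal2_sq_field: "solenoidal2 U \<Longrightarrow> sq_field (\<lambda>x. U x $ i)"
  by (simp add: solenoidal2_def solenoidal_def)

lemma div_curl2:
  assumes U: "solenoidal2 U" and V: "irrotational2 V"
  shows "(\<integral>x. U x \<bullet> V x \<partial>cell) = mean U \<bullet> mean V"
proof -
  have "(\<integral>x. U x \<bullet> V x \<partial>cell) = (\<Sum>i\<in>UNIV. \<integral>x. U x $ i \<bullet> V x $ i \<partial>cell)"
    unfolding inner_vec_def
    by (intro Bochner_Integration.integral_sum sq_field_inner_integrable
        solenoidal2_sq_field[OF U] irrotational2_sq_field[OF V])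
  also have "\<dots> = (\<Sum>i\<in>UNIV. (\<integral>x. U x $ i \<partial>cell) \<bullet> (\<integral>x. V x $ i \<partial>cell))"
    using U irrotational2_nth[OF V] by (intro sum.cong refl div_curl) (auto simp: solenoidal2_def)
  finally show ?thesis
    by (simp add: mean_def inner_vec_def)
qed

definition real_mat :: "complex^2^2 \<Rightarrow> bool" where
  "real_mat A \<longleftrightarrow> (\<forall>i j. A $ i $ j \<in> \<real>)"

lemma solenoidal2_add: "solenoidal2 U \<Longrightarrow> solenoidal2 V \<Longrightarrow> solenoidal2 (\<lambda>x. U x + V x)"
  by (simp add: solenoidal2_def solenoidal_add)

text \<open>Real entries matter: multiplication by \<i> turns plane vectors by a right angle and
  exchanges divergence-free with curl-free fields.\<close>

lemma solenoidal2_real_mat: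
  assumes "real_mat A" "solenoidal2 U"
  shows "solenoidal2 (\<lambda>x. A *v U x)"
proof -
  have "solenoidal (\<lambda>x. A $ i $ j * U x $ j)" for i j
    using assms solenoidal_cmult[of "\<lambda>x. U x $ j" "Re (A $ i $ j)"]
    by (simp add: real_mat_def solenoidal2_def)
  then show ?thesis
    by (simp add: solenoidal2_def matrix_vector_mult_def sum_2 solenoidal_add)
qed

lemma irrotational2_rotate: "solenoidal2 U \<Longrightarrow> irrotational2 (\<lambda>x. \<i> *s U x)"
  using irrotational_rotate by (simp add: irrotational2_def solenoidal2_def irrotational_def)

lemma mean_matrix_vector_mult:
  assumes "\<And>i. sq_field (\<lambda>x. U x $ i)"
  shows "mean (\<lambda>x. A *v U x) = A *v mean U"
  using sq_field_integrable[OF assms] by (simp add: mean_def vec_eq_iff matrix_vector_mult_def sum_2)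

lemma mean_vector_scalar_mult: "mean (\<lambda>x. c *s U x) = c *s mean U"
  by (simp add: mean_def vec_eq_iff)

lemma mean_add:
  assumes "\<And>i. sq_field (\<lambda>x. U x $ i)" "\<And>i. sq_field (\<lambda>x. V x $ i)"
  shows "mean (\<lambda>x. U x + V x) = mean U + mean V"
  using sq_field_integrable[OF assms(1)] sq_field_integrable[OF assms(2)]
  by (simp add: mean_def vec_eq_iff)

text \<open>Links the componentwise averages, to which the scalar div-curl lemma applies, with the
  vector-valued integral that defines the effective tensor.\<close>

lemma mean_eq_integral:
  assumes "\<And>i. sq_field (\<lambda>x. U x $ i)"
  shows "(\<integral>x. U x \<partial>cell) = mean U"
proof -
  have eq: "(\<Sum>i\<in>UNIV. axis i (U x $ i)) = U x" for x
    by (simp add: vec_eq_iff axis_def if_distrib cong: if_cong)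
  have ax: "bounded_linear (axis i :: complex \<Rightarrow> complex^2)" for i
    by (rule linear_conv_bounded_linear[THEN iffD1], rule linearI)
      (auto simp: vec_eq_iff axis_def)
  have "integrable cell (\<lambda>x. \<Sum>i\<in>UNIV. axis i (U x $ i))"
    by (intro Bochner_Integration.integrable_sum integrable_bounded_linear[OF ax]
        sq_field_integrable assms)
  then have i: "integrable cell U" unfolding eq by simp
  show ?thesis
    unfolding mean_def vec_eq_iff
    by (simp add: integral_bounded_linear[OF bounded_linear_vec_nth i])
qed

text \<open>The compact range of a composite bounds the operator norm uniformly, so the flux
  inherits square integrability from the field.\<close>

lemma sq_field_blinfun_apply:
  assumes L: "composite L" and E: "\<And>i. sq_field (\<lambda>x. E x $ i)"
  shows "sq_field (\<lambda>x. blinfun_apply (L x) (E x) $ i)"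
proof -
  obtain C where C: "compact C" "\<And>x. L x \<in> C"
    using L by (auto simp: composite_def)
  obtain B where B: "\<And>x. norm (L x) \<le> B"
    using compact_imp_bounded[OF C(1)] C(2) by (auto simp: bounded_iff)
  have B0: "B \<ge> 0" using norm_ge_zero B order_trans by blast
  define h where "h x = (\<Sum>i\<in>UNIV. \<bar>Re (E x $ i)\<bar> + \<bar>Im (E x $ i)\<bar>)" for x
  have sqabs: "sq_integrable cell (\<lambda>x. \<bar>f x\<bar>)" if "sq_integrable cell f" for f
    using that by (auto simp: sq_integrable_def)
  have "sq_integrable cell h"
    unfolding h_def using E
    by (intro sq_integrable_sum sq_integrable_add sqabs) (auto simp: sq_field_def)
  then have h: "sq_integrable cell (\<lambda>x. B * h x)"
    by (rule sq_integrable_cmult)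
  have nE: "norm (E x) \<le> h x" for x
    unfolding h_def
    unfolding norm_vec_def by (rule order_trans[OF L2_set_le_sum sum_mono]) (auto simp: cmod_le)
  have bd: "norm (blinfun_apply (L x) (E x) $ i) \<le> B * h x" for x
  proof -
    have "norm (blinfun_apply (L x) (E x) $ i) \<le> norm (blinfun_apply (L x) (E x))"
      by (rule Finite_Cartesian_Product.norm_nth_le)
    also have "\<dots> \<le> norm (L x) * norm (E x)" by (rule norm_blinfun)
    also have "\<dots> \<le> B * h x"
      using B nE B0 by (intro mult_mono) auto
    finally show ?thesis .
  qed
  have Em [measurable]: "(\<lambda>x. E x $ j) \<in> borel_measurable cell" for j
    using sq_field_integrable[OF E] by (rule borel_measurable_integrable)
  have Lm: "(\<lambda>x. blinfun_apply (L x) b $ i) \<in> borel_measurable cell" for b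
  proof (rule measurable_compose[OF _ borel_measurable_continuous_onI[of "\<lambda>l. blinfun_apply l b $ i"]])
    show "L \<in> borel_measurable cell"
      using L by (auto simp: composite_def intro: measurable_restrict_space1)
  qed (intro continuous_intros)
  \<comment> \<open>For measurability: in the real basis \<open>axis j 1\<close>,
    \<open>axis j \<i>\<close> the flux is a sum of scalar measurable functions times
    \<open>L x\<close> applied to fixed vectors.\<close>
  have "blinfun_apply (L x) (E x) = (\<Sum>j\<in>UNIV. Re (E x $ j) *\<^sub>R blinfun_apply (L x) (axis j 1)
      + Im (E x $ j) *\<^sub>R blinfun_apply (L x) (axis j \<i>))" for x
  proof -
    have "E x = (\<Sum>j\<in>UNIV. Re (E x $ j) *\<^sub>R axis j 1 + Im (E x $ j) *\<^sub>R axis j \<i>)"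
      by (simp add: vec_eq_iff axis_def complex_eq_iff if_distrib forall_2 sum_2 cong: if_cong)
    then have "blinfun_apply (L x) (E x) = blinfun_apply (L x)
        (\<Sum>j\<in>UNIV. Re (E x $ j) *\<^sub>R axis j 1 + Im (E x $ j) *\<^sub>R axis j \<i>)" by (rule arg_cong)
    then show ?thesis
      by (simp add: blinfun.sum_right blinfun.add_right blinfun.scaleR_right)
  qed
  then have J: "blinfun_apply (L x) (E x) $ i = (\<Sum>j\<in>UNIV. Re (E x $ j) *\<^sub>R blinfun_apply (L x) (axis j 1) $ i
      + Im (E x $ j) *\<^sub>R blinfun_apply (L x) (axis j \<i>) $ i)" for x
    by (simp add: sum_2)
  have Jm [measurable]: "(\<lambda>x. blinfun_apply (L x) (E x) $ i) \<in> borel_measurable cell"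
    unfolding J
    by (intro borel_measurable_sum borel_measurable_add borel_measurable_scaleR Lm) measurable
  show ?thesis
    unfolding sq_field_def
  proof
    show "sq_integrable cell (\<lambda>x. Re (blinfun_apply (L x) (E x) $ i))"
      by (rule sq_integrable_bound[OF h])
        (measurable, meson abs_Re_le_cmod abs_ge_self bd order_trans)
    show "sq_integrable cell (\<lambda>x. Im (blinfun_apply (L x) (E x) $ i))"
      by (rule sq_integrable_bound[OF h])
        (measurable, meson abs_Im_le_cmod abs_ge_self bd order_trans)
  qed
qed

lemma cell_field_irrotational:
  assumes "cell_field L E0 E"
  shows "irrotational2 E" "mean E = E0"
proof -
  obtain \<phi>1 \<phi>2 G1 G2 where H: "H1_per_with_grad \<phi>1 G1" "H1_per_with_grad \<phi>2 G2"
    and E: "E = (\<lambda>x. E0 + vector [cplx (G1 x), cplx (G2 x)])"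
    using assms unfolding cell_field_def by blast
  note g = weak_gradient_irrotational[OF H(1)] weak_gradient_irrotational[OF H(2)]
  have *: "irrotational (\<lambda>x. c + g x)" if "irrotational g" for c g
    using solenoidal_add[OF solenoidal_const[of "\<i> * c"] that[unfolded irrotational_def]]
    by (simp add: irrotational_def distrib_left)
  show "irrotational2 E"
    unfolding irrotational2_def solenoidal2_def forall_2
    using *[OF g(2), of "E0 $ 1"] *[OF g(5), of "E0 $ 2"] by (simp add: E irrotational_def distrib_left)
  have "integrable cell (\<lambda>x. c)" for c :: complex
    by (rule sq_field_integrable[OF solenoidal_sq_field[OF solenoidal_const]])
  then have "(\<integral>x. c + g x \<partial>cell) = c" if "sq_field g" "(\<integral>x. g x \<partial>cell) = 0" for c g
    using that sq_field_integrable[OF that(1)] measure_cell by simp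
  then show "mean E = E0"
    using g by (simp add: mean_def vec_eq_iff forall_2 E)
qed

lemma cell_field_solenoidal:
  assumes L: "composite L" and E: "cell_field L E0 E"
  shows "solenoidal2 (\<lambda>x. blinfun_apply (L x) (E x))"
  unfolding solenoidal2_def
proof
  fix i
  show "solenoidal (\<lambda>x. blinfun_apply (L x) (E x) $ i)"
  proof (rule weakly_div_free_solenoidal)
    show "sq_field (\<lambda>x. blinfun_apply (L x) (E x) $ i)"
      by (intro sq_field_blinfun_apply L irrotational2_sq_field cell_field_irrotational[OF E])
    show "weakly_div_free (\<lambda>x. uncplx (blinfun_apply (L x) (E x) $ i))"
      using E by (simp add: cell_field_def)
  qed
qed

text \<open>Subtracting \<open>\<i> P\<close> with a real matrix \<open>P\<close> keeps fluxes divergence-free, because \<open>\<i>\<close> rotates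
  curl-free fields into divergence-free ones. The three claims integrate pointwise identities
  between null Lagrangians.\<close>

lemma effective_tensor_identities:
  assumes L: "composite L" and Ls: "effective_tensor L Ls"
    and real: "real_mat P" "real_mat A" "real_mat A'"
    and Lt_def: "\<And>x u. Lt x u = blinfun_apply (L x) u - \<i> *s (P *v u)"
    and T_def: "\<And>u. T u = blinfun_apply Ls u - \<i> *s (P *v u)"
  shows "(\<And>x u w. Lt x u \<bullet> w = u \<bullet> Lt x w) \<Longrightarrow> T u \<bullet> w = u \<bullet> T w"
    and "(\<And>x u. 0 \<le> Lt x u \<bullet> u) \<Longrightarrow> 0 \<le> T u \<bullet> u"
    and "(\<And>x u w. Lt x w \<bullet> (\<i> *s (A' *v Lt x u)) = (\<i> *s (A *v u)) \<bullet> w) \<Longrightarrow>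
      T w \<bullet> (\<i> *s (A' *v T u)) = (\<i> *s (A *v u)) \<bullet> w"
proof -
  have ex: "\<exists>E. irrotational2 E \<and> mean E = u \<and> solenoidal2 (\<lambda>x. Lt x (E x))
      \<and> mean (\<lambda>x. Lt x (E x)) = T u" for u
  proof -
    obtain E where E: "cell_field L u E"
      and avg: "blinfun_apply Ls u = (\<integral>x. blinfun_apply (L x) (E x) \<partial>cell)"
      using Ls unfolding effective_tensor_def set_integral_cell by blast
    note irr = cell_field_irrotational[OF E]
    note sol = cell_field_solenoidal[OF L E]
    have sq: "sq_field (\<lambda>x. E x $ i)" for i
      by (rule irrotational2_sq_field[OF irr(1)])
    have Lt: "Lt x (E x) = blinfun_apply (L x) (E x) + (- \<i>) *s (P *v E x)" for x
      by (simp add: Lt_def vec_eq_iff)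
    have mP: "real_mat (- P)"
      using real(1) by (simp add: real_mat_def)
    \<comment> \<open>The real matrix acts on the rotated field, which is divergence-free; linearity
      then moves the factor \<i> outside.\<close>
    have "solenoidal2 (\<lambda>x. (- P) *v (\<i> *s E x))"
      using irr(1) by (intro solenoidal2_real_mat mP) (simp add: irrotational2_def)
    moreover have "(- P) *v (\<i> *s e) = (- \<i>) *s (P *v e)" for e
      by (simp add: vec_eq_iff matrix_vector_mult_def sum_2 algebra_simps)
    ultimately have solP: "solenoidal2 (\<lambda>x. (- \<i>) *s (P *v E x))"
      by simp
    have "solenoidal2 (\<lambda>x. Lt x (E x))"
      unfolding Lt by (rule solenoidal2_add[OF sol solP])
    moreover have "mean (\<lambda>x. (- \<i>) *s (P *v E x)) = (- \<i>) *s (P *v u)"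
      by (simp only: mean_vector_scalar_mult mean_matrix_vector_mult[OF sq] irr(2))
    then have "mean (\<lambda>x. Lt x (E x)) = T u"
      unfolding Lt
      by (subst mean_add[OF solenoidal2_sq_field[OF sol] solenoidal2_sq_field[OF solP]])
        (simp add: T_def avg mean_eq_integral[OF solenoidal2_sq_field[OF sol]] vec_eq_iff)
    ultimately show ?thesis using irr by blast
  qed
  obtain E where E: "irrotational2 E" "mean E = u" "solenoidal2 (\<lambda>x. Lt x (E x))"
    "mean (\<lambda>x. Lt x (E x)) = T u" using ex by blast
  obtain F where F: "irrotational2 F" "mean F = w" "solenoidal2 (\<lambda>x. Lt x (F x))"
    "mean (\<lambda>x. Lt x (F x)) = T w" using ex by blast
  show "T u \<bullet> w = u \<bullet> T w" if "\<And>x u w. Lt x u \<bullet> w = u \<bullet> Lt x w"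
    using div_curl2[OF E(3) F(1)] div_curl2[OF F(3) E(1)] E F that
    by (simp add: inner_commute)
  show "0 \<le> T u \<bullet> u" if "\<And>x u. 0 \<le> Lt x u \<bullet> u"
    using div_curl2[OF E(3) E(1)] E that
    by (metis (mono_tags, lifting) Bochner_Integration.integral_nonneg)
  show "T w \<bullet> (\<i> *s (A' *v T u)) = (\<i> *s (A *v u)) \<bullet> w"
    if pt: "\<And>x u w. Lt x w \<bullet> (\<i> *s (A' *v Lt x u)) = (\<i> *s (A *v u)) \<bullet> w"
  proof -
    \<comment> \<open>The rotated flux is curl-free and the rotated field divergence-free, so the
      div-curl lemma applies to both sides of the pointwise identity.\<close>
    have irrA: "irrotational2 (\<lambda>x. \<i> *s (A' *v Lt x (E x)))"
      by (intro irrotational2_rotate solenoidal2_real_mat real E)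
    have "solenoidal2 (\<lambda>x. A *v (\<i> *s E x))"
      using E(1) by (intro solenoidal2_real_mat real) (simp add: irrotational2_def)
    then have solA: "solenoidal2 (\<lambda>x. \<i> *s (A *v E x))"
      by (simp add: vector_scalar_commute)
    have "T w \<bullet> (\<i> *s (A' *v T u)) = (\<integral>x. Lt x (F x) \<bullet> (\<i> *s (A' *v Lt x (E x))) \<partial>cell)"
      by (simp add: div_curl2[OF F(3) irrA] mean_vector_scalar_mult E F
          mean_matrix_vector_mult[OF solenoidal2_sq_field[OF E(3)]])
    also have "\<dots> = (\<i> *s (A *v u)) \<bullet> w"
      by (simp add: pt div_curl2[OF solA F(1)] mean_vector_scalar_mult E F
          mean_matrix_vector_mult[OF irrotational2_sq_field[OF E(1)]])
    finally show ?thesis .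
  qed
qed

section \<open>The pointwise constitutive law\<close>

lemma inner_matrix_vector_mult: "(A *v u) \<bullet> w = u \<bullet> (ctranspose A *v w)"
  for A :: "complex^2^2"
  by (simp add: inner_vec_def sum_2 inner_complex_def matrix_vector_mult_def ctranspose_def
      transpose_def algebra_simps)

lemma inner_vector_scalar_mult: "(c *s u) \<bullet> v = u \<bullet> (cnj c *s v)" for u v :: "complex^2"
  by (simp add: inner_vec_def sum_2 inner_complex_def algebra_simps)

lemma cnj_vec_simps [simp]:
  "cnj_vec (cnj_vec u) = u"
  "cnj_vec (u + v) = cnj_vec u + cnj_vec v"
  "cnj_vec (u - v) = cnj_vec u - cnj_vec v"
  "cnj_vec (c *s u) = cnj c *s cnj_vec u"
  "cnj_vec (A *v u) = cnj_mat A *v cnj_vec u"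
  by (simp_all add: cnj_vec_def vec_eq_iff matrix_vector_mult_def)

lemma inner_cnj_vec: "cnj_vec u \<bullet> cnj_vec v = u \<bullet> v"
  by (simp add: cnj_vec_def inner_vec_def inner_complex_def)

lemma inner_cnj_vec_left: "cnj_vec u \<bullet> v = u \<bullet> cnj_vec v"
  using inner_cnj_vec[of u "cnj_vec v"] by simp

lemma cnj_mat_simps [simp]:
  "cnj_mat (cnj_mat A) = A"
  "cnj_mat (A + B) = cnj_mat A + cnj_mat B"
  "cnj_mat (A - B) = cnj_mat A - cnj_mat B"
  "cnj_mat (A ** B) = cnj_mat A ** cnj_mat B"
  "cnj_mat (mat 1) = mat 1"
  by (simp_all add: vec_eq_iff matrix_matrix_mult_def mat_def)

lemma ctranspose_simps [simp]:
  "ctranspose (ctranspose A) = A"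
  "ctranspose (A + B) = ctranspose A + ctranspose B"
  "ctranspose (A - B) = ctranspose A - ctranspose B"
  "ctranspose (A ** B) = ctranspose B ** ctranspose A"
  "ctranspose (mat 1) = mat 1"
  "ctranspose (cnj_mat A) = transpose A"
  "cnj_mat (ctranspose A) = transpose A"
  by (simp_all add: vec_eq_iff matrix_matrix_mult_def mat_def ctranspose_def transpose_def mult.commute)

lemma pos_def_hermitian_iff:
  "pos_def_hermitian A \<longleftrightarrow> ctranspose A = A \<and> (\<forall>u. u \<noteq> 0 \<longrightarrow> 0 < u \<bullet> (A *v u))"
  by (simp add: pos_def_hermitian_def hermitian_mats_def inner_vec_def inner_complex_def)

lemma inner_I_hermitian:
  fixes A :: "complex^2^2"
  assumes "ctranspose A = A"
  shows "(\<i> *s (A *v u)) \<bullet> w = - (u \<bullet> (\<i> *s (A *v w)))"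
  by (simp add: inner_vector_scalar_mult inner_matrix_vector_mult assms vector_scalar_commute)

text \<open>The left side is the real part of a complex bilinear form in the conjugates of u and w,
  and that form inherits the symmetry of \<open>B\<close>.\<close>

lemma inner_symmetric_mat:
  fixes B :: "complex^2^2"
  assumes "transpose B = B"
  shows "u \<bullet> (B *v cnj_vec w) = w \<bullet> (B *v cnj_vec u)"
proof -
  have "ctranspose B = cnj_mat B"
    using ctranspose_simps(7)[of B] assms by (metis cnj_mat_simps(1))
  then have "u \<bullet> (B *v cnj_vec w) = (cnj_mat B *v u) \<bullet> cnj_vec w"
    by (metis ctranspose_simps(1) inner_matrix_vector_mult)
  also have "\<dots> = (B *v cnj_vec u) \<bullet> w"
    using inner_cnj_vec_left[of "B *v cnj_vec u" "cnj_vec w"] by simp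
  finally show ?thesis by (simp add: inner_commute)
qed

lemma matrix_sub_rdistrib: "(A - B) ** C = A ** C - B ** C" for A B :: "'a::ring_1^'n^'m"
  by (simp add: vec_eq_iff matrix_matrix_mult_def sum_subtractf left_diff_distrib)

lemma matrix_sub_ldistrib: "C ** (A - B) = C ** A - C ** B" for A B :: "'a::ring_1^'n^'m"
  by (simp add: vec_eq_iff matrix_matrix_mult_def sum_subtractf right_diff_distrib)

lemma inner_I_I: "(\<i> *s u) \<bullet> (\<i> *s v) = u \<bullet> v" for u v :: "complex^2"
  by (simp add: inner_vec_def inner_complex_def sum_2)

lemma cnj_vec_I: "cnj_vec (\<i> *s u) = - (\<i> *s cnj_vec u)"
  by (simp add: cnj_vec_def vec_eq_iff)

lemma matrix_vector_mult_uminus: "A *v (- u) = - (A *v u)" for A :: "'a::ring_1^'n^'m"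
  by (simp add: vec_eq_iff matrix_vector_mult_def sum_negf)

text \<open>Replacing (u, v) by (\<i> u, \<i> v) keeps the \<open>X\<close> terms and reverses the
  sign of the \<open>Y\<close> terms, so the symmetry identity splits into one for each
  matrix.\<close>

lemma K_symmetric:
  assumes "\<And>u v. blinfun_apply (K X Y) u \<bullet> v = u \<bullet> blinfun_apply (K X Y) v"
  shows "ctranspose X = X" "transpose Y = Y"
proof -
  have sym: "(X *v u) \<bullet> v + (Y *v cnj_vec u) \<bullet> v = u \<bullet> (X *v v) + u \<bullet> (Y *v cnj_vec v)" for u v
    using assms[of u v] by (simp add: K_apply inner_add_left inner_add_right)
  have 1: "(X *v (\<i> *s u)) \<bullet> (\<i> *s v) = (X *v u) \<bullet> v"
    "(\<i> *s u) \<bullet> (X *v (\<i> *s v)) = u \<bullet> (X *v v)" for u v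
    by (simp_all add: vector_scalar_commute inner_I_I)
  have 2: "(Y *v cnj_vec (\<i> *s u)) \<bullet> (\<i> *s v) = - ((Y *v cnj_vec u) \<bullet> v)"
    "(\<i> *s u) \<bullet> (Y *v cnj_vec (\<i> *s v)) = - (u \<bullet> (Y *v cnj_vec v))" for u v
    by (simp_all only: cnj_vec_I matrix_vector_mult_uminus vector_scalar_commute inner_minus_left
        inner_minus_right inner_I_I)
  have X: "(X *v u) \<bullet> v = u \<bullet> (X *v v)" and Y: "(Y *v cnj_vec u) \<bullet> v = u \<bullet> (Y *v cnj_vec v)" for u v
    using sym[of u v] sym[of "\<i> *s u" "\<i> *s v"] unfolding 1 2 by linarith+
  have "u \<bullet> (ctranspose X *v v - X *v v) = 0" for u v
    using X[of u v] by (simp add: inner_matrix_vector_mult inner_diff_right)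
  then have "ctranspose X *v v = X *v v" for v
    by (metis inner_eq_zero_iff right_minus_eq)
  then show "ctranspose X = X" by (simp add: matrix_eq)
  have "u \<bullet> (transpose Y *v cnj_vec v - Y *v cnj_vec v) = 0" for u v
    using Y[of u v] by (simp add: inner_matrix_vector_mult inner_diff_right inner_cnj_vec_left)
  then have "transpose Y *v cnj_vec v = Y *v cnj_vec v" for v
    by (metis inner_eq_zero_iff right_minus_eq)
  from this[of "cnj_vec _"] show "transpose Y = Y"
    by (simp add: matrix_eq)
qed

text \<open>The adjugate formula: rational in the entries, which gives continuity, and written with
  the same \<open>transpose (cof B)\<close> that occurs in \<open>BY\<close>.\<close>

definition inv2 :: "complex^2^2 \<Rightarrow> complex^2^2" where
  "inv2 B = map_matrix (\<lambda>z. z / det B) (transpose (cof B))"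

lemma inv2_inverse:
  assumes "det B \<noteq> 0"
  shows "inv2 B ** B = mat 1" "B ** inv2 B = mat 1"
proof -
  have "inv2 B ** B = map_matrix (\<lambda>z. z / det B) (transpose (cof B) ** B)"
    "B ** inv2 B = map_matrix (\<lambda>z. z / det B) (B ** transpose (cof B))"
    by (simp_all add: inv2_def vec_eq_iff matrix_matrix_mult_def sum_2 add_divide_distrib)
  then show "inv2 B ** B = mat 1" "B ** inv2 B = mat 1"
    using assms by (simp_all add: cof_mult vec_eq_iff mat_def)
qed

lemma matrix_inverse_unique:
  fixes B C D :: "'a::comm_ring_1^'n^'n"
  assumes "C ** B = mat 1" "B ** D = mat 1"
  shows "C = D"
proof -
  have "C = C ** (B ** D)" by (simp add: assms)
  also have "\<dots> = D" unfolding matrix_mul_assoc assms(1) by simp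
  finally show ?thesis .
qed

lemma matrix_inv_inv2:
  assumes "det B \<noteq> 0"
  shows "matrix_inv B = inv2 B"
proof -
  have "B ** matrix_inv B = mat 1 \<and> matrix_inv B ** B = mat 1"
    unfolding matrix_inv_def
    by (rule someI[of "\<lambda>C. B ** C = mat 1 \<and> C ** B = mat 1" "inv2 B"])
      (simp add: inv2_inverse[OF assms])
  then show ?thesis
    using matrix_inverse_unique[OF _ inv2_inverse(2)[OF assms]] by simp
qed

lemma det_nonzero_of_pos:
  fixes B :: "complex^2^2"
  assumes "\<And>u. u \<noteq> 0 \<Longrightarrow> 0 < u \<bullet> (B *v u)"
  shows "det B \<noteq> 0"
proof -
  have "inj ((*v) B)"
  proof (rule injI)
    fix u v assume "B *v u = B *v v"
    then have "B *v (u - v) = 0" by (simp add: matrix_vector_mult_diff_distrib)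
    then show "u = v" using assms[of "u - v"] by force
  qed
  then show ?thesis
    using matrix_left_invertible_injective invertible_left_inverse invertible_det_nz by blast
qed

lemma hermitian_eq_0:
  fixes B :: "complex^2^2"
  assumes "ctranspose B = B" "\<And>u. u \<bullet> (B *v u) = 0"
  shows "B = 0"
proof -
  have "u \<bullet> (B *v v) = 0" for u v
  proof -
    have "v \<bullet> (B *v u) = u \<bullet> (B *v v)"
      using inner_matrix_vector_mult[of B v u] assms(1) by (simp add: inner_commute)
    then show ?thesis
      using assms(2)[of "u + v"] assms(2)[of u] assms(2)[of v]
      by (simp add: matrix_vector_right_distrib inner_add_left inner_add_right)
  qed
  then have "B *v v = 0" for v
    by (metis inner_eq_zero_iff)
  then show ?thesis by (simp add: matrix_eq)
qed

lemma hermitian_inverse: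
  fixes B C :: "complex^2^2"
  assumes "ctranspose B = B" "C ** B = mat 1" "B ** C = mat 1"
  shows "ctranspose C = C"
proof -
  have "ctranspose C ** B = mat 1"
    using arg_cong[OF assms(3), of ctranspose] assms(1) by simp
  then show ?thesis
    using matrix_inverse_unique assms(3) by blast
qed

lemma matrix_vector_mult_scaleR_right: "B *v (c *\<^sub>R x) = c *\<^sub>R (B *v x)" for B :: "complex^2^2"
  by (simp add: vec_eq_iff matrix_vector_mult_def scaleR_sum_right)

lemma scaleR_matrix_vector_mult: "(c *\<^sub>R B) *v x = c *\<^sub>R (B *v x)" for B :: "complex^2^2"
  by (simp add: vec_eq_iff matrix_vector_mult_def scaleR_sum_right)

text \<open>The form of the block matrix with diagonal blocks X, cnj X and off-diagonal blocks Y,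
  Y^H; the two off-diagonal contributions have equal real parts, hence the factor 2.\<close>

definition block_form :: "complex^2^2 \<Rightarrow> complex^2^2 \<Rightarrow> complex^2 \<Rightarrow> complex^2 \<Rightarrow> real" where
  "block_form X Y u v = u \<bullet> (X *v u) + v \<bullet> (cnj_mat X *v v) + 2 * (u \<bullet> (Y *v v))"

text \<open>The block form is the Hermitian extension of the real quadratic form of \<open>K X Y\<close>, whose
  real points are the pairs with \<open>v\<close> the conjugate of \<open>u\<close>.\<close>

lemma block_form_complexification:
  assumes "transpose Y = Y"
  shows "block_form X Y (a + \<i> *s b) (cnj_vec a + \<i> *s cnj_vec b)
    = 2 * (blinfun_apply (K X Y) a \<bullet> a) + 2 * (blinfun_apply (K X Y) b \<bullet> b)"
proof -
  let ?v = "cnj_vec a + \<i> *s cnj_vec b"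
  have "?v = cnj_vec (a - \<i> *s b)"
    by (simp add: cnj_vec_I del: cnj_vec_simps(4))
  then have 1: "?v \<bullet> (cnj_mat X *v ?v) = (a - \<i> *s b) \<bullet> (X *v (a - \<i> *s b))"
    using inner_cnj_vec[of "a - \<i> *s b" "X *v (a - \<i> *s b)"] by simp
  have tr: "transpose (map_matrix ((*) \<i>) Y) = map_matrix ((*) \<i>) Y"
    using assms by (auto simp: vec_eq_iff transpose_def)
  have mm: "map_matrix ((*) \<i>) Y *v w = \<i> *s (Y *v w)" for w
    by (simp add: vec_eq_iff matrix_vector_mult_def sum_distrib_left mult.assoc)
  \<comment> \<open>The mixed terms cancel: \<i> Y is again complex symmetric, and moving \<i>
    across the real inner product changes the sign.\<close>
  have 2: "a \<bullet> (\<i> *s (Y *v cnj_vec b)) + (\<i> *s b) \<bullet> (Y *v cnj_vec a) = 0"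
    using inner_symmetric_mat[OF tr, of a b]
    by (simp add: mm inner_vector_scalar_mult)
  have 3: "(\<i> *s b) \<bullet> (\<i> *s w) = b \<bullet> w" for w
    by (rule inner_I_I)
  show ?thesis
    unfolding block_form_def 1 using 2
    by (simp add: K_apply matrix_vector_right_distrib matrix_vector_mult_diff_distrib
        inner_add_left inner_add_right inner_diff_left inner_diff_right vector_scalar_commute 3
        algebra_simps inner_commute[of "X *v _"] inner_commute[of "Y *v _"])
qed

lemma block_form_pos:
  assumes K: "K X Y \<in> Sym_pos" and nz: "u \<noteq> 0 \<or> v \<noteq> 0"
  shows "0 < block_form X Y u v"
proof -
  have Y: "transpose Y = Y"
    using K by (intro K_symmetric(2)[of X]) (simp add: Sym_pos_def)
  \<comment> \<open>Real and imaginary part of (u, v) for the conjugation (u, v) -> (cnj v, cnj u),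
    whose fixed points are the pairs (a, cnj a).\<close>
  define a where "a = (1/2) *s (u + cnj_vec v)"
  define b where "b = (- \<i>/2) *s (u - cnj_vec v)"
  have u: "u = a + \<i> *s b" and v: "v = cnj_vec a + \<i> *s cnj_vec b"
    by (simp_all add: a_def b_def vec_eq_iff cnj_vec_def field_simps)
  have "a \<noteq> 0 \<or> b \<noteq> 0"
    using nz u v by (auto simp: cnj_vec_def vec_eq_iff)
  moreover have "0 \<le> blinfun_apply (K X Y) w \<bullet> w" "w \<noteq> 0 \<Longrightarrow> 0 < blinfun_apply (K X Y) w \<bullet> w" for w
    using K by (auto simp: Sym_pos_def intro: less_imp_le) (cases "w = 0"; auto intro: less_imp_le)
  ultimately show ?thesis
    unfolding u v block_form_complexification[OF Y]
    by (metis add_nonneg_pos add_pos_nonneg mult_nonneg_nonneg mult_pos_pos zero_le_numeral zero_less_numeral)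
qed

section \<open>Beltrami form of the constitutive law\<close>

locale fixed_point_matrix =
  fixes X Y M Si :: "complex^2^2"
  assumes X: "ctranspose X = X" and Y: "transpose Y = Y"
    and M: "pos_def_hermitian M"
    and S_nonneg: "\<And>u. 0 \<le> u \<bullet> ((cnj_mat X + M) *v u)"
    and Si_left: "Si ** (cnj_mat X + M) = mat 1"
    and Si_right: "(cnj_mat X + M) ** Si = mat 1"
    and fixed: "X - M = Y ** Si ** cnj_mat Y"
begin

definition S where "S = cnj_mat X + M"
definition A where "A = map_matrix (\<lambda>z. complex_of_real (Re z)) M"
definition P where "P = map_matrix (\<lambda>z. complex_of_real (Im z)) M"

lemma real_A: "real_mat A" and real_P: "real_mat P"
  by (simp_all add: real_mat_def A_def P_def)

lemma Y_ct: "ctranspose Y = cnj_mat Y"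
  using Y by (auto simp: vec_eq_iff ctranspose_def transpose_def)

lemma M_herm: "ctranspose M = M"
  using M by (simp add: pos_def_hermitian_iff)

lemma cnj_A: "cnj_mat A = A"
  by (simp add: A_def vec_eq_iff)

lemma M_decomp: "M *v u = A *v u + \<i> *s (P *v u)"
  by (simp add: vec_eq_iff matrix_vector_mult_def sum_2 A_def P_def complex_eq_iff)

lemma A_eq: "A + A = M + cnj_mat M"
  by (simp add: A_def vec_eq_iff complex_eq_iff)

lemma S_herm: "ctranspose S = S"
proof -
  have "ctranspose (cnj_mat X) = cnj_mat X"
    using X by (metis ctranspose_simps(6,7))
  then show ?thesis using M_herm by (simp add: S_def)
qed

lemma A_herm: "ctranspose A = A"
  using M_herm by (auto simp: A_def ctranspose_def transpose_def vec_eq_iff complex_eq_iff)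

lemma IP_herm: "(\<i> *s (P *v u)) \<bullet> w = u \<bullet> (\<i> *s (P *v w))"
proof -
  have "(\<i> *s (P *v x)) = M *v x - A *v x" for x by (simp add: M_decomp)
  then show ?thesis
    by (simp add: inner_diff_left inner_diff_right inner_matrix_vector_mult M_herm A_herm)
qed

lemma A_pos: "u \<noteq> 0 \<Longrightarrow> 0 < u \<bullet> (A *v u)"
proof -
  assume u: "u \<noteq> 0"
  have "u \<bullet> (cnj_mat M *v u) = cnj_vec u \<bullet> (M *v cnj_vec u)"
    by (simp add: inner_cnj_vec_left)
  moreover have "cnj_vec u \<noteq> 0"
    using u by (simp add: cnj_vec_def vec_eq_iff)
  ultimately have "0 < u \<bullet> (M *v u) + u \<bullet> (cnj_mat M *v u)"
    using M u by (auto simp: pos_def_hermitian_iff intro: add_pos_pos)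
  also have "\<dots> = u \<bullet> ((A + A) *v u)"
    by (simp add: A_eq matrix_vector_mult_add_rdistrib inner_add_right)
  finally show ?thesis
    unfolding matrix_vector_mult_add_rdistrib inner_add_right by simp
qed

lemma Si_herm: "ctranspose Si = Si"
  using hermitian_inverse[OF S_herm] Si_left Si_right by (simp add: S_def)

lemma SiS: "Si ** S = mat 1" "S ** Si = mat 1"
  using Si_left Si_right by (simp_all add: S_def)

text \<open>X and M are eliminated in favour of S and the real part A, through X = cnj S - cnj M and
  M + cnj M = 2 A.\<close>

lemma fixed': "Y ** Si ** cnj_mat Y = cnj_mat S - A - A"
proof -
  have "X - M = cnj_mat S - (A + A)"
    by (simp add: S_def A_eq)
  then show ?thesis using fixed by (simp add: diff_diff_eq)
qed

text \<open>The product Y S^-1 cnj Y (cnj S)^-1 Y is evaluated twice: with \<open>fixed'\<close> for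
  its first three factors, and with the conjugate of \<open>fixed'\<close> for its last
  three.\<close>

lemma exchange: "Y ** Si ** A = A ** cnj_mat Si ** Y"
proof -
  let ?S' = "cnj_mat S" and ?Si' = "cnj_mat Si"
  have inv': "?S' ** ?Si' = mat 1"
    using arg_cong[OF SiS(2), of cnj_mat] by simp
  have c: "cnj_mat Y ** ?Si' ** Y = S - A - A"
    using arg_cong[OF fixed', of cnj_mat] by (simp only: cnj_mat_simps cnj_A)
  have "Y ** Si ** cnj_mat Y ** ?Si' ** Y = Y - A ** ?Si' ** Y - A ** ?Si' ** Y"
    unfolding fixed' by (simp only: matrix_sub_rdistrib inv' matrix_mul_lid)
  moreover have "Y ** Si ** cnj_mat Y ** ?Si' ** Y = Y - Y ** Si ** A - Y ** Si ** A"
  proof -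
    have "Y ** Si ** cnj_mat Y ** ?Si' ** Y = Y ** Si ** (S - A - A)"
      unfolding c[symmetric] by (simp add: matrix_mul_assoc)
    also have "\<dots> = Y ** (Si ** S) - Y ** Si ** A - Y ** Si ** A"
      by (simp only: matrix_sub_ldistrib matrix_mul_assoc)
    finally show ?thesis by (simp only: SiS matrix_mul_rid)
  qed
  ultimately have "Y ** Si ** A + Y ** Si ** A = A ** ?Si' ** Y + A ** ?Si' ** Y"
    by (simp add: algebra_simps)
  then show ?thesis
    by (simp add: vec_eq_iff)
qed

definition A' where "A' = inv2 A"

lemma A'_inv: "A' ** A = mat 1" "A ** A' = mat 1"
  using inv2_inverse[OF det_nonzero_of_pos[OF A_pos]] by (simp_all add: A'_def)

lemma cnj_A': "cnj_mat A' = A'"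
proof (rule matrix_inverse_unique[OF _ A'_inv(2)])
  show "cnj_mat A' ** A = mat 1"
    using arg_cong[OF A'_inv(1), of cnj_mat] by (simp add: cnj_A)
qed

lemma A'_herm: "ctranspose A' = A'"
  by (rule hermitian_inverse[OF A_herm A'_inv])

lemma real_A': "real_mat A'"
  using cnj_A' by (simp add: real_mat_def vec_eq_iff complex_is_Real_iff complex_eq_iff)

text \<open>\<open>exchange\<close> multiplied by A^-1 on both sides. This matrix is the coefficient
  of the Beltrami system after applying A^-1, up to the factor q.\<close>

lemma D_symmetric: "transpose (A' ** Y ** Si) = A' ** Y ** Si"
proof -
  have "A' ** (Y ** Si ** A) ** A' = A' ** (A ** cnj_mat Si ** Y) ** A'"
    by (simp add: exchange)
  moreover have "A' ** (Y ** Si ** A) ** A' = A' ** Y ** Si ** (A ** A')"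
    by (simp add: matrix_mul_assoc)
  moreover have "A' ** (A ** cnj_mat Si ** Y) ** A' = (A' ** A) ** cnj_mat Si ** Y ** A'"
    by (simp add: matrix_mul_assoc)
  ultimately have eq: "A' ** Y ** Si = cnj_mat Si ** Y ** A'"
    by (simp add: A'_inv)
  have t: "transpose (cnj_mat Si) = Si" "transpose A' = A'"
    using ctranspose_simps(7)[of A'] Si_herm A'_herm cnj_A' by (simp_all add: ctranspose_def)
  have "transpose (A' ** Y ** Si) = A' ** Y ** Si"
    by (subst eq) (simp add: matrix_transpose_mul Y t matrix_mul_assoc)
  then show ?thesis .
qed

text \<open>The flux J_t at a point where the crystal is turned by \<phi>, with q = cis (2
  \<phi>).\<close>

definition Lt :: "complex \<Rightarrow> complex^2 \<Rightarrow> complex^2" where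
  "Lt q u = X *v u + q *s (Y *v cnj_vec u) - \<i> *s (P *v u)"

lemma Lt_eq: "Lt q u = A *v u + (Y ** Si ** cnj_mat Y) *v u + q *s (Y *v cnj_vec u)"
proof -
  have "X *v u = M *v u + (Y ** Si ** cnj_mat Y) *v u"
    by (simp add: fixed[symmetric] matrix_vector_mult_diff_rdistrib)
  then show ?thesis by (simp add: Lt_def M_decomp)
qed

definition beltrami :: "complex \<Rightarrow> complex^2 \<Rightarrow> complex^2" where
  "beltrami q u = S *v cnj_vec u + cnj q *s (cnj_mat Y *v u)"

lemma cnj_vec_Lt_plus: "cnj_vec (Lt q u + A *v u) = beltrami q u"
proof -
  have "Lt q u + A *v u = (A + A + Y ** Si ** cnj_mat Y) *v u + q *s (Y *v cnj_vec u)"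
    unfolding Lt_eq matrix_vector_mult_add_rdistrib by (simp only: add_ac)
  also have "A + A + Y ** Si ** cnj_mat Y = cnj_mat S"
    unfolding fixed' by simp
  finally show ?thesis by (simp add: beltrami_def)
qed

text \<open>Applying S^-1 to \<open>beltrami q u\<close> gives cnj u + cnj q S^-1 cnj Y u. In the
  second term the outer q cancels against cnj q, which leaves the two summands of
  \<open>Lt_eq\<close> besides A u.\<close>

lemma Lt_minus:
  assumes q: "q * cnj q = 1"
  shows "Lt q u - A *v u = q *s (Y *v (Si *v beltrami q u))"
proof -
  have "Si *v (S *v w) = w" for w
    by (simp add: matrix_vector_mul_assoc SiS)
  then show ?thesis
    using q
    by (simp add: Lt_eq beltrami_def matrix_vector_right_distrib vector_scalar_commute
        vector_add_ldistrib vector_smult_assoc matrix_vector_mul_assoc matrix_mul_assoc)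
qed

text \<open>Twice the quantity is the form of S^-1 at \<open>beltrami q u\<close>, and S^-1 inherits
  nonnegativity from S.\<close>

lemma Lt_nonneg:
  assumes q: "q * cnj q = 1"
  shows "0 \<le> Lt q u \<bullet> u"
proof -
  let ?b = "beltrami q u" and ?y = "cnj_mat Y *v u"
  have Si_nonneg: "0 \<le> w \<bullet> (Si *v w)" for w
    using S_nonneg[of "Si *v w"]
    by (simp add: S_def[symmetric] matrix_vector_mul_assoc SiS inner_commute[of w])
  have Sib: "Si *v ?b = cnj_vec u + cnj q *s (Si *v ?y)"
    by (simp add: beltrami_def matrix_vector_right_distrib vector_scalar_commute
        matrix_vector_mul_assoc SiS)
  have 1: "(S *v cnj_vec u) \<bullet> cnj_vec u = (A *v u) \<bullet> u + (A *v u) \<bullet> u + ?y \<bullet> (Si *v ?y)"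
  proof -
    have "(S *v cnj_vec u) \<bullet> cnj_vec u = (cnj_mat S *v u) \<bullet> u"
      using inner_cnj_vec[of "cnj_mat S *v u" u] by simp
    also have "cnj_mat S = A + A + Y ** Si ** cnj_mat Y"
      unfolding fixed' by simp
    also have "((A + A + Y ** Si ** cnj_mat Y) *v u) \<bullet> u
        = (A *v u) \<bullet> u + (A *v u) \<bullet> u + ((Y ** Si ** cnj_mat Y) *v u) \<bullet> u"
      by (simp only: matrix_vector_mult_add_rdistrib inner_add_left)
    also have "((Y ** Si ** cnj_mat Y) *v u) \<bullet> u = (Si *v ?y) \<bullet> ?y"
      using inner_matrix_vector_mult[of Y "Si *v ?y" u]
      by (simp add: Y_ct matrix_vector_mul_assoc matrix_mul_assoc)
    finally show ?thesis by (simp add: inner_commute)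
  qed
  have 2: "(S *v cnj_vec u) \<bullet> (cnj q *s (Si *v ?y)) = (cnj q *s ?y) \<bullet> cnj_vec u"
  proof -
    have "(S *v cnj_vec u) \<bullet> (cnj q *s (Si *v ?y)) = cnj_vec u \<bullet> (S *v (cnj q *s (Si *v ?y)))"
      by (simp only: inner_matrix_vector_mult S_herm)
    also have "S *v (cnj q *s (Si *v ?y)) = cnj q *s ?y"
    proof -
      have "S *v (Si *v w) = w" for w
        by (simp add: matrix_vector_mul_assoc SiS)
      then show ?thesis by (simp only: vector_scalar_commute)
    qed
    finally show ?thesis by (simp add: inner_commute)
  qed
  have 3: "(cnj q *s ?y) \<bullet> (cnj q *s (Si *v ?y)) = ?y \<bullet> (Si *v ?y)"
    using q by (simp add: inner_vector_scalar_mult vector_smult_assoc)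
  have 4: "(cnj q *s ?y) \<bullet> cnj_vec u = (q *s (Y *v cnj_vec u)) \<bullet> u"
    using inner_cnj_vec[of "q *s (Y *v cnj_vec u)" u] by simp
  have 5: "Lt q u \<bullet> u = (A *v u) \<bullet> u + ?y \<bullet> (Si *v ?y) + (q *s (Y *v cnj_vec u)) \<bullet> u"
  proof -
    have "((Y ** Si ** cnj_mat Y) *v u) \<bullet> u = (Si *v ?y) \<bullet> ?y"
      using inner_matrix_vector_mult[of Y "Si *v ?y" u]
      by (simp add: Y_ct matrix_vector_mul_assoc matrix_mul_assoc)
    then show ?thesis
      unfolding Lt_eq inner_add_left by (simp add: inner_commute)
  qed
  have "?b \<bullet> (Si *v ?b) = 2 * (Lt q u \<bullet> u)"
    unfolding Sib unfolding beltrami_def inner_add_left inner_add_right 1 2 3 4 5 by simp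
  then show ?thesis using Si_nonneg[of ?b] by simp
qed

text \<open>With s = J + A u and p = J - A u the Beltrami law reads A^-1 p = q D cnj s. Symmetry of
  D makes s2 \<bullet> \<i> A^-1 p1 symmetric in the two fields, and \<i> A^-1 is skew, so s2
  \<bullet> \<i> A^-1 p1 + p2 \<bullet> \<i> A^-1 s1 = 0. Expanded, this sum is twice the difference
  of the two sides.\<close>

lemma Lt_duality:
  assumes q: "q * cnj q = 1"
  shows "Lt q w \<bullet> (\<i> *s (A' *v Lt q u)) = (\<i> *s (A *v u)) \<bullet> w"
proof -
  define D where "D = A' ** Y ** Si"
  define J1 s1 p1 where "J1 = Lt q u" and "s1 = J1 + A *v u" and "p1 = J1 - A *v u"
  define J2 s2 p2 where "J2 = Lt q w" and "s2 = J2 + A *v w" and "p2 = J2 - A *v w"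
  have A'A: "A' *v (A *v v) = v" for v
    by (simp add: matrix_vector_mul_assoc A'_inv)
  have Ap: "A' *v p1 = q *s (D *v cnj_vec s1)" "A' *v p2 = q *s (D *v cnj_vec s2)"
    unfolding p1_def p2_def s1_def s2_def J1_def J2_def cnj_vec_Lt_plus Lt_minus[OF q] D_def
    by (simp_all add: vector_scalar_commute matrix_vector_mul_assoc matrix_mul_assoc)
  have tr: "transpose (map_matrix ((*) (\<i> * q)) D) = map_matrix ((*) (\<i> * q)) D"
    using D_symmetric by (auto simp: vec_eq_iff transpose_def D_def[symmetric])
  have mm: "map_matrix ((*) (\<i> * q)) D *v v = \<i> *s (q *s (D *v v))" for v
    by (simp add: vec_eq_iff matrix_vector_mult_def sum_distrib_left mult.assoc)
  have A'_inner: "p2 \<bullet> (\<i> *s (A' *v s1)) = - (s1 \<bullet> (\<i> *s (A' *v p2)))"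
    using inner_I_hermitian[OF A'_herm, of s1 p2] by (simp add: inner_commute)
  have "s2 \<bullet> (\<i> *s (A' *v p1)) + p2 \<bullet> (\<i> *s (A' *v s1)) = 0"
    unfolding A'_inner Ap
    using inner_symmetric_mat[OF tr, of s2 s1] unfolding mm by simp
  moreover have "s2 \<bullet> (\<i> *s (A' *v p1)) + p2 \<bullet> (\<i> *s (A' *v s1))
      = 2 * (J2 \<bullet> (\<i> *s (A' *v J1))) - 2 * ((A *v w) \<bullet> (\<i> *s u))"
    unfolding s1_def s2_def p1_def p2_def
    by (simp add: matrix_vector_right_distrib matrix_vector_mult_diff_distrib A'A
        vector_add_ldistrib vector_ssub_ldistrib inner_add_left inner_add_right
        inner_diff_left inner_diff_right)
  moreover have "(A *v w) \<bullet> (\<i> *s u) = (\<i> *s (A *v u)) \<bullet> w"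
    by (simp only: inner_matrix_vector_mult A_herm vector_scalar_commute)
      (rule inner_commute)
  ultimately show ?thesis
    by (simp add: J1_def J2_def)
qed

lemma effective_tensor_eq:
  assumes L: "composite L" and Ls: "effective_tensor L Ls"
    and q: "\<And>x. q x * cnj (q x) = 1"
    and Lq: "\<And>x u. blinfun_apply (L x) u = X *v u + q x *s (Y *v cnj_vec u)"
    and comm: "\<And>u. blinfun_apply Ls (\<i> *s u) = \<i> *s blinfun_apply Ls u"
  shows "Ls = K M 0"
proof -
  define T where "T u = blinfun_apply Ls u - \<i> *s (P *v u)" for u
  have Lt: "Lt (q x) u = blinfun_apply (L x) u - \<i> *s (P *v u)" for x u
    by (simp add: Lt_def Lq)
  note ids = effective_tensor_identities[OF L Ls real_P real_A real_A', of "\<lambda>x. Lt (q x)" T,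
      OF Lt T_def]
  have "L x \<in> Sym_pos" for x
    using L by (auto simp: composite_def)
  then have "blinfun_apply (L x) u \<bullet> w = u \<bullet> blinfun_apply (L x) w" for x u w
    by (simp add: Sym_pos_def)
  then have sym: "T u \<bullet> w = u \<bullet> T w" for u w
    by (intro ids(1)) (simp add: Lt inner_diff_left inner_diff_right IP_herm)
  have nonneg: "0 \<le> T u \<bullet> u" for u
    by (intro ids(2) Lt_nonneg q)
  have dual: "T w \<bullet> (\<i> *s (A' *v T u)) = (\<i> *s (A *v u)) \<bullet> w" for u w
    by (intro ids(3) Lt_duality q)
  have T_I: "T (\<i> *s u) = \<i> *s T u" for u
    by (simp add: T_def comm vector_scalar_commute vector_ssub_ldistrib)
  have T_diff: "T (u - v) = T u - T v" for u v
    by (simp add: T_def blinfun.diff_right matrix_vector_mult_diff_distrib vector_ssub_ldistrib)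
  have TA'T: "T (A' *v T u) = A *v u" for u
  proof -
    have "(T (\<i> *s (A' *v T u)) - \<i> *s (A *v u)) \<bullet> w = 0" for w
      unfolding inner_diff_left
      using dual[of w u] sym[of w "\<i> *s (A' *v T u)"] inner_commute[of w "T (\<i> *s (A' *v T u))"]
      by linarith
    then have "T (\<i> *s (A' *v T u)) = \<i> *s (A *v u)"
      by (metis inner_eq_zero_iff right_minus_eq)
    then show ?thesis
      by (simp add: T_I vec_eq_iff)
  qed
  have "T u = A *v u" for u
  proof -
    \<comment> \<open>T w = T A^-1 T u - T u = A u - T u = - A w, so T \<ge> 0 and A > 0 are
      compatible only for w = 0.\<close>
    define w where "w = A' *v T u - u"
    have Aw: "A *v w = T u - A *v u"
      by (simp add: w_def matrix_vector_mult_diff_distrib matrix_vector_mul_assoc A'_inv)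
    have "T w = - (A *v w)"
      unfolding Aw by (simp add: w_def T_diff TA'T)
    then have "w \<bullet> (A *v w) \<le> 0"
      using nonneg[of w] by (simp add: inner_commute)
    then have "w = 0" using A_pos[of w] by force
    then show ?thesis using Aw by simp
  qed
  then have "blinfun_apply Ls u = M *v u" for u
    by (simp add: T_def M_decomp algebra_simps)
  then show ?thesis
    by (intro blinfun_eqI) (simp add: K_apply)
qed

end

section \<open>The fixed point equation\<close>

lemma bounded_hermitian_interval:
  fixes X :: "complex^2^2"
  shows "bounded {B. ctranspose B = B \<and> (\<forall>u. 0 \<le> u \<bullet> (B *v u)) \<and> (\<forall>u. u \<bullet> (B *v u) \<le> u \<bullet> (X *v u))}"
    (is "bounded ?H")
proof -
  obtain c where c: "\<And>u. norm (X *v u) \<le> norm u * c" "c > 0"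
    using bounded_linear.pos_bounded[OF matrix_vector_mul_bounded_linear[of X]] by blast
  \<comment> \<open>Real and imaginary parts of the entries are at most c, hence 2 c per entry, 4 c
    per row and 8 c for the matrix, estimating each norm by the sum over components.\<close>
  have "norm B \<le> 8 * c" if B: "B \<in> ?H" for B
  proof -
    have up: "u \<bullet> (B *v u) \<le> c * (norm u)\<^sup>2" for u
    proof -
      have "u \<bullet> (B *v u) \<le> u \<bullet> (X *v u)" using B by blast
      also have "\<dots> \<le> norm u * norm (X *v u)" by (rule norm_cauchy_schwarz)
      also have "\<dots> \<le> norm u * (norm u * c)" by (intro mult_left_mono c) simp
      finally show ?thesis by (simp add: power2_eq_square mult_ac)
    qed
    have lo: "0 \<le> u \<bullet> (B *v u)" for u using B by blast
    \<comment> \<open>u + v and u - v have norm at most 2, so both forms in the polarisation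
      identity lie between 0 and 4 c.\<close>
    have polar: "\<bar>u \<bullet> (B *v v)\<bar> \<le> c" if "norm u = 1" "norm v = 1" for u v
    proof -
      have "v \<bullet> (B *v u) = u \<bullet> (B *v v)"
        using inner_matrix_vector_mult[of B v u] B by (simp add: inner_commute)
      then have "4 * (u \<bullet> (B *v v)) = (u + v) \<bullet> (B *v (u + v)) - (u - v) \<bullet> (B *v (u - v))"
        by (simp add: matrix_vector_right_distrib matrix_vector_mult_diff_distrib
            inner_add_left inner_add_right inner_diff_left inner_diff_right)
      moreover have "(norm (u + v))\<^sup>2 \<le> 2\<^sup>2" "(norm (u - v))\<^sup>2 \<le> 2\<^sup>2"
        using norm_triangle_ineq[of u v] norm_triangle_ineq4[of u v] that
        by (intro power_mono; simp)+
      then have "c * (norm (u + v))\<^sup>2 \<le> 4 * c" "c * (norm (u - v))\<^sup>2 \<le> 4 * c"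
        using c(2) by (simp_all add: mult.commute)
      ultimately show ?thesis
        using up[of "u + v"] up[of "u - v"] lo[of "u + v"] lo[of "u - v"] by linarith
    qed
    have "(B *v axis j 1) $ i = B $ i $ j" for i j
      by (simp add: matrix_vector_mult_def axis_def if_distrib cong: if_cong)
    then have "Re (B $ i $ j) = axis i 1 \<bullet> (B *v axis j 1)" "Im (B $ i $ j) = axis i \<i> \<bullet> (B *v axis j 1)" for i j
      by (simp_all add: inner_axis' inner_complex_def)
    moreover have "norm (axis i 1 :: complex^2) = 1" "norm (axis i \<i> :: complex^2) = 1" for i
      by (simp_all add: norm_eq_sqrt_inner inner_axis_axis)
    ultimately have "\<bar>Re (B $ i $ j)\<bar> \<le> c" "\<bar>Im (B $ i $ j)\<bar> \<le> c" for i j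
      by (simp_all add: polar)
    then have ent: "norm (B $ i $ j) \<le> 2 * c" for i j
      using cmod_le[of "B $ i $ j"] by (smt (verit))
    have "norm (B $ i) \<le> 4 * c" for i
      unfolding norm_vec_def[of "B $ i"]
      by (rule order_trans[OF L2_set_le_sum]) (use ent[of i 1] ent[of i 2] in \<open>auto simp: sum_2\<close>)
    from this[of 1] this[of 2] show ?thesis
      unfolding norm_vec_def[of B]
      by (intro order_trans[OF L2_set_le_sum]) (auto simp: sum_2)
  qed
  then show ?thesis by (auto simp: bounded_iff)
qed

lemma continuous_on_matrix_vector_mult: "continuous_on UNIV (\<lambda>B :: complex^2^2. B *v u)"
  unfolding matrix_vector_mult_def by (intro continuous_intros)

lemma continuous_on_inv2:
  assumes "continuous_on H f" "\<And>x. x \<in> H \<Longrightarrow> det (f x) \<noteq> 0"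
  shows "continuous_on H (\<lambda>x. inv2 (f x))"
proof -
  have entries: "inv2 B $ 1 $ 1 = B $ 2 $ 2 / det B" "inv2 B $ 1 $ 2 = - B $ 1 $ 2 / det B"
    "inv2 B $ 2 $ 1 = - B $ 2 $ 1 / det B" "inv2 B $ 2 $ 2 = B $ 1 $ 1 / det B" for B
    by (simp_all add: inv2_def transpose_def cof_def)
  have "continuous_on H (\<lambda>x. det (f x))"
    unfolding det_2 by (intro continuous_intros assms(1))
  then have "continuous_on H (\<lambda>x. inv2 (f x) $ 1 $ 1)" "continuous_on H (\<lambda>x. inv2 (f x) $ 1 $ 2)"
    "continuous_on H (\<lambda>x. inv2 (f x) $ 2 $ 1)" "continuous_on H (\<lambda>x. inv2 (f x) $ 2 $ 2)"
    unfolding entries using assms(2) by (intro continuous_intros assms(1); blast)+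
  then have "continuous_on H (\<lambda>x. inv2 (f x) $ i $ j)" for i j
    using exhaust_2[of i] exhaust_2[of j] by auto
  then have "continuous_on H (\<lambda>x. \<chi> i j. inv2 (f x) $ i $ j)"
    by (intro continuous_on_vec_lambda)
  then show ?thesis by simp
qed

lemma continuous_on_matrix_matrix_mult:
  fixes f g :: "'a::topological_space \<Rightarrow> complex^2^2"
  assumes "continuous_on H f" "continuous_on H g"
  shows "continuous_on H (\<lambda>x. f x ** g x)"
  unfolding matrix_matrix_mult_def by (intro continuous_intros assms)

definition schur_map :: "complex^2^2 \<Rightarrow> complex^2^2 \<Rightarrow> complex^2^2 \<Rightarrow> complex^2^2" where
  "schur_map X Y M = X - Y ** inv2 (cnj_mat X + M) ** cnj_mat Y"

context
  fixes X Y :: "complex^2^2"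
  assumes K: "K X Y \<in> Sym_pos"
begin

lemma X_herm: "ctranspose X = X" and Y_sym: "transpose Y = Y"
  using K K_symmetric[of X Y] by (auto simp: Sym_pos_def)

lemma Y_ct: "ctranspose Y = cnj_mat Y"
  using Y_sym by (auto simp: vec_eq_iff ctranspose_def transpose_def)

lemma cnj_X_herm: "ctranspose (cnj_mat X) = cnj_mat X"
  using X_herm by (metis ctranspose_simps(6,7))

lemma shifted_pos:
  assumes "\<And>u. 0 \<le> u \<bullet> (M *v u)" "u \<noteq> 0"
  shows "0 < u \<bullet> ((cnj_mat X + M) *v u)"
  using block_form_pos[OF K, of 0 u] assms
  by (simp add: block_form_def matrix_vector_mult_add_rdistrib inner_add_right add_pos_nonneg)

lemma shifted_facts:
  assumes "ctranspose M = M" "\<And>u. 0 \<le> u \<bullet> (M *v u)"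
  shows "det (cnj_mat X + M) \<noteq> 0"
    "inv2 (cnj_mat X + M) ** (cnj_mat X + M) = mat 1"
    "(cnj_mat X + M) ** inv2 (cnj_mat X + M) = mat 1"
    "ctranspose (cnj_mat X + M) = cnj_mat X + M"
    "ctranspose (inv2 (cnj_mat X + M)) = inv2 (cnj_mat X + M)"
    "matrix_inv (cnj_mat X + M) = inv2 (cnj_mat X + M)"
proof -
  show d: "det (cnj_mat X + M) \<noteq> 0"
    by (rule det_nonzero_of_pos) (rule shifted_pos[OF assms(2)])
  show h: "ctranspose (cnj_mat X + M) = cnj_mat X + M"
    using cnj_X_herm assms(1) by simp
  show "ctranspose (inv2 (cnj_mat X + M)) = inv2 (cnj_mat X + M)"
    by (rule hermitian_inverse[OF h inv2_inverse[OF d]])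
qed (use inv2_inverse matrix_inv_inv2 det_nonzero_of_pos[OF shifted_pos[OF assms(2)]] in auto)

lemma schur_map_herm:
  assumes "ctranspose M = M" "\<And>u. 0 \<le> u \<bullet> (M *v u)"
  shows "ctranspose (schur_map X Y M) = schur_map X Y M"
  using shifted_facts(5)[OF assms] X_herm Y_ct Y_sym by (simp add: schur_map_def matrix_mul_assoc)

text \<open>\<open>schur_map X Y M\<close> is a Schur complement, so its form is a minimum over \<open>v\<close>, attained as in
  the second claim.\<close>

lemma schur_map_form_le:
  assumes M: "ctranspose M = M" "\<And>u. 0 \<le> u \<bullet> (M *v u)"
  shows "u \<bullet> (schur_map X Y M *v u) \<le> block_form X Y u v + v \<bullet> (M *v v)"
    and "v = - (inv2 (cnj_mat X + M) *v (cnj_mat Y *v u)) \<Longrightarrow>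
      u \<bullet> (schur_map X Y M *v u) = block_form X Y u v + v \<bullet> (M *v v)"
proof -
  define B where "B = cnj_mat X + M"
  define w where "w = inv2 B *v (cnj_mat Y *v u)"
  note f = shifted_facts[OF M, folded B_def]
  have Bw: "B *v w = cnj_mat Y *v u"
    by (simp add: w_def matrix_vector_mul_assoc f matrix_mul_assoc)
  have adj: "x \<bullet> (Y *v y) = (cnj_mat Y *v x) \<bullet> y" for x y
    using inner_matrix_vector_mult[of "cnj_mat Y" x y] Y_sym by simp
  have Bsym: "x \<bullet> (B *v y) = y \<bullet> (B *v x)" for x y
    using inner_matrix_vector_mult[of B x y] f(4) by (simp add: inner_commute)
  have 1: "u \<bullet> (schur_map X Y M *v u) = u \<bullet> (X *v u) - w \<bullet> (B *v w)"
  proof -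
    have "schur_map X Y M *v u = X *v u - Y *v w"
      by (simp add: schur_map_def B_def[symmetric] w_def matrix_vector_mult_diff_rdistrib
          matrix_vector_mul_assoc matrix_mul_assoc)
    then show ?thesis
      by (simp add: inner_diff_right adj Bw inner_commute)
  qed
  have 2: "block_form X Y u v + v \<bullet> (M *v v) = u \<bullet> (X *v u) + v \<bullet> (B *v v) + 2 * (v \<bullet> (B *v w))"
    by (simp add: block_form_def B_def matrix_vector_mult_add_rdistrib inner_add_right adj)
      (simp add: Bw[unfolded B_def matrix_vector_mult_add_rdistrib, symmetric] inner_commute inner_add_right)
  \<comment> \<open>Completing the square in v; the minimiser is v = - w.\<close>
  have 3: "block_form X Y u v + v \<bullet> (M *v v) = u \<bullet> (schur_map X Y M *v u) + (v + w) \<bullet> (B *v (v + w))"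
    unfolding 1 2 using Bsym[of v w]
    by (simp add: matrix_vector_right_distrib inner_add_left inner_add_right)
  have "0 \<le> (v + w) \<bullet> (B *v (v + w))"
    using shifted_pos[OF M(2), of "v + w"] by (cases "v + w = 0") (auto simp: B_def intro: less_imp_le)
  with 3 show "u \<bullet> (schur_map X Y M *v u) \<le> block_form X Y u v + v \<bullet> (M *v v)" by simp
  show "u \<bullet> (schur_map X Y M *v u) = block_form X Y u v + v \<bullet> (M *v v)"
    if "v = - (inv2 (cnj_mat X + M) *v (cnj_mat Y *v u))"
    using 3 that by (simp add: w_def B_def)
qed

text \<open>At the minimiser the form is a positive block form plus a nonnegative term. Since M may
  be merely semidefinite, positivity holds on the whole Brouwer set, its boundary included.\<close>

lemma schur_map_pos:
  assumes M: "ctranspose M = M" "\<And>u. 0 \<le> u \<bullet> (M *v u)" and u: "u \<noteq> 0"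
  shows "0 < u \<bullet> (schur_map X Y M *v u)"
  unfolding schur_map_form_le(2)[OF M refl]
  by (rule add_pos_nonneg[OF block_form_pos[OF K] M(2)]) (simp add: u)

lemma schur_map_le_X:
  assumes M: "ctranspose M = M" "\<And>u. 0 \<le> u \<bullet> (M *v u)"
  shows "u \<bullet> (schur_map X Y M *v u) \<le> u \<bullet> (X *v u)"
  using schur_map_form_le(1)[OF M, of u 0] by (simp add: block_form_def)

text \<open>Compactness forces semidefinite M into the domain, with 0 as witness that it is
  nonempty. Definiteness of the fixed point returns because \<open>schur_map\<close> sends even
  these to positive definite matrices.\<close>

lemma schur_map_fixed_point_exists: "\<exists>M. pos_def_hermitian M \<and> schur_map X Y M = M"
proof -
  let ?H = "{M. ctranspose M = M \<and> (\<forall>u. 0 \<le> u \<bullet> (M *v u)) \<and> (\<forall>u. u \<bullet> (M *v u) \<le> u \<bullet> (X *v u))}"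
  have cont: "continuous_on UNIV (\<lambda>M :: complex^2^2. u \<bullet> (M *v u))" for u
    by (intro continuous_intros continuous_on_matrix_vector_mult)
  have contt: "continuous_on UNIV ctranspose"
    unfolding ctranspose_def transpose_def map_matrix_def by (simp, intro continuous_intros)
  have "closed ({M. ctranspose M = M} \<inter> (\<Inter>u. {M. 0 \<le> u \<bullet> (M *v u)}) \<inter> (\<Inter>u. {M. u \<bullet> (M *v u) \<le> u \<bullet> (X *v u)}))"
    by (intro closed_Int closed_INT ballI closed_Collect_eq closed_Collect_le cont contt continuous_intros)
  moreover have "{M. ctranspose M = M} \<inter> (\<Inter>u. {M. 0 \<le> u \<bullet> (M *v u)}) \<inter> (\<Inter>u. {M. u \<bullet> (M *v u) \<le> u \<bullet> (X *v u)}) = ?H"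
    by auto
  ultimately have "compact ?H"
    using bounded_hermitian_interval[of X] by (simp add: compact_eq_bounded_closed)
  moreover have "convex ?H"
  proof (rule convexI)
    fix B C :: "complex^2^2" and s t :: real
    assume BC: "B \<in> ?H" "C \<in> ?H" and st: "0 \<le> s" "0 \<le> t" "s + t = 1"
    have "ctranspose (s *\<^sub>R B + t *\<^sub>R C) = s *\<^sub>R ctranspose B + t *\<^sub>R ctranspose C"
      by (simp add: ctranspose_def transpose_def vec_eq_iff)
    moreover have form: "u \<bullet> ((s *\<^sub>R B + t *\<^sub>R C) *v u) = s * (u \<bullet> (B *v u)) + t * (u \<bullet> (C *v u))" for u
      by (simp add: matrix_vector_mult_add_rdistrib inner_add_right scaleR_matrix_vector_mult)
    moreover have "s * (u \<bullet> (B *v u)) + t * (u \<bullet> (C *v u)) \<le> u \<bullet> (X *v u)" for u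
      using convex_bound_le[of "u \<bullet> (B *v u)" "u \<bullet> (X *v u)" "u \<bullet> (C *v u)" s t] BC st by simp
    ultimately show "s *\<^sub>R B + t *\<^sub>R C \<in> ?H"
      using BC st by simp
  qed
  moreover have "0 \<in> ?H"
  proof -
    have "0 \<le> u \<bullet> (X *v u)" for u
      using block_form_pos[OF K, of u 0] by (cases "u = 0") (auto simp: block_form_def)
    then show ?thesis by (simp add: ctranspose_def transpose_def vec_eq_iff)
  qed
  then have "?H \<noteq> {}" by blast
  moreover have "continuous_on ?H (schur_map X Y)"
    unfolding schur_map_def
    by (intro continuous_intros continuous_on_matrix_matrix_mult continuous_on_inv2)
      (use shifted_facts(1) in blast)
  moreover have "schur_map X Y \<in> ?H \<rightarrow> ?H"
    using schur_map_herm schur_map_le_X schur_map_pos by (auto, metis inner_zero_left less_imp_le order_refl)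
  ultimately obtain M where M: "M \<in> ?H" "schur_map X Y M = M"
    using brouwer by blast
  then have "pos_def_hermitian M"
    using schur_map_pos[of M] by (auto simp: pos_def_hermitian_iff)
  with M show ?thesis by blast
qed

text \<open>Let r be the largest ratio of the form \<open>d\<close> of M1 - M2 to the form
  \<open>e\<close> of M2, attained at x, and let v be the minimiser for M2 at x. The variational
  characterisation gives d x \<le> d v, and positivity of the block form gives e v < e x. For r > 0
  this leads to d x \<le> d v \<le> r e v < r e x = d x.\<close>

lemma schur_map_fixed_point_le:
  assumes M1: "pos_def_hermitian M1" "schur_map X Y M1 = M1" and M2: "pos_def_hermitian M2" "schur_map X Y M2 = M2"
  shows "u \<bullet> (M1 *v u) \<le> u \<bullet> (M2 *v u)"
proof -
  have h: "ctranspose M1 = M1" "ctranspose M2 = M2"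
    and p: "x \<noteq> 0 \<Longrightarrow> 0 < x \<bullet> (M1 *v x)" "x \<noteq> 0 \<Longrightarrow> 0 < x \<bullet> (M2 *v x)" for x
    using M1 M2 by (auto simp: pos_def_hermitian_iff)
  have n: "0 \<le> x \<bullet> (M1 *v x)" "0 \<le> x \<bullet> (M2 *v x)" for x
    using p[of x] by (cases "x = 0"; auto intro: less_imp_le)+
  define d where "d x = x \<bullet> (M1 *v x) - x \<bullet> (M2 *v x)" for x
  define e where "e x = x \<bullet> (M2 *v x)" for x
  have scale: "(c *\<^sub>R x) \<bullet> (B *v (c *\<^sub>R x)) = c\<^sup>2 * (x \<bullet> (B *v x))" for c x and B :: "complex^2^2"
    by (simp add: matrix_vector_mult_scaleR_right power2_eq_square)
  have "continuous_on (sphere 0 1) (\<lambda>x :: complex^2. d x / e x)"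
    unfolding d_def e_def
  proof (intro continuous_intros linear_continuous_on matrix_vector_mul_bounded_linear ballI)
    show "x \<bullet> (M2 *v x) \<noteq> 0" if "x \<in> sphere 0 1" for x
      using p(2)[of x] that by (cases "x = 0") auto
  qed
  moreover have "sphere 0 1 \<noteq> ({} :: (complex^2) set)" by simp
  ultimately obtain x where x: "norm x = 1" "\<And>y. norm y = 1 \<Longrightarrow> d y / e y \<le> d x / e x"
    using continuous_attains_sup[OF compact_sphere] by (metis (no_types, lifting) mem_sphere_0)
  define r where "r = d x / e x"
  have all: "d y \<le> r * e y" for y
  proof (cases "y = 0")
    case False
    define y' where "y' = (1 / norm y) *\<^sub>R y"
    have y: "y = norm y *\<^sub>R y'" "norm y' = 1" using False by (simp_all add: y'_def)
    have "y' \<noteq> 0" using y(2) by force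
    then have "d y' \<le> r * e y'"
      using x(2)[OF y(2)] p(2)[of y'] by (simp add: r_def e_def divide_le_eq)
    then have "(norm y)\<^sup>2 * d y' \<le> (norm y)\<^sup>2 * (r * e y')" by (rule mult_left_mono) simp
    moreover have "d y = (norm y)\<^sup>2 * d y'" "e y = (norm y)\<^sup>2 * e y'"
      unfolding d_def e_def right_diff_distrib scale[symmetric] y(1)[symmetric] by simp_all
    ultimately show ?thesis by (simp add: mult_ac)
  qed (simp add: d_def e_def)
  have "r \<le> 0"
  proof (rule ccontr)
    assume "\<not> r \<le> 0"
    then have r: "0 < r" by simp
    have x0: "x \<noteq> 0" using x(1) by force
    define v where "v = - (inv2 (cnj_mat X + M2) *v (cnj_mat Y *v x))"
    have "e x = block_form X Y x v + e v"
      using schur_map_form_le(2)[OF h(2) n(2) v_def] M2(2) by (simp add: e_def)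
    then have less: "e v < e x" using block_form_pos[OF K, of x v] x0 by simp
    have "d x \<le> d v"
      using schur_map_form_le(1)[OF h(1) n(1), of x v] schur_map_form_le(2)[OF h(2) n(2) v_def] M1(2) M2(2)
      by (simp add: d_def)
    also have "\<dots> \<le> r * e v" by (rule all)
    also have "\<dots> < r * e x" using less r by simp
    also have "\<dots> = d x" using p(2)[OF x0] by (simp add: r_def e_def)
    finally show False by simp
  qed
  then have "r * e u \<le> 0" using n(2)[of u] by (simp add: e_def mult_nonpos_nonneg)
  then show ?thesis using all[of u] by (simp add: d_def)
qed

lemma schur_map_fixed_point_unique:
  assumes "pos_def_hermitian M1" "schur_map X Y M1 = M1" "pos_def_hermitian M2" "schur_map X Y M2 = M2"
  shows "M1 = M2"
proof -
  have "M1 - M2 = 0"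
  proof (rule hermitian_eq_0)
    show "ctranspose (M1 - M2) = M1 - M2"
      using assms by (simp add: pos_def_hermitian_iff)
    show "u \<bullet> ((M1 - M2) *v u) = 0" for u
      using schur_map_fixed_point_le[OF assms, of u] schur_map_fixed_point_le[OF assms(3,4,1,2), of u]
      by (simp add: matrix_vector_mult_diff_rdistrib inner_diff_right)
  qed
  then show ?thesis by simp
qed

end

section \<open>The parameter \<open>\<theta>\<close>\<close>

lemma abs_double_le_add:
  fixes p q t :: real
  assumes "0 \<le> p" "0 \<le> q" "t\<^sup>2 \<le> p * q"
  shows "2 * \<bar>t\<bar> \<le> p + q"
proof (rule power2_le_imp_le)
  have "(2 * \<bar>t\<bar>)\<^sup>2 \<le> 4 * (p * q)"
    using assms(3) by (simp add: power_mult_distrib)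
  also have "\<dots> \<le> (p + q)\<^sup>2"
    using zero_le_power2[of "p - q"] by (simp add: power2_eq_square algebra_simps)
  finally show "(2 * \<bar>t\<bar>)\<^sup>2 \<le> (p + q)\<^sup>2" .
qed (use assms in simp)

section \<open>Hermitian 2 by 2 matrices in terms of their entries\<close>

lemma hermitian_entries:
  assumes "ctranspose B = B"
  shows "B $ 1 $ 1 = of_real (Re (B $ 1 $ 1))" "B $ 2 $ 2 = of_real (Re (B $ 2 $ 2))"
    "B $ 2 $ 1 = cnj (B $ 1 $ 2)"
proof -
  have e: "cnj (B $ j $ i) = B $ i $ j" for i j
    using assms by (auto simp: ctranspose_def transpose_def vec_eq_iff)
  show "B $ 1 $ 1 = of_real (Re (B $ 1 $ 1))" "B $ 2 $ 2 = of_real (Re (B $ 2 $ 2))"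
    using e[of 1 1] e[of 2 2] by (simp_all add: complex_eq_iff)
  show "B $ 2 $ 1 = cnj (B $ 1 $ 2)" using e[of 1 2] by simp
qed

lemma hermitian_det:
  assumes "ctranspose B = B"
  shows "det B = of_real (Re (B $ 1 $ 1) * Re (B $ 2 $ 2) - (norm (B $ 1 $ 2))\<^sup>2)"
proof -
  have "det B = B $ 1 $ 1 * B $ 2 $ 2 - B $ 1 $ 2 * cnj (B $ 1 $ 2)"
    using hermitian_entries(3)[OF assms] by (simp add: det_2)
  also have "\<dots> = of_real (Re (B $ 1 $ 1)) * of_real (Re (B $ 2 $ 2)) - of_real ((norm (B $ 1 $ 2))\<^sup>2)"
    unfolding complex_norm_square using hermitian_entries(1,2)[OF assms] by simp
  finally show ?thesis by simp
qed

lemma hermitian_form: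
  assumes "ctranspose B = B"
  shows "u \<bullet> (B *v u) = Re (B $ 1 $ 1) * (norm (u $ 1))\<^sup>2 + Re (B $ 2 $ 2) * (norm (u $ 2))\<^sup>2
    + 2 * Re (cnj (u $ 1) * B $ 1 $ 2 * u $ 2)"
proof -
  have "(B *v u) $ 1 = of_real (Re (B $ 1 $ 1)) * u $ 1 + B $ 1 $ 2 * u $ 2"
    "(B *v u) $ 2 = cnj (B $ 1 $ 2) * u $ 1 + of_real (Re (B $ 2 $ 2)) * u $ 2"
    using hermitian_entries[OF assms] by (simp_all add: matrix_vector_mult_def sum_2)
  then show ?thesis
    by (simp add: inner_vec_def sum_2 inner_complex_def cmod_power2)
      (simp add: power2_eq_square algebra_simps)
qed

lemma nonneg_form_of_entries:
  assumes h: "ctranspose B = B" and e: "0 \<le> Re (B $ 1 $ 1)" "0 \<le> Re (B $ 2 $ 2)"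
    "(norm (B $ 1 $ 2))\<^sup>2 \<le> Re (B $ 1 $ 1) * Re (B $ 2 $ 2)"
  shows "0 \<le> u \<bullet> (B *v u)"
proof -
  let ?z = "cnj (u $ 1) * B $ 1 $ 2 * u $ 2"
  have "(norm ?z)\<^sup>2 = ((norm (u $ 1))\<^sup>2 * (norm (u $ 2))\<^sup>2) * (norm (B $ 1 $ 2))\<^sup>2"
    by (simp add: norm_mult power_mult_distrib)
  also have "\<dots> \<le> ((norm (u $ 1))\<^sup>2 * (norm (u $ 2))\<^sup>2) * (Re (B $ 1 $ 1) * Re (B $ 2 $ 2))"
    using e(3) by (rule mult_left_mono) simp
  finally have "2 * \<bar>norm ?z\<bar> \<le> Re (B $ 1 $ 1) * (norm (u $ 1))\<^sup>2 + Re (B $ 2 $ 2) * (norm (u $ 2))\<^sup>2"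
    using e by (intro abs_double_le_add) (simp_all add: mult_ac)
  moreover have "- norm ?z \<le> Re ?z"
    using abs_Re_le_cmod[of ?z] by linarith
  ultimately show ?thesis
    unfolding hermitian_form[OF h] by simp
qed

lemma pos_form_entries:
  assumes h: "ctranspose B = B" and pos: "\<And>u. u \<noteq> 0 \<Longrightarrow> 0 < u \<bullet> (B *v u)"
  shows "0 < Re (B $ 1 $ 1)" "0 < Re (B $ 2 $ 2)" "(norm (B $ 1 $ 2))\<^sup>2 < Re (B $ 1 $ 1) * Re (B $ 2 $ 2)"
proof -
  show a: "0 < Re (B $ 1 $ 1)" "0 < Re (B $ 2 $ 2)"
    using pos[of "vector [1, 0]"] pos[of "vector [0, 1]"]
    by (simp_all add: hermitian_form[OF h] vec_eq_iff forall_2)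
  \<comment> \<open>Annihilated by the first row of \<open>B\<close>, so that the form at this
    vector is the first diagonal entry times the determinant.\<close>
  let ?u = "vector [- B $ 1 $ 2, of_real (Re (B $ 1 $ 1))] :: complex^2"
  have "?u \<noteq> 0" using a(1) by (auto simp: vec_eq_iff forall_2)
  then have "0 < ?u \<bullet> (B *v ?u)" by (rule pos)
  also have "\<dots> = Re (B $ 1 $ 1) * (Re (B $ 1 $ 1) * Re (B $ 2 $ 2) - (norm (B $ 1 $ 2))\<^sup>2)"
    unfolding hermitian_form[OF h]
    by (simp add: cmod_power2) (simp add: power2_eq_square algebra_simps)
  finally show "(norm (B $ 1 $ 2))\<^sup>2 < Re (B $ 1 $ 1) * Re (B $ 2 $ 2)"
    using a(1) by (simp add: zero_less_mult_iff)
qed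

text \<open>The definite case for B + \<epsilon> I, in the limit \<epsilon> -> 0.\<close>

lemma nonneg_form_entries:
  assumes h: "ctranspose B = B" and nn: "\<And>u. 0 \<le> u \<bullet> (B *v u)"
  shows "0 \<le> Re (B $ 1 $ 1)" "0 \<le> Re (B $ 2 $ 2)" "(norm (B $ 1 $ 2))\<^sup>2 \<le> Re (B $ 1 $ 1) * Re (B $ 2 $ 2)"
proof -
  let ?a = "Re (B $ 1 $ 1)" and ?d = "Re (B $ 2 $ 2)" and ?b = "B $ 1 $ 2"
  show a: "0 \<le> ?a" and d: "0 \<le> ?d"
    using nn[of "vector [1, 0]"] nn[of "vector [0, 1]"]
    by (simp_all add: hermitian_form[OF h])
  have "(norm ?b)\<^sup>2 \<le> (?a + \<epsilon>) * (?d + \<epsilon>)" if \<epsilon>: "\<epsilon> > 0" for \<epsilon>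
  proof -
    let ?B = "B + \<epsilon> *\<^sub>R mat 1"
    have "ctranspose ?B = ?B"
      using h by (simp add: ctranspose_def transpose_def vec_eq_iff mat_def)
    moreover have "0 < u \<bullet> (?B *v u)" if "u \<noteq> 0" for u
      using nn[of u] \<epsilon> that
      by (simp add: matrix_vector_mult_add_rdistrib scaleR_matrix_vector_mult inner_add_right
          add_nonneg_pos)
    ultimately have "(norm (?B $ 1 $ 2))\<^sup>2 < Re (?B $ 1 $ 1) * Re (?B $ 2 $ 2)"
      by (rule pos_form_entries(3))
    then show ?thesis by (simp add: mat_def)
  qed
  then have "eventually (\<lambda>\<epsilon>. (norm ?b)\<^sup>2 \<le> (?a + \<epsilon>) * (?d + \<epsilon>)) (at_right 0)"
    unfolding eventually_at_right_field by (intro exI[of _ 1]) auto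
  moreover have "((\<lambda>\<epsilon>. (?a + \<epsilon>) * (?d + \<epsilon>)) \<longlongrightarrow> (?a + 0) * (?d + 0)) (at_right 0)"
    by (intro tendsto_intros)
  ultimately show "(norm ?b)\<^sup>2 \<le> ?a * ?d"
    using tendsto_lowerbound[of _ _ "at_right (0::real)"] by simp
qed

text \<open>The determinant of the sum is det P + det R plus a mixed term. The mixed term is
  nonnegative by the arithmetic-geometric mean inequality, and det R > 0 makes the inequality
  strict.\<close>

lemma det_less_det_add:
  assumes P: "ctranspose P = P" "\<And>u. 0 \<le> u \<bullet> (P *v u)"
    and R: "ctranspose R = R" "\<And>u. u \<noteq> 0 \<Longrightarrow> 0 < u \<bullet> (R *v u)"
  shows "Re (det P) < Re (det (P + R))"
proof -
  note p = nonneg_form_entries[OF P] and r = pos_form_entries[OF R]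
  have h: "ctranspose (P + R) = P + R" using P R by simp
  let ?z = "P $ 1 $ 2 * cnj (R $ 1 $ 2)"
  have "(norm ?z)\<^sup>2 = (norm (P $ 1 $ 2))\<^sup>2 * (norm (R $ 1 $ 2))\<^sup>2"
    by (simp add: norm_mult power_mult_distrib)
  also have "\<dots> \<le> (Re (P $ 1 $ 1) * Re (P $ 2 $ 2)) * (Re (R $ 1 $ 1) * Re (R $ 2 $ 2))"
    using p r by (intro mult_mono) auto
  finally have "2 * \<bar>norm ?z\<bar> \<le> Re (P $ 1 $ 1) * Re (R $ 2 $ 2) + Re (P $ 2 $ 2) * Re (R $ 1 $ 1)"
    using p r by (intro abs_double_le_add) (simp_all add: mult_ac)
  then have "2 * Re ?z \<le> Re (P $ 1 $ 1) * Re (R $ 2 $ 2) + Re (P $ 2 $ 2) * Re (R $ 1 $ 1)"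
    using complex_Re_le_cmod[of ?z] by linarith
  moreover have "(norm (P $ 1 $ 2 + R $ 1 $ 2))\<^sup>2
      = (norm (P $ 1 $ 2))\<^sup>2 + (norm (R $ 1 $ 2))\<^sup>2 + 2 * Re ?z"
    by (simp add: cmod_power2) (simp add: power2_eq_square algebra_simps)
  ultimately show ?thesis
    using r(3) unfolding hermitian_det[OF h] hermitian_det[OF P(1)]
    by (simp add: algebra_simps)
qed

section \<open>Invertibility of the operator I + \<theta> B_Y\<close>

lemma linear_I_plus_BY: "linear (I_plus_BY \<theta> Y)"
  by (rule linearI)
    (auto simp: vec_eq_iff forall_2 I_plus_BY_def BY_def cof_def transpose_def ctranspose_def
      matrix_matrix_mult_def sum_2 scaleR_conv_of_real[where 'a=complex] algebra_simps)

lemma det_cof: "det (cof Z) = det Z"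
  by (simp add: det_2 cof_def)

lemma ctranspose_cof: "ctranspose (transpose (cof Z)) = transpose (cof (ctranspose Z))"
  by (simp add: vec_eq_iff forall_2 ctranspose_def transpose_def cof_def)

lemma ctranspose_scaleR: "ctranspose (r *\<^sub>R Z) = r *\<^sub>R ctranspose Z"
  by (simp add: ctranspose_def transpose_def vec_eq_iff)

lemma ctranspose_BY: "ctranspose (BY Y Z) = BY Y (ctranspose Z)"
  by (simp add: BY_def ctranspose_cof matrix_mul_assoc)

lemma ctranspose_I_plus_BY: "ctranspose (I_plus_BY \<theta> Y Z) = I_plus_BY \<theta> Y (ctranspose Z)"
  by (simp add: I_plus_BY_def ctranspose_BY ctranspose_scaleR)

text \<open>The cofactor of a 2 by 2 matrix is linear in its entries, so the operator is complex
  linear on all matrices; this lets kernel elements be split into Hermitian and anti-Hermitian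
  parts.\<close>

lemma I_plus_BY_scale: "I_plus_BY \<theta> Y (map_matrix ((*) c) Z) = map_matrix ((*) c) (I_plus_BY \<theta> Y Z)"
  by (auto simp: vec_eq_iff forall_2 I_plus_BY_def BY_def cof_def transpose_def ctranspose_def
      matrix_matrix_mult_def sum_2 scaleR_conv_of_real[where 'a=complex] algebra_simps)

text \<open>Taking determinants in Z = - \<theta> B_Y Z gives det Z = (\<theta> |det Y|)^2 det Z, so
  Z is singular and therefore semidefinite up to sign. But B_Y preserves semidefiniteness, so Z
  \<ge> 0 entails Z = - \<theta> B_Y Z \<le> 0.\<close>

lemma I_plus_BY_kernel_hermitian:
  assumes \<theta>: "0 < \<theta>" "\<theta> * norm (det Y) < 1" and Z: "ctranspose Z = Z" "I_plus_BY \<theta> Y Z = 0"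
  shows "Z = 0"
proof -
  have "det Z = 0"
  proof -
    have "Z = (- \<theta>) *\<^sub>R BY Y Z"
      using Z(2) by (simp add: I_plus_BY_def eq_neg_iff_add_eq_0)
    then have "det Z = det ((- \<theta>) *\<^sub>R BY Y Z)" by (rule arg_cong)
    also have "\<dots> = of_real (\<theta>\<^sup>2) * det (BY Y Z)"
      by (simp add: det_2 scaleR_conv_of_real[where 'a=complex] power2_eq_square algebra_simps)
    also have "det (BY Y Z) = det Y * det Z * det (ctranspose Y)"
      by (simp add: BY_def det_mul det_cof)
    also have "det (ctranspose Y) = cnj (det Y)"
      by (simp add: det_2 ctranspose_def transpose_def)
    finally have "det Z = of_real ((\<theta> * norm (det Y))\<^sup>2) * det Z"
      by (simp only: power_mult_distrib of_real_mult complex_norm_square mult_ac)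
    moreover have "(\<theta> * norm (det Y))\<^sup>2 < 1"
      using \<theta> by (simp add: abs_square_less_1)
    then have "complex_of_real ((\<theta> * norm (det Y))\<^sup>2) \<noteq> 1"
      unfolding of_real_eq_1_iff by simp
    ultimately show ?thesis by simp
  qed
  have semidef: "W = 0" if W: "ctranspose W = W" "I_plus_BY \<theta> Y W = 0" "det W = 0"
    "0 \<le> Re (W $ 1 $ 1)" "0 \<le> Re (W $ 2 $ 2)" for W
  proof (rule hermitian_eq_0[OF W(1)])
    let ?C = "transpose (cof W)"
    have n: "(norm (W $ 1 $ 2))\<^sup>2 = Re (W $ 1 $ 1) * Re (W $ 2 $ 2)"
      using W(3) unfolding hermitian_det[OF W(1)] of_real_eq_0_iff by simp
    have nn: "0 \<le> u \<bullet> (W *v u)" for u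
      by (rule nonneg_form_of_entries[OF W(1)]) (use W n in auto)
    have C: "0 \<le> x \<bullet> (?C *v x)" for x
    proof (rule nonneg_form_of_entries)
      show "ctranspose ?C = ?C" by (simp add: ctranspose_cof W)
    qed (use W n in \<open>auto simp: transpose_def cof_def mult.commute\<close>)
    have neg: "u \<bullet> (W *v u) = - \<theta> * ((ctranspose Y *v u) \<bullet> (?C *v (ctranspose Y *v u)))" for u
    proof -
      have "W = (- \<theta>) *\<^sub>R BY Y W"
        using W(2) by (simp add: I_plus_BY_def eq_neg_iff_add_eq_0)
      then have "W *v u = ((- \<theta>) *\<^sub>R BY Y W) *v u"
        by (rule arg_cong)
      then have "W *v u = (- \<theta>) *\<^sub>R (BY Y W *v u)"
        by (simp only: scaleR_matrix_vector_mult)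
      moreover have "u \<bullet> (BY Y W *v u) = (ctranspose Y *v u) \<bullet> (?C *v (ctranspose Y *v u))"
        by (simp add: BY_def inner_matrix_vector_mult matrix_vector_mul_assoc matrix_mul_assoc)
      ultimately show ?thesis by simp
    qed
    show "u \<bullet> (W *v u) = 0" for u
    proof (rule antisym[OF _ nn])
      show "u \<bullet> (W *v u) \<le> 0"
        unfolding neg using \<theta>(1) C by (simp add: mult_nonneg_nonneg)
    qed
  qed
  \<comment> \<open>The diagonal entries of a singular Hermitian matrix do not have opposite signs,
    so \<open>semidef\<close> applies to Z or to - Z.\<close>
  have prod: "0 \<le> Re (Z $ 1 $ 1) * Re (Z $ 2 $ 2)"
    using \<open>det Z = 0\<close> zero_le_power2[of "norm (Z $ 1 $ 2)"]
    unfolding hermitian_det[OF Z(1)] of_real_eq_0_iff by simp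
  then consider "0 \<le> Re (Z $ 1 $ 1)" "0 \<le> Re (Z $ 2 $ 2)" | "Re (Z $ 1 $ 1) \<le> 0" "Re (Z $ 2 $ 2) \<le> 0"
    by (auto simp: zero_le_mult_iff)
  then show ?thesis
  proof cases
    case 1
    then show ?thesis using semidef Z \<open>det Z = 0\<close> by blast
  next
    case 2
    have "- Z = 0"
    proof (rule semidef)
      show "ctranspose (- Z) = - Z"
        using ctranspose_scaleR[of "-1" Z] Z by simp
      show "I_plus_BY \<theta> Y (- Z) = 0"
        using linear_neg[OF linear_I_plus_BY, of \<theta> Y Z] Z by simp
      show "det (- Z) = 0" using \<open>det Z = 0\<close> by (simp add: det_2)
    qed (use 2 in auto)
    then show ?thesis by simp
  qed
qed

text \<open>Surjectivity follows from injectivity on the finite-dimensional space of all matrices,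
  and commutation with \<open>ctranspose\<close> restricts it to Hermitian ones. The kernel is
  trivial because Z + Z^H and \<i> (Z - Z^H) are Hermitian kernel elements.\<close>

lemma I_plus_BY_bij:
  assumes \<theta>: "0 < \<theta>" "\<theta> * norm (det Y) < 1"
  shows "bij_betw (I_plus_BY \<theta> Y) hermitian_mats hermitian_mats"
proof -
  let ?f = "I_plus_BY \<theta> Y"
  note lin = linear_I_plus_BY[of \<theta> Y]
  have "Z = 0" if Z: "?f Z = 0" for Z
  proof -
    have Z': "?f (ctranspose Z) = 0"
      using arg_cong[OF Z, of ctranspose] ctranspose_scaleR[of 0 0] by (simp add: ctranspose_I_plus_BY)
    have "Z + ctranspose Z = 0"
      by (rule I_plus_BY_kernel_hermitian[OF \<theta>]) (simp_all add: add.commute linear_add[OF lin] Z Z')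
    moreover have "map_matrix ((*) \<i>) (Z - ctranspose Z) = 0"
    proof (rule I_plus_BY_kernel_hermitian[OF \<theta>])
      show "ctranspose (map_matrix ((*) \<i>) (Z - ctranspose Z)) = map_matrix ((*) \<i>) (Z - ctranspose Z)"
        by (simp add: ctranspose_def transpose_def vec_eq_iff algebra_simps)
      show "?f (map_matrix ((*) \<i>) (Z - ctranspose Z)) = 0"
        unfolding I_plus_BY_scale linear_diff[OF lin] Z Z' by (simp add: vec_eq_iff)
    qed
    then have "Z - ctranspose Z = 0"
      by (simp add: vec_eq_iff)
    moreover have "Z + Z = (Z + ctranspose Z) + (Z - ctranspose Z)" by simp
    ultimately have "Z + Z = 0" by simp
    then show ?thesis by (simp add: vec_eq_iff)
  qed
  then have inj: "inj ?f"
    unfolding linear_injective_0[OF lin] by blast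
  then have surj: "surj ?f"
    by (rule linear_inj_imp_surj[OF lin])
  have "?f ` hermitian_mats = hermitian_mats"
  proof (intro equalityI subsetI)
    fix W assume "W \<in> hermitian_mats"
    moreover obtain Z where Z: "W = ?f Z" using surj by blast
    ultimately have "?f (ctranspose Z) = ?f Z"
      by (simp add: hermitian_mats_def ctranspose_I_plus_BY)
    then show "W \<in> ?f ` hermitian_mats"
      using injD[OF inj] Z by (force simp: hermitian_mats_def)
  qed (auto simp: hermitian_mats_def ctranspose_I_plus_BY)
  then show ?thesis
    using inj by (simp add: bij_betw_def inj_on_subset[OF _ subset_UNIV])
qed

text \<open>The root condition says \<theta> = 1 / det B, so \<theta> times the adjugate is the
  inverse: this is the passage between the linear equation with \<theta> and the fixed point
  equation.\<close>

lemma I_plus_BY_inv2: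
  assumes "of_real \<theta> * det B = 1"
  shows "I_plus_BY \<theta> Y B = B + Y ** inv2 B ** ctranspose Y"
proof -
  have "det B \<noteq> 0"
    using assms by auto
  then have d: "of_real \<theta> = 1 / det B"
    using assms by (rule eq_divide_imp)
  have "\<theta> *\<^sub>R transpose (cof B) = inv2 B"
    unfolding inv2_def using d by (simp add: vec_eq_iff scaleR_conv_of_real[where 'a=complex])
  moreover have "\<theta> *\<^sub>R BY Y B = Y ** (\<theta> *\<^sub>R transpose (cof B)) ** ctranspose Y"
    by (simp add: BY_def vec_eq_iff matrix_matrix_mult_def sum_2 scaleR_conv_of_real[where 'a=complex] algebra_simps)
  ultimately show ?thesis by (simp add: I_plus_BY_def)
qed

section \<open>Rotations, isotropy and polycrystals\<close>

lemma rotation_matrix_2_eq_rot: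
  assumes "rotation_matrix R"
  shows "\<exists>\<phi>. R = rot \<phi>"
proof -
  let ?a = "R $ 1 $ 1" and ?b = "R $ 1 $ 2" and ?c = "R $ 2 $ 1" and ?d = "R $ 2 $ 2"
  have "transpose R ** R = mat 1" "det R = 1"
    using assms by (auto simp: rotation_matrix_def orthogonal_matrix_def)
  then have 1: "?a * ?a + ?c * ?c = 1" "?b * ?b + ?d * ?d = 1" "?a * ?d - ?b * ?c = 1"
    by (auto simp: vec_eq_iff forall_2 matrix_matrix_mult_def transpose_def sum_2 mat_def det_2)
  \<comment> \<open>Unit columns and determinant 1 make this 1 + 1 - 2 = 0, which forces the shape
    of \<open>rot\<close>.\<close>
  have "(?a - ?d)\<^sup>2 + (?b + ?c)\<^sup>2
      = (?a * ?a + ?c * ?c) + (?b * ?b + ?d * ?d) - 2 * (?a * ?d - ?b * ?c)"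
    by (simp add: power2_eq_square algebra_simps)
  then have "(?a - ?d)\<^sup>2 + (?b + ?c)\<^sup>2 = 0"
    using 1 by simp
  then have 2: "?d = ?a" "?b = - ?c"
    by (auto simp: sum_power2_eq_zero_iff)
  have "?a\<^sup>2 + ?c\<^sup>2 = 1" using 1(1) by (simp add: power2_eq_square)
  then obtain \<phi> where "?a = cos \<phi>" "?c = sin \<phi>"
    using sincos_total_2pi by metis
  then show ?thesis
    using 2 by (intro exI[of _ \<phi>]) (simp add: rot_def vec_eq_iff forall_2)
qed

lemma rotation_matrix_rot: "rotation_matrix (rot \<phi>)"
proof -
  have "transpose (rot \<phi>) ** rot \<phi> = mat 1" "rot \<phi> ** transpose (rot \<phi>) = mat 1"
    by (auto simp: vec_eq_iff forall_2 matrix_matrix_mult_def transpose_def sum_2 mat_def rot_def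
        power2_eq_square[symmetric])
  moreover have "det (rot \<phi>) = 1"
    by (simp add: det_2 rot_def power2_eq_square[symmetric])
  ultimately show ?thesis
    by (simp add: rotation_matrix_def orthogonal_matrix_def)
qed

text \<open>The quarter turn acts as multiplication by \<i>, so invariance under it is commutation
  with \<i>.\<close>

lemma isotropic_commutes_I:
  assumes "isotropic L"
  shows "blinfun_apply L (\<i> *s u) = \<i> *s blinfun_apply L u"
proof -
  have "rot_act (rot (pi / 2)) L = L"
    using assms rotation_matrix_rot by (auto simp: isotropic_def)
  then have "blinfun_apply (rot_act (rot (pi / 2)) L) (\<i> *s u) = blinfun_apply L (\<i> *s u)"
    by simp
  then have "cis (pi / 2) *s blinfun_apply L (cis (- (pi / 2)) *s (\<i> *s u)) = blinfun_apply L (\<i> *s u)"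
    by (simp only: planar_act_rot planar_act_rot_transpose rot_act_apply)
  moreover have "cis (pi / 2) = \<i>" "cis (- (pi / 2)) = - \<i>"
    by (simp_all add: complex_eq_iff)
  ultimately show ?thesis
    by (simp add: vector_smult_assoc)
qed

text \<open>The antilinear part is turned at its input and at its output, hence the doubled angle in
  q. The angle is chosen separately at each point.\<close>

lemma polycrystal_apply:
  assumes "polycrystal (K X Y) L"
  obtains q where "\<And>x. q x * cnj (q x) = 1"
    "\<And>x u. blinfun_apply (L x) u = X *v u + q x *s (Y *v cnj_vec u)"
proof -
  have "\<exists>\<phi>. L x = rot_act (rot \<phi>) (K X Y)" for x
    using assms rotation_matrix_2_eq_rot unfolding polycrystal_def by metis
  then obtain \<phi> where \<phi>: "\<And>x. L x = rot_act (rot (\<phi> x)) (K X Y)" by metis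
  have "map_matrix ((*) c) Y *v w = c *s (Y *v w)" for c w
    by (simp add: vec_eq_iff matrix_vector_mult_def sum_distrib_left mult.assoc)
  then show thesis
    by (intro that[of "\<lambda>x. cis (2 * \<phi> x)"])
      (simp_all add: \<phi> rot_act_K K_apply cis_cnj cis_mult)
qed

section \<open>Texture independence and the admissible roots\<close>

theorem mainTheorem6:
  fixes X Y :: "complex^2^2"
  assumes "K X Y \<in> Sym_pos"
  shows "\<exists>Lm :: complex^2^2.
      (\<forall>L Ls. isotropic_polycrystal (K X Y) L Ls \<longrightarrow> Ls = K Lm 0) \<and>
      pos_def_hermitian Lm \<and>
      X - Lm = Y ** matrix_inv (cnj_mat X + Lm) ** cnj_mat Y \<and>
      (\<exists>\<theta>. admissible_theta X Y \<theta>) \<and>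
      (\<forall>\<theta>. admissible_theta X Y \<theta> \<longrightarrow> Lm = theta_matrix X Y \<theta> - cnj_mat X)"
proof -
  note K = assms
  obtain M where M: "pos_def_hermitian M" "schur_map X Y M = M"
    using schur_map_fixed_point_exists[OF K] by blast
  have M_herm: "ctranspose M = M" and M_pos: "u \<noteq> 0 \<Longrightarrow> 0 < u \<bullet> (M *v u)" for u
    using M(1) by (auto simp: pos_def_hermitian_iff)
  have M_nn: "0 \<le> u \<bullet> (M *v u)" for u
    using M_pos[of u] by (cases "u = 0") auto
  define S where "S = cnj_mat X + M"
  note S = shifted_facts[OF K M_herm M_nn, folded S_def]
  have shifted_pos': "u \<noteq> 0 \<Longrightarrow> 0 < u \<bullet> (S *v u)" for u
    unfolding S_def by (rule shifted_pos[OF K M_nn])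
  have fixed: "X - M = Y ** inv2 S ** cnj_mat Y"
    using M(2) by (simp add: schur_map_def S_def algebra_simps)
  interpret sol: fixed_point_matrix X Y M "inv2 S"
  proof
    show "0 \<le> u \<bullet> ((cnj_mat X + M) *v u)" for u
      using shifted_pos'[of u] by (cases "u = 0") (auto simp: S_def)
  qed (use X_herm[OF K] Y_sym[OF K] M(1) S fixed in \<open>auto simp: S_def\<close>)
  have eff: "Ls = K M 0" if "isotropic_polycrystal (K X Y) L Ls" for L Ls
  proof -
    have p: "polycrystal (K X Y) L" "composite L" "effective_tensor L Ls" "isotropic Ls"
      using that by (auto simp: isotropic_polycrystal_def polycrystal_def)
    obtain q where "\<And>x. q x * cnj (q x) = 1"
      "\<And>x u. blinfun_apply (L x) u = X *v u + q x *s (Y *v cnj_vec u)"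
      using polycrystal_apply[OF p(1)] by blast
    then show ?thesis
      using sol.effective_tensor_eq[OF p(2,3)] isotropic_commutes_I[OF p(4)] by blast
  qed
  define r where "r = Re (S $ 1 $ 1) * Re (S $ 2 $ 2) - (norm (S $ 1 $ 2))\<^sup>2"
  have detS: "det S = of_real r" and r: "0 < r"
    using hermitian_det[OF S(4)] pos_form_entries(3)[OF S(4) shifted_pos'] by (auto simp: r_def)
  define \<theta> where "\<theta> = 1 / r"
  have \<theta>: "0 < \<theta>" "of_real \<theta> * det S = 1"
    using r by (simp_all add: \<theta>_def detS)
  have IS: "I_plus_BY \<theta> Y S = X + cnj_mat X"
    unfolding I_plus_BY_inv2[OF \<theta>(2)] using fixed by (simp add: Y_ct[OF K] S_def algebra_simps)
  \<comment> \<open>Equivalent to |det Y| < det S. Since cnj S is X - M \<ge> 0 plus M + cnj M > 0,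
    the determinant of X - M, which the fixed point equation evaluates to |det Y|^2 / det S, is less
    than det (cnj S) = det S.\<close>
  have "\<theta> * norm (det Y) < 1"
  proof -
    have sum: "X - M + (M + cnj_mat M) = cnj_mat S"
      by (simp add: S_def)
    have "transpose M = cnj_mat M"
      using M_herm ctranspose_simps(7)[of M] by simp
    then have h: "ctranspose (M + cnj_mat M) = M + cnj_mat M"
      by (simp add: M_herm)
    have pos: "0 < u \<bullet> ((M + cnj_mat M) *v u)" if "u \<noteq> 0" for u
    proof -
      have "cnj_vec u \<noteq> 0" using that by (simp add: cnj_vec_def vec_eq_iff)
      then have "0 < u \<bullet> (M *v u) + cnj_vec u \<bullet> (M *v cnj_vec u)"
        using that by (intro add_pos_pos M_pos)
      then show ?thesis
        by (simp add: matrix_vector_mult_add_rdistrib inner_add_right inner_cnj_vec_left)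
    qed
    have nonneg: "0 \<le> u \<bullet> ((X - M) *v u)" for u
      using schur_map_le_X[OF K M_herm M_nn, of u] M(2)
      by (simp add: matrix_vector_mult_diff_rdistrib inner_diff_right)
    have "ctranspose (X - M) = X - M"
      by (simp add: M_herm X_herm[OF K])
    then have "Re (det (X - M)) < Re (det (cnj_mat S))"
      unfolding sum[symmetric] by (rule det_less_det_add[OF _ nonneg h pos])
    moreover have "det (cnj_mat S) = of_real r"
      using arg_cong[OF detS, of cnj] by (simp add: det_2)
    moreover have "det (X - M) = of_real ((norm (det Y))\<^sup>2 / r)"
    proof -
      have "det (inv2 S) * det S = 1"
        using arg_cong[OF S(2), of det] by (simp add: det_mul)
      then have "det (inv2 S) = 1 / of_real r"
        using r by (simp add: detS field_simps)
      moreover have "det (cnj_mat Y) = cnj (det Y)" by (simp add: det_2)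
      ultimately show ?thesis
        unfolding fixed det_mul of_real_divide complex_norm_square by simp
    qed
    ultimately have "(norm (det Y))\<^sup>2 / r < r" by simp
    then have "(norm (det Y))\<^sup>2 < r\<^sup>2"
      using r by (simp add: divide_less_eq power2_eq_square)
    then have "norm (det Y) < r"
      by (rule power2_less_imp_less) (use r in simp)
    then show ?thesis using r by (simp add: \<theta>_def)
  qed
  then have bij: "bij_betw (I_plus_BY \<theta> Y) hermitian_mats hermitian_mats"
    by (rule I_plus_BY_bij[OF \<theta>(1)])
  have "theta_matrix X Y \<theta> = S"
    unfolding theta_matrix_def
    by (rule inv_into_f_eq) (use bij S IS in \<open>auto simp: bij_betw_def hermitian_mats_def\<close>)
  then have adm: "admissible_theta X Y \<theta>"
    using \<theta> bij M(1) by (simp add: admissible_theta_def S_def)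
  \<comment> \<open>Every admissible root yields a positive definite fixed point of
    \<open>schur_map\<close>, so uniqueness of the fixed point settles the claim without comparing
    roots.\<close>
  have all: "M = theta_matrix X Y \<theta>' - cnj_mat X" if adm': "admissible_theta X Y \<theta>'" for \<theta>'
  proof -
    define S' where "S' = theta_matrix X Y \<theta>'"
    define M' where "M' = S' - cnj_mat X"
    have b: "bij_betw (I_plus_BY \<theta>' Y) hermitian_mats hermitian_mats"
      and d: "of_real \<theta>' * det S' = 1" and M': "pos_def_hermitian M'"
      using adm' by (auto simp: admissible_theta_def S'_def M'_def)
    have "X + cnj_mat X \<in> hermitian_mats"
      using cnj_X_herm[OF K] X_herm[OF K] by (simp add: hermitian_mats_def)
    then have "I_plus_BY \<theta>' Y S' = X + cnj_mat X"
      unfolding S'_def theta_matrix_def using b by (intro f_inv_into_f) (simp add: bij_betw_def)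
    then have "schur_map X Y M' = M'"
      unfolding I_plus_BY_inv2[OF d] by (simp add: schur_map_def M'_def Y_ct[OF K] algebra_simps)
    then show ?thesis
      using schur_map_fixed_point_unique[OF K M M'] by (simp add: M'_def S'_def)
  qed
  show ?thesis
    by (intro exI[of _ M] conjI allI impI)
      (use eff M(1) fixed S(6) adm all in \<open>auto simp: S_def\<close>)
qed

end
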